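(* Let $N\ge1$ be an integer and suppose $a>\max\{0,2-N\}$. Let $h_a(x,y;t)$ be the $a$-deformed heat kernel on $\mathbb{R}^N$. Then $h_a(x,y;t)\ge0$ for all $x,y\in\mathbb{R}^N$ and $t>0$.
   Context: Normalized I-Bessel function: for $\mu\in\mathbb{R}$ and $w\in\mathbb{C}$, $\tilde I_\mu(w)=\sum_{j=0}^\infty\frac{(w/2)^{2j}}{j!\,\Gamma(\mu+j+1)}$ (with $1/\Gamma=0$ at the poles of $\Gamma$). Normalized Gegenbauer polynomials $\check C^\nu_m(t)$ are defined by the formal power series expansion $\frac{1-x^2}{(1-2tx+x^2)^{\nu+1}}=\sum_{m=0}^\infty\check C^\nu_m(t)x^m$. For $b>0$, $\nu\in\mathbb{R}$ with $1+b\nu>0$, $w\in\mathbb{C}$, $t\in[-1,1]$, $$\mathscr{I}(b,\nu,w,t):=\Gamma(b\nu+1)\sum_{m=0}^\infty\left(\frac w2\right)^{bm}\tilde I_{b(m+\nu)}(w)\,\check C^\nu_m(t),$$ where $(w/2)^s=(|w|/2)^se^{i\theta s}$ for $w=|w|e^{i\theta}$, $\theta\in(-\pi,\pi]$; the series converges absolutely and locally uniformly. For $a>\max\{0,2-N\}$ put $B_a(r\omega,s\mu)=\mathscr{I}\left(\frac2a,\frac{N-2}{2},\frac{2(rs)^{a/2}}{ai},\langle\omega,\mu\rangle\right)$ for $r,s\ge0$, $\omega,\mu\in S^{N-1}$, and $c_a=\left(\int_{\mathbb{R}^N}e^{-\frac1a|x|^a}\frac{dx}{|x|^{2-a}}\right)^{-1}$.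 The $a$-deformed heat kernel is $$h_a(x,y;t)=c_a\int_{\mathbb{R}^N}\overline{B_a(x,\xi)}\,B_a(y,\xi)\,e^{-\frac ta|\xi|^a}\frac{d\xi}{|\xi|^{2-a}}\qquad(x,y\in\mathbb{R}^N,\ t>0),$$ an absolutely convergent integral. (It is real valued.) *)

theory Defs
  imports "HOL-Analysis.Analysis"
begin

(* The power (w powr s) of the library satisfies 0 powr 0 = 0; in the series below 0^0 = 1 is
   needed.  The library's Arg takes values in the interval from -pi (excluded) to pi (included). *)
definition principal_power :: "complex \<Rightarrow> real \<Rightarrow> complex" where
  "principal_power z s = (if s = 0 then 1 else of_real (norm z powr s) * cis (Arg z * s))"

(* rGamma is 1 / Gamma, extended by 0 to the poles of Gamma. *)
definition normalized_Bessel_I :: "real \<Rightarrow> complex \<Rightarrow> complex" where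
  "normalized_Bessel_I \<mu> w =
     (\<Sum>j. (w / 2) ^ (2 * j) * of_real (rGamma (\<mu> + real j + 1) / fact j))"

(* fps_binomial c is the formal binomial series (1 + X)^c, so that the denominator is the formal
   power series (1 - 2tX + X^2)^(\<nu> + 1). *)
definition normalized_Gegenbauer :: "real \<Rightarrow> nat \<Rightarrow> real \<Rightarrow> real" where
  "normalized_Gegenbauer \<nu> m t =
     fps_nth ((1 - fps_X ^ 2) /
        fps_compose (fps_binomial (\<nu> + 1)) (fps_X ^ 2 - fps_const (2 * t) * fps_X)) m"

definition I_series :: "real \<Rightarrow> real \<Rightarrow> complex \<Rightarrow> real \<Rightarrow> complex" where
  "I_series b \<nu> w t = of_real (Gamma (b * \<nu> + 1)) *
     (\<Sum>m. principal_power (w / 2) (b * real m) *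
          normalized_Bessel_I (b * (real m + \<nu>)) w * of_real (normalized_Gegenbauer \<nu> m t))"

(* Polar coordinates x = |x| * sgn x, where sgn x = x / |x| and sgn 0 = 0.  If x or y is 0, the
   last argument of I_series is irrelevant, see the lemma B_kernel_polar below. *)
definition B_kernel :: "real \<Rightarrow> real ^ 'n \<Rightarrow> real ^ 'n \<Rightarrow> complex" where
  "B_kernel a x y = I_series (2 / a) ((real CARD('n) - 2) / 2)
     (of_real (2 * (norm x * norm y) powr (a / 2)) / (of_real a * \<i>)) (sgn x \<bullet> sgn y)"

definition c_const :: "'n::finite itself \<Rightarrow> real \<Rightarrow> real" where
  "c_const _ a =
     inverse (\<integral>x. exp (- (1 / a) * norm x powr a) / norm x powr (2 - a) \<partial>(lborel :: (real ^ 'n) measure))"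

definition heat_kernel :: "real \<Rightarrow> real ^ 'n \<Rightarrow> real ^ 'n \<Rightarrow> real \<Rightarrow> complex" where
  "heat_kernel a x y t = of_real (c_const TYPE('n) a) *
     (\<integral>\<xi>. cnj (B_kernel a x \<xi>) * B_kernel a y \<xi> *
          of_real (exp (- (t / a) * norm \<xi> powr a) / norm \<xi> powr (2 - a)) \<partial>lborel)"

lemma I_series_0:
  assumes "b > 0"
  shows "I_series b \<nu> 0 t = I_series b \<nu> 0 t'"
proof -
  have *: "normalized_Gegenbauer \<nu> 0 u = 1" for u
    by (simp add: normalized_Gegenbauer_def fps_divide_unit)
  have "principal_power 0 (b * real m) * normalized_Bessel_I (b * (real m + \<nu>)) 0 *
          of_real (normalized_Gegenbauer \<nu> m t) =
        principal_power 0 (b * real m) * normalized_Bessel_I (b * (real m + \<nu>)) 0 *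
          of_real (normalized_Gegenbauer \<nu> m t')" for m
    using assms * by (cases "m = 0") (auto simp: principal_power_def)
  then show ?thesis
    unfolding I_series_def by (simp only: div_0)
qed

lemma B_kernel_polar:
  fixes \<omega> \<mu> :: "real ^ 'n"
  assumes "a > 0" "r \<ge> 0" "s \<ge> 0" "norm \<omega> = 1" "norm \<mu> = 1"
  shows "B_kernel a (r *\<^sub>R \<omega>) (s *\<^sub>R \<mu>) = I_series (2 / a) ((real CARD('n) - 2) / 2)
           (of_real (2 * (r * s) powr (a / 2)) / (of_real a * \<i>)) (\<omega> \<bullet> \<mu>)"
proof (cases "r = 0 \<or> s = 0")
  case True
  then show ?thesis
    using assms I_series_0[of "2 / a"] by (auto simp: B_kernel_def)
next
  case False
  then show ?thesis
    using assms by (simp add: B_kernel_def sgn_div_norm)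
qed

end

theory Submission
  imports Defs
begin

text \<open>The kernel \<open>B_kernel a x \<xi>\<close> is a series of terms \<open>J\<^sub>m(|x| |\<xi>|) C\<^sub>m(\<langle>x, \<xi>\<rangle>)\<close> with a phase depending only
  on \<open>m\<close>. Since the normalised Gegenbauer polynomials are the reproducing kernels of spherical harmonics, only the
  diagonal of the product of two such series survives integration, the phases cancel, and Weber's second
  exponential integral evaluates the radial part. Up to a nonnegative factor the heat kernel becomes
  \<open>\<Sum>\<^sub>m I\<^sub>b\<^sub>(\<^sub>m\<^sub>+\<^sub>\<nu>\<^sub>)(w) C\<^sub>m(t)\<close> with \<open>w \<ge> 0\<close>.

  This series solves an elliptic equation in \<open>(w, t)\<close> that obeys a minimum principle. If every \<open>I\<^sub>\<mu>(w)\<close> is divided by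
  \<open>I\<^sub>\<mu>(w\<^sub>0)\<close> and damped by \<open>r\<^sup>m\<close>, then the boundary value at \<open>w = w\<^sub>0\<close> is the Poisson kernel, which is
  positive; truncation keeps it positive and makes all sums finite. Since \<open>I\<^sub>\<mu>(w\<^sub>0) / I\<^sub>\<mu>\<^sub>'(w\<^sub>0) \<rightarrow> 1\<close> as
  \<open>w\<^sub>0 \<rightarrow> \<infinity>\<close>, the normalisation can be removed, and then the truncation and the damping.\<close>

section \<open>Bessel-Clifford functions\<close>

text \<open>The values C_m(t) change sign, so the final series is not positive term by term; this is
  what calls for a minimum principle. On the side w = 0 no boundary data are prescribed: the terms
  with m >= 1 tend to 0 there, while the term m = 0, whose order b \<nu> may be negative, has a
  nonnegative coefficient. With b = 2/a and \<nu> = (N - 2)/2 the condition a > 2 - N says exactly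
  that b \<nu> > -1. Then all orders exceed -1, all values of 1/\<Gamma> in the series are positive
  and the radial integrals converge. In dimension 1 one has \<nu> = -1/2, the least value for which
  the equation in t has the right sign at t = 1 and t = -1. The reproducing property is a polynomial
  identity in the inner product of two unit vectors. It is derived from Gaussian moments, because
  Gaussian integration by parts takes place in flat space and its recursion is purely algebraic;
  polar coordinates carry the result over to the sphere.\<close>

lemma
  fixes s \<tau> :: real
  assumes "s > -1" "\<tau> > 0"
  shows Gamma_real_integrable:
      "integrable lborel (\<lambda>z. indicator {0<..} z * (z powr s * exp (- (\<tau> * z))))" (is "integrable lborel ?g")
    and Gamma_real_integral_eq:
      "(\<integral>z. indicator {0<..} z * (z powr s * exp (- (\<tau> * z))) \<partial>lborel) = Gamma (s + 1) / \<tau> powr (s + 1)" (is ?B)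
proof -
  let ?h = "\<lambda>z. ennreal (indicator {0..} z * z powr (s + 1 - 1) / exp z)"
  have G: "Gamma (s + 1) > 0"
    using assms by (intro Gamma_real_pos) auto
  have "(\<integral>\<^sup>+z. ennreal (?g z) \<partial>lborel) =
        (\<integral>\<^sup>+z. ?h z \<partial>lborel) / ennreal (\<tau> powr (s + 1))"
  proof -
    have "(\<integral>\<^sup>+z. ?h z \<partial>lborel) =
      ennreal \<bar>\<tau>\<bar> * (\<integral>\<^sup>+z. ennreal (indicator {0..} (0 + \<tau> * z) * (0 + \<tau> * z) powr (s + 1 - 1) / exp (0 + \<tau> * z)) \<partial>lborel)"
      using assms by (intro nn_integral_real_affine) auto
    also have "\<dots> = (\<integral>\<^sup>+z. ennreal (\<tau> * (indicator {0..} (\<tau> * z) * (\<tau> * z) powr s / exp (\<tau> * z))) \<partial>lborel)"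
      using assms by (subst nn_integral_cmult [symmetric])
        (auto simp: ennreal_mult[symmetric] intro!: nn_integral_cong)
    also have "\<dots> = (\<integral>\<^sup>+z. ennreal (\<tau> powr (s + 1)) * ennreal (?g z) \<partial>lborel)"
      using assms
      by (intro nn_integral_cong)
        (auto simp: ennreal_mult[symmetric] indicator_def powr_mult powr_add exp_minus field_simps
          zero_le_mult_iff)
    also have "\<dots> = ennreal (\<tau> powr (s + 1)) * (\<integral>\<^sup>+z. ennreal (?g z) \<partial>lborel)"
      by (intro nn_integral_cmult) auto
    finally show ?thesis
      using assms by (simp only: mult.commute[of "ennreal (\<tau> powr (s + 1))"]) (simp add: ennreal_mult_divide_eq)
  qed
  also have "\<dots> = ennreal (Gamma (s + 1)) / ennreal (\<tau> powr (s + 1))"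
    using Gamma_conv_nn_integral_real[of "s + 1"] assms
    by (simp add: nn_integral_set_ennreal mult.commute)
  also have "\<dots> = ennreal (Gamma (s + 1) / \<tau> powr (s + 1))"
    using G assms by (simp add: divide_ennreal)
  finally have *: "(\<integral>\<^sup>+z. ennreal (?g z) \<partial>lborel) =
    ennreal (Gamma (s + 1) / \<tau> powr (s + 1))" .
  show "integrable lborel ?g"
    using * by (intro integrableI_nonneg) auto
  show ?B
    using * G by (intro integral_eq_nn_integral[THEN trans]) auto
qed

text \<open>Restrict Euler's integral to z > T. There z^s >= T^s, and e^(-z) <= 1/z <= z^\<mu>, so
  the remaining integrand is at least e^(-2z). The bound is uniform in \<mu>, and the free parameter
  T later makes 1/\<Gamma> decay geometrically at any prescribed rate.\<close>

lemma Gamma_ge_powr: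
  fixes \<mu> s T :: real
  assumes "\<mu> > -1" "s \<ge> 0" "T \<ge> 1"
  shows "Gamma (\<mu> + 1 + s) \<ge> T powr s * exp (- 2 * T) / 2"
proof -
  let ?f = "\<lambda>z::real. indicator {0<..} z * (z powr 0 * exp (- (2 * z)))"
  have 1: "(\<integral>z. indicator {T<..} z * (T powr s * exp (- (2 * z))) \<partial>lborel) = T powr s * exp (- 2 * T) / 2"
  proof -
    have "(\<integral>z. indicator {T<..} z * (T powr s * exp (- (2 * z))) \<partial>lborel) =
      (\<integral>z. indicator {T<..} (T + 1 * z) * (T powr s * exp (- (2 * (T + 1 * z)))) \<partial>lborel)"
      by (subst lborel_integral_real_affine[where c = 1 and t = T]) auto
    also have "\<dots> = (\<integral>z. (T powr s * exp (- 2 * T)) * ?f z \<partial>lborel)"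
      by (intro Bochner_Integration.integral_cong) (auto simp: indicator_def exp_add[symmetric] algebra_simps)
    also have "\<dots> = (T powr s * exp (- 2 * T)) * (\<integral>z. ?f z \<partial>lborel)"
      by (rule integral_mult_right_zero)
    also have "(\<integral>z. ?f z \<partial>lborel) = 1 / 2"
      using Gamma_real_integral_eq[of 0 2] by simp
    finally show ?thesis by simp
  qed
  have 2: "integrable lborel (\<lambda>z. indicator {T<..} z * (T powr s * exp (- (2 * z))))"
    by (rule Bochner_Integration.integrable_bound
          [OF integrable_mult_right[OF Gamma_real_integrable[of 0 2], of "T powr s"]])
      (use assms in \<open>auto simp: indicator_def\<close>)
  have "indicator {T<..} z * (T powr s * exp (- (2 * z))) \<le>
        indicator {0<..} z * (z powr (\<mu> + s) * exp (- (1 * z)))" for z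
  proof (cases "z > T")
    case True
    have "exp (- z) \<le> z powr (- 1)"
      using True assms by (simp add: powr_minus exp_minus) (use exp_ge_add_one_self[of z] in linarith)
    also have "\<dots> \<le> z powr \<mu>"
      using True assms by (intro powr_mono) auto
    finally have "T powr s * exp (- z) \<le> z powr s * z powr \<mu>"
      using True assms by (intro mult_mono powr_mono2) auto
    then have "T powr s * exp (- z) * exp (- z) \<le> z powr s * z powr \<mu> * exp (- z)"
      by (intro mult_right_mono) auto
    moreover have "exp (- (2 * z)) = exp (- z) * exp (- z)"
      by (simp add: exp_add[symmetric])
    ultimately show ?thesis
      using True assms by (simp add: powr_add mult_ac)
  qed auto
  then have "(\<integral>z. indicator {T<..} z * (T powr s * exp (- (2 * z))) \<partial>lborel) \<le>
     (\<integral>z. indicator {0<..} z * (z powr (\<mu> + s) * exp (- (1 * z))) \<partial>lborel)"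
    using assms by (intro integral_mono 2 Gamma_real_integrable) auto
  also have "\<dots> = Gamma (\<mu> + 1 + s)"
    using assms by (subst Gamma_real_integral_eq) (auto simp: algebra_simps)
  finally show ?thesis
    unfolding 1 .
qed

text \<open>Log-convexity of Gamma on the segment from x to x + 1, at the point with weight
  s.\<close>

lemma Gamma_add_le:
  fixes x s :: real
  assumes "x > 0" "0 \<le> s" "s \<le> 1"
  shows "Gamma (x + s) \<le> x powr s * Gamma x"
proof -
  have G: "Gamma x > 0" "Gamma (x + 1) > 0" "Gamma (x + s) > 0"
    using assms by (auto intro!: Gamma_real_pos)
  then have G0: "Gamma x \<noteq> 0"
    by simp
  have "(ln \<circ> Gamma) ((1 - s) *\<^sub>R x + s *\<^sub>R (x + 1)) \<le> (1 - s) * (ln \<circ> Gamma) x + s * (ln \<circ> Gamma) (x + 1)"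
    using assms by (intro convex_onD[OF log_convex_Gamma_real]) auto
  then have "ln (Gamma (x + s)) \<le> (1 - s) * ln (Gamma x) + s * ln (Gamma (x + 1))"
    by (simp add: algebra_simps)
  also have "Gamma (x + 1) = x * Gamma x"
    using assms by (intro Gamma_plus1) (auto elim!: nonpos_Ints_cases)
  also have "ln (x * Gamma x) = ln x + ln (Gamma x)"
    using assms G0 by (simp add: ln_mult)
  finally have "ln (Gamma (x + s)) \<le> s * ln x + ln (Gamma x)"
    by (simp add: algebra_simps)
  also have "\<dots> = ln (x powr s * Gamma x)"
    using assms G0 by (simp add: ln_mult ln_powr)
  finally show ?thesis
    using G assms by (subst (asm) ln_le_cancel_iff) auto
qed

text \<open>At (w/2)^2 this is the normalized I-Bessel function of w. As a function of the square it
  stays real on both axes: negative z serves the kernel, whose argument is imaginary, and positive z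
  the result of Weber's integral.\<close>

definition Bessel_Clifford :: "real \<Rightarrow> real \<Rightarrow> real" where
  "Bessel_Clifford \<mu> z = (\<Sum>j. rGamma (\<mu> + real j + 1) / fact j * z ^ j)"

lemma rGamma_pos:
  fixes x :: real
  assumes "x > 0"
  shows "rGamma x > 0"
  using Gamma_real_pos[OF assms] by (simp add: rGamma_inverse_Gamma)

lemma rGamma_le:
  fixes \<mu> s T :: real
  assumes "\<mu> > -1" "s \<ge> 0" "T \<ge> 1"
  shows "rGamma (\<mu> + 1 + s) \<le> 2 * exp (2 * T) / T powr s"
proof -
  have "inverse (Gamma (\<mu> + 1 + s)) \<le> inverse (T powr s * exp (- 2 * T) / 2)"
    using Gamma_ge_powr[OF assms] assms by (intro le_imp_inverse_le) auto
  also have "\<dots> = 2 * exp (2 * T) / T powr s"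
    by (simp add: exp_minus field_simps)
  finally show ?thesis
    by (simp add: rGamma_inverse_Gamma)
qed

lemma rGamma_le_nat:
  fixes \<mu> s T :: real
  assumes "\<mu> > -1" "s \<ge> 0" "T \<ge> 1"
  shows "rGamma (\<mu> + s + real j + 1) \<le> 2 * exp (2 * T) / T powr s * inverse T ^ j"
  using rGamma_le[of \<mu> "s + real j" T] assms
  by (simp add: powr_add powr_realpow field_simps)

text \<open>By \<open>rGamma_le_nat\<close> the term of index j is at most a constant times
  (|z|/T)^j / j!, so an exponential series dominates. The factor \<open>T powr s\<close> in the
  denominator is what later compensates a growing power of v.\<close>

lemma Bessel_Clifford_sums_abs:
  fixes \<mu> s T z :: real
  assumes "\<mu> > -1" "s \<ge> 0" "T \<ge> 1"
  shows "summable (\<lambda>j. \<bar>rGamma (\<mu> + s + real j + 1) / fact j * z ^ j\<bar>)" (is ?A)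
    and "(\<Sum>j. \<bar>rGamma (\<mu> + s + real j + 1) / fact j * z ^ j\<bar>) \<le> 2 * exp (2 * T) / T powr s * exp (\<bar>z\<bar> / T)" (is ?B)
proof -
  have le: "\<bar>rGamma (\<mu> + s + real j + 1) / fact j * z ^ j\<bar> \<le>
      2 * exp (2 * T) / T powr s * (inverse (fact j) * (\<bar>z\<bar> / T) ^ j)" for j
  proof -
    have "rGamma (\<mu> + s + real j + 1) > 0"
      using assms by (intro rGamma_pos) auto
    then have "\<bar>rGamma (\<mu> + s + real j + 1) / fact j * z ^ j\<bar> =
        rGamma (\<mu> + s + real j + 1) * (\<bar>z\<bar> ^ j / fact j)"
      by (simp add: abs_mult power_abs)
    also have "\<dots> \<le> 2 * exp (2 * T) / T powr s * inverse T ^ j * (\<bar>z\<bar> ^ j / fact j)"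
      using rGamma_le_nat[OF assms] by (intro mult_right_mono) auto
    finally show ?thesis
      by (simp add: field_simps)
  qed
  have E: "(\<lambda>j. inverse (fact j) * (\<bar>z\<bar> / T) ^ j) sums exp (\<bar>z\<bar> / T)"
    using exp_converges[of "\<bar>z\<bar> / T"] by simp
  show S: ?A
    by (rule summable_comparison_test'
        [where g = "\<lambda>j. 2 * exp (2 * T) / T powr s * (inverse (fact j) * (\<bar>z\<bar> / T) ^ j)",
          OF summable_mult[OF sums_summable[OF E]]]) (use le in auto)
  show ?B
    by (rule sums_le[OF le summable_sums[OF S] sums_mult[OF E]])
qed

lemma summable_Bessel_Clifford:
  assumes "\<mu> > -1"
  shows "summable (\<lambda>j. rGamma (\<mu> + real j + 1) / fact j * z ^ j)"
  using Bessel_Clifford_sums_abs(1)[of \<mu> 0 1 z] assms summable_rabs_cancel by fastforce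

lemma abs_Bessel_Clifford_le:
  assumes "\<mu> > -1" "s \<ge> 0" "T \<ge> 1"
  shows "\<bar>Bessel_Clifford (\<mu> + s) z\<bar> \<le> 2 * exp (2 * T) / T powr s * exp (\<bar>z\<bar> / T)"
  unfolding Bessel_Clifford_def
  using summable_rabs[OF Bessel_Clifford_sums_abs(1)[OF assms]] Bessel_Clifford_sums_abs(2)[OF assms]
  by (rule order_trans)

text \<open>The choice \<open>T = 1 + \<kappa> v\<close> in the preceding bound.\<close>

lemma powr_mult_Bessel_Clifford_le:
  assumes "\<mu> > -1" "s \<ge> 0" "v \<ge> 0" "\<kappa> \<ge> 1" "\<bar>z\<bar> = v\<^sup>2"
  shows "v powr s * \<bar>Bessel_Clifford (\<mu> + s) z\<bar> \<le> 2 * exp (2 + (2 * \<kappa> + 1) * v) * \<kappa> powr (- s)"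
proof -
  define T where "T = 1 + \<kappa> * v"
  have T: "T \<ge> 1" "\<kappa> * v \<le> T"
    using assms by (auto simp: T_def)
  have "v\<^sup>2 \<le> v * T"
    using assms T mult_right_mono[of 1 \<kappa> v] unfolding power2_eq_square
    by (intro mult_left_mono) auto
  then have "\<bar>z\<bar> / T \<le> v"
    using T assms by (simp add: field_simps)
  have "v powr s \<le> (T / \<kappa>) powr s"
    using T assms by (intro powr_mono2) (auto simp: field_simps)
  also have "\<dots> = T powr s * \<kappa> powr (- s)"
    using T assms by (simp add: powr_divide powr_minus field_simps)
  finally have "v powr s * \<bar>Bessel_Clifford (\<mu> + s) z\<bar> \<le>
      (T powr s * \<kappa> powr (- s)) * (2 * exp (2 * T) / T powr s * exp (\<bar>z\<bar> / T))"
    using T assms abs_Bessel_Clifford_le[of \<mu> s T z] by (intro mult_mono) auto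
  also have "\<dots> = 2 * (exp (2 * T) * exp (\<bar>z\<bar> / T)) * \<kappa> powr (- s)"
    using T by simp
  also have "\<dots> \<le> 2 * (exp (2 * T) * exp v) * \<kappa> powr (- s)"
    using \<open>\<bar>z\<bar> / T \<le> v\<close> by (intro mult_mono) auto
  also have "exp (2 * T) * exp v = exp (2 + (2 * \<kappa> + 1) * v)"
    unfolding T_def exp_add[symmetric] by (simp add: algebra_simps)
  finally show ?thesis .
qed

lemma Bessel_Clifford_pos:
  assumes "\<mu> > -1" "z \<ge> 0"
  shows "Bessel_Clifford \<mu> z > 0"
proof -
  have "0 < (\<Sum>j\<in>{0}. rGamma (\<mu> + real j + 1) / fact j * z ^ j)"
    using assms by (auto intro!: rGamma_pos)
  also have "\<dots> \<le> Bessel_Clifford \<mu> z"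
    unfolding Bessel_Clifford_def
    using assms by (intro sum_le_suminf summable_Bessel_Clifford)
      (auto intro!: mult_nonneg_nonneg divide_nonneg_pos less_imp_le[OF rGamma_pos])
  finally show ?thesis .
qed

lemma DERIV_Bessel_Clifford:
  assumes "\<mu> > -1"
  shows "(Bessel_Clifford \<mu> has_real_derivative Bessel_Clifford (\<mu> + 1) z) (at z)"
proof -
  have "((\<lambda>z. \<Sum>j. rGamma (\<mu> + real j + 1) / fact j * z ^ j) has_real_derivative
      (\<Sum>j. diffs (\<lambda>j. rGamma (\<mu> + real j + 1) / fact j) j * z ^ j)) (at z)"
    using assms by (intro termdiffs_strong_converges_everywhere summable_Bessel_Clifford)
  also have "diffs (\<lambda>j. rGamma (\<mu> + real j + 1) / fact j) = (\<lambda>j. rGamma (\<mu> + 1 + real j + 1) / fact j)"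
    by (auto simp: diffs_def fun_eq_iff field_simps simp del: of_nat_Suc) (simp add: algebra_simps)?
  finally show ?thesis
    unfolding Bessel_Clifford_def .
qed

lemma Bessel_Clifford_sums:
  assumes "\<mu> > -1"
  shows "(\<lambda>j. rGamma (\<mu> + real j + 1) / fact j * z ^ j) sums Bessel_Clifford \<mu> z"
  unfolding Bessel_Clifford_def using summable_Bessel_Clifford[OF assms] by (rule summable_sums)

lemma index_Bessel_Clifford_sums:
  assumes "\<mu> > -1"
  shows "(\<lambda>j. real j * (rGamma (\<mu> + real j + 1) / fact j * z ^ j)) sums (z * Bessel_Clifford (\<mu> + 1) z)"
proof -
  have "(\<lambda>j. z * (rGamma (\<mu> + 1 + real j + 1) / fact j * z ^ j)) sums (z * Bessel_Clifford (\<mu> + 1) z)"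
    using assms by (intro sums_mult Bessel_Clifford_sums) auto
  also have "(\<lambda>j. z * (rGamma (\<mu> + 1 + real j + 1) / fact j * z ^ j)) =
     (\<lambda>j. real (Suc j) * (rGamma (\<mu> + real (Suc j) + 1) / fact (Suc j) * z ^ Suc j))"
    by (auto simp: fun_eq_iff divide_simps)
  finally show ?thesis
    by (subst (asm) sums_Suc_iff) simp
qed

lemma Bessel_order_gt:
  fixes b \<nu> :: real
  assumes "b > 0" "b * \<nu> > -1"
  shows "b * (real m + \<nu>) > -1"
proof -
  have "b * real m \<ge> 0"
    using assms(1) by simp
  then show ?thesis
    unfolding distrib_left using assms(2) by linarith
qed

text \<open>Multiplying the terms of order \<mu> + 1 by j + (\<mu> + 1) lowers the order, by the
  functional equation of 1/\<Gamma>. As differentiation raises the order by one, this is Bessel's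
  differential equation in disguise.\<close>

lemma Bessel_Clifford_rec:
  assumes "\<mu> > -1"
  shows "z * Bessel_Clifford (\<mu> + 2) z + (\<mu> + 1) * Bessel_Clifford (\<mu> + 1) z = Bessel_Clifford \<mu> z"
proof -
  define c where "c j = rGamma (\<mu> + 1 + real j + 1) / fact j * z ^ j" for j
  have "(\<lambda>j. real j * c j + (\<mu> + 1) * c j) sums
        (z * Bessel_Clifford (\<mu> + 1 + 1) z + (\<mu> + 1) * Bessel_Clifford (\<mu> + 1) z)"
    unfolding c_def using assms
    by (intro sums_add sums_mult index_Bessel_Clifford_sums Bessel_Clifford_sums) auto
  moreover have "real j * c j + (\<mu> + 1) * c j = rGamma (\<mu> + real j + 1) / fact j * z ^ j" for j
  proof -
    have "rGamma (\<mu> + real j + 1) = (\<mu> + real j + 1) * rGamma (\<mu> + 1 + real j + 1)"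
      using rGamma_plus1[of "\<mu> + real j + 1"] by (simp add: algebra_simps)
    then show ?thesis
      by (simp add: c_def field_simps)
  qed
  ultimately show ?thesis
    using sums_unique2[OF _ Bessel_Clifford_sums[OF assms]] by (simp add: add.assoc)
qed

text \<open>The factor j (j + \<mu>) undoes one step of the factorial and one of Gamma, so that the
  term of index j + 1 becomes z times the term of index j.\<close>

lemma quadratic_index_Bessel_Clifford_sums:
  assumes "\<mu> > -1"
  shows "(\<lambda>j. real j * (real j + \<mu>) * (rGamma (\<mu> + real j + 1) / fact j * z ^ j)) sums (z * Bessel_Clifford \<mu> z)"
proof -
  have "(\<lambda>j. z * (rGamma (\<mu> + real j + 1) / fact j * z ^ j)) sums (z * Bessel_Clifford \<mu> z)"
    using assms by (intro sums_mult Bessel_Clifford_sums) auto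
  also have "(\<lambda>j. z * (rGamma (\<mu> + real j + 1) / fact j * z ^ j)) =
     (\<lambda>j. real (Suc j) * (real (Suc j) + \<mu>) * (rGamma (\<mu> + real (Suc j) + 1) / fact (Suc j) * z ^ Suc j))"
  proof
    fix j
    have "rGamma (\<mu> + real j + 1) = (real (Suc j) + \<mu>) * rGamma (\<mu> + real (Suc j) + 1)"
      using rGamma_plus1[of "\<mu> + real j + 1"] by (simp add: algebra_simps)
    then show "z * (rGamma (\<mu> + real j + 1) / fact j * z ^ j) =
        real (Suc j) * (real (Suc j) + \<mu>) * (rGamma (\<mu> + real (Suc j) + 1) / fact (Suc j) * z ^ Suc j)"
      by (simp add: divide_simps)
  qed
  finally show ?thesis
    by (subst (asm) sums_Suc_iff) simp
qed

section \<open>The modified Bessel equation in the logarithmic variable\<close>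

lemma DERIV_Bessel_exp:
  assumes "\<mu> > -1"
  shows "((\<lambda>x. exp (\<mu> * x) * Bessel_Clifford \<mu> (exp (2 * x))) has_real_derivative
      exp (\<mu> * x) * (\<mu> * Bessel_Clifford \<mu> (exp (2 * x)) + 2 * exp (2 * x) * Bessel_Clifford (\<mu> + 1) (exp (2 * x)))) (at x)"
  using assms
  by (auto intro!: derivative_eq_intros DERIV_chain2[OF DERIV_Bessel_Clifford] simp: algebra_simps)

text \<open>With v = e^x the function is the modified Bessel function of order \<mu> at 2v, and v
  d/dv becomes d/dx, which removes the first-order term of its equation. The order enters only
  through the additive constant \<mu>^2; this allows a sum over different orders to satisfy one
  common equation.\<close>

lemma DERIV2_Bessel_exp:
  assumes "\<mu> > -1"
  shows "((\<lambda>x. exp (\<mu> * x) * (\<mu> * Bessel_Clifford \<mu> (exp (2 * x)) + 2 * exp (2 * x) * Bessel_Clifford (\<mu> + 1) (exp (2 * x))))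
     has_real_derivative (4 * exp (2 * x) + \<mu>\<^sup>2) * (exp (\<mu> * x) * Bessel_Clifford \<mu> (exp (2 * x)))) (at x)"
    (is "(?f has_real_derivative ?D) _")
proof -
  define z where "z = exp (2 * x)"
  have rec: "Bessel_Clifford \<mu> z = z * Bessel_Clifford (\<mu> + 2) z + (\<mu> + 1) * Bessel_Clifford (\<mu> + 1) z"
    using Bessel_Clifford_rec[OF assms] by simp
  have "(?f has_real_derivative exp (\<mu> * x) * \<mu> * (\<mu> * Bessel_Clifford \<mu> z + 2 * z * Bessel_Clifford (\<mu> + 1) z)
     + exp (\<mu> * x) * (\<mu> * (Bessel_Clifford (\<mu> + 1) z * (2 * z)) + 4 * z * Bessel_Clifford (\<mu> + 1) z +
         2 * z * (Bessel_Clifford (\<mu> + 1 + 1) z * (2 * z)))) (at x)" (is "(_ has_real_derivative ?D') _")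
    using assms unfolding z_def
    by (auto intro!: derivative_eq_intros DERIV_chain2[OF DERIV_Bessel_Clifford] simp: algebra_simps)
  moreover have "?D' = ?D"
    unfolding z_def[symmetric] rec by (simp add: algebra_simps power2_eq_square)
  ultimately show ?thesis
    by simp
qed

text \<open>Regard the terms of the series of \<open>Bessel_Clifford \<mu> (v\<^sup>2)\<close> as weights on the index \<open>j\<close>, with
  normalised mean \<open>E\<close>. Then \<open>E (j (j + \<mu>)) = v\<^sup>2\<close>, and \<open>E j\<close> is \<open>v\<close> times the ratio of the modified Bessel
  functions of orders \<open>\<mu> + 1\<close> and \<open>\<mu>\<close>; so \<open>2 v j \<le> j\<^sup>2 + v\<^sup>2\<close> bounds this ratio.\<close>

lemma Bessel_Clifford_succ_le:
  assumes "\<mu> > -1" "v \<ge> 1"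
  shows "v * Bessel_Clifford (\<mu> + 1) (v\<^sup>2) \<le> (1 + 1 / v) * Bessel_Clifford \<mu> (v\<^sup>2)"
proof -
  define A where "A = Bessel_Clifford \<mu> (v\<^sup>2)"
  define e where "e = v\<^sup>2 * Bessel_Clifford (\<mu> + 1) (v\<^sup>2)"
  define w where "w j = rGamma (\<mu> + real j + 1) / fact j * (v\<^sup>2) ^ j" for j
  have w: "w j \<ge> 0" for j
    unfolding w_def using assms by (intro mult_nonneg_nonneg divide_nonneg_pos less_imp_le[OF rGamma_pos]) auto
  have A: "A > 0"
    unfolding A_def using assms by (intro Bessel_Clifford_pos) auto
  have s0: "w sums A"
    unfolding w_def A_def using assms by (intro Bessel_Clifford_sums)
  have s1: "(\<lambda>j. real j * w j) sums e"
    unfolding w_def e_def using assms by (intro index_Bessel_Clifford_sums)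
  have s2: "(\<lambda>j. real j * (real j + \<mu>) * w j) sums (v\<^sup>2 * A)"
    unfolding w_def A_def using assms by (intro quadratic_index_Bessel_Clifford_sums)
  have "2 * v * e \<le> v\<^sup>2 * A + (- \<mu>) * e + v\<^sup>2 * A"
  proof (rule sums_le)
    show "(\<lambda>j. 2 * v * (real j * w j)) sums (2 * v * e)"
      by (intro sums_mult s1)
    show "(\<lambda>j. real j * (real j + \<mu>) * w j + (- \<mu>) * (real j * w j) + v\<^sup>2 * w j) sums
      (v\<^sup>2 * A + (- \<mu>) * e + v\<^sup>2 * A)"
      by (intro sums_add sums_mult s0 s1 s2)
    fix j
    have "0 \<le> (real j - v)\<^sup>2 * w j"
      using w by auto
    then show "2 * v * (real j * w j) \<le> real j * (real j + \<mu>) * w j + (- \<mu>) * (real j * w j) + v\<^sup>2 * w j"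
      by (simp add: power2_eq_square algebra_simps)
  qed
  moreover have "e > 0"
    unfolding e_def using assms by (auto intro!: mult_pos_pos Bessel_Clifford_pos)
  \<comment> \<open>Here \<mu> > -1 makes the final bound independent of the order.\<close>
  then have "(- \<mu>) * e \<le> 1 * e"
    using assms by (intro mult_right_mono) auto
  ultimately have "(2 * v - 1) * e \<le> 2 * v\<^sup>2 * A"
    by (simp add: algebra_simps)
  \<comment> \<open>The difference of the two factors is (2v - 1)(v + 1) - 2v^2 = v - 1, nonnegative
    since v >= 1.\<close>
  also have "\<dots> \<le> (2 * v - 1) * (v + 1) * A"
    using assms A by (intro mult_right_mono) (auto simp: algebra_simps power2_eq_square)
  finally have "e \<le> (v + 1) * A"
    using assms by (simp add: mult.assoc)
  then show ?thesis
    using assms unfolding e_def A_def by (simp add: field_simps power2_eq_square)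
qed

text \<open>Put x = \<mu> + j + 1. Log-convexity gives 1/\<Gamma>(x) <= x^s / \<Gamma>(x + s), and
  (v/x)^s >= 1 - s (x/v - 1) is a lower bound linear in j. After summation only the mean of the
  index j is left, and \<open>Bessel_Clifford_succ_le\<close> bounds it.\<close>

lemma powr_mult_Bessel_Clifford_ge:
  assumes "\<mu> > -1" "v \<ge> 1" "0 \<le> s" "s \<le> 1"
  shows "(1 - s * (\<mu> + 2) / v) * Bessel_Clifford \<mu> (v\<^sup>2) \<le> v powr s * Bessel_Clifford (\<mu> + s) (v\<^sup>2)"
proof -
  define A where "A = Bessel_Clifford \<mu> (v\<^sup>2)"
  define e where "e = v\<^sup>2 * Bessel_Clifford (\<mu> + 1) (v\<^sup>2)"
  define w where "w j = rGamma (\<mu> + real j + 1) / fact j * (v\<^sup>2) ^ j" for j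
  have s0: "w sums A"
    unfolding w_def A_def using assms by (intro Bessel_Clifford_sums)
  have s1: "(\<lambda>j. real j * w j) sums e"
    unfolding w_def e_def using assms by (intro index_Bessel_Clifford_sums)
  have "e = v * (v * Bessel_Clifford (\<mu> + 1) (v\<^sup>2))"
    by (simp add: e_def power2_eq_square)
  also have "\<dots> \<le> v * ((1 + 1 / v) * A)"
    unfolding A_def using assms by (intro mult_left_mono Bessel_Clifford_succ_le) auto
  also have "\<dots> = (v + 1) * A"
    using assms by (simp add: divide_simps algebra_simps)
  finally have e: "e \<le> (v + 1) * A" .
  have "(1 + s - s * (\<mu> + 1) / v) * A - s / v * e \<le> v powr s * Bessel_Clifford (\<mu> + s) (v\<^sup>2)"
  proof (rule sums_le)
    show "(\<lambda>j. (1 + s - s * (\<mu> + 1) / v) * w j - s / v * (real j * w j)) sums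
       ((1 + s - s * (\<mu> + 1) / v) * A - s / v * e)"
      by (intro sums_diff sums_mult s0 s1)
    show "(\<lambda>j. v powr s * (rGamma (\<mu> + s + real j + 1) / fact j * (v\<^sup>2) ^ j)) sums
       (v powr s * Bessel_Clifford (\<mu> + s) (v\<^sup>2))"
      using assms by (intro sums_mult Bessel_Clifford_sums) auto
    fix j
    define x where "x = \<mu> + real j + 1"
    have x: "x > 0"
      using assms by (auto simp: x_def)
    have r: "rGamma x > 0" "rGamma (x + s) > 0"
      using x assms by (auto intro!: rGamma_pos)
    have "rGamma x \<le> x powr s * rGamma (x + s)"
      using Gamma_add_le[OF x assms(3,4)] r by (simp add: rGamma_inverse_Gamma field_simps)
    moreover have "1 - s * (x / v - 1) \<le> (v / x) powr s"
    proof -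
      have "ln (x / v) \<le> x / v - 1"
        using x assms by (intro ln_le_minus_one) auto
      then have "s * ln (x / v) \<le> s * (x / v - 1)"
        using assms by (intro mult_left_mono) auto
      moreover have "ln (v / x) = - ln (x / v)"
        using x assms by (simp add: ln_div)
      ultimately have "1 - s * (x / v - 1) \<le> 1 + s * ln (v / x)"
        by simp
      also have "\<dots> \<le> exp (s * ln (v / x))"
        by (rule exp_ge_add_one_self)
      finally show ?thesis
        using x assms by (simp add: powr_def)
    qed
    ultimately have "(1 - s * (x / v - 1)) * rGamma x \<le> (v / x) powr s * (x powr s * rGamma (x + s))"
      using r x assms by (intro mult_mono) auto
    also have "\<dots> = v powr s * rGamma (x + s)"
      using x assms by (simp add: powr_divide)
    finally have "(1 - s * (x / v - 1)) * rGamma x * ((v\<^sup>2) ^ j / fact j) \<le>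
        v powr s * rGamma (x + s) * ((v\<^sup>2) ^ j / fact j)"
      by (intro mult_right_mono) auto
    then show "(1 + s - s * (\<mu> + 1) / v) * w j - s / v * (real j * w j) \<le>
        v powr s * (rGamma (\<mu> + s + real j + 1) / fact j * (v\<^sup>2) ^ j)"
      using assms unfolding x_def w_def by (simp add: algebra_simps add_divide_distrib diff_divide_distrib)
  qed
  moreover have "s / v * e \<le> s / v * ((v + 1) * A)"
    using assms e by (intro mult_left_mono) auto
  moreover have "s / v * ((v + 1) * A) = s * A + s / v * A"
    using assms by (simp add: divide_simps algebra_simps)
  moreover have "(1 + s - s * (\<mu> + 1) / v) * A - (s * A + s / v * A) = (1 - s * (\<mu> + 2) / v) * A"
    by (simp add: algebra_simps add_divide_distrib)
  ultimately show ?thesis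
    unfolding A_def[symmetric] by linarith
qed

text \<open>The modified Bessel function \<open>I\<^sub>\<mu>\<close> at \<open>2 v\<close>.\<close>

definition Bessel_I :: "real \<Rightarrow> real \<Rightarrow> real" where
  "Bessel_I \<mu> v = v powr \<mu> * Bessel_Clifford \<mu> (v\<^sup>2)"

lemma Bessel_I_pos: "\<mu> > -1 \<Longrightarrow> v > 0 \<Longrightarrow> Bessel_I \<mu> v > 0"
  by (auto simp: Bessel_I_def intro!: mult_pos_pos Bessel_Clifford_pos)

section \<open>Ratios of modified Bessel functions of large argument\<close>

lemma Bessel_I_ratio_ge:
  assumes "\<mu> > -1" "v \<ge> 1" "0 \<le> s" "s \<le> 1"
  shows "1 - s * (\<mu> + 2) / v \<le> Bessel_I (\<mu> + s) v / Bessel_I \<mu> v"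
proof -
  have "v powr \<mu> * ((1 - s * (\<mu> + 2) / v) * Bessel_Clifford \<mu> (v\<^sup>2)) \<le>
        v powr \<mu> * (v powr s * Bessel_Clifford (\<mu> + s) (v\<^sup>2))"
    using powr_mult_Bessel_Clifford_ge[OF assms] by (intro mult_left_mono) auto
  then have "(1 - s * (\<mu> + 2) / v) * Bessel_I \<mu> v \<le> Bessel_I (\<mu> + s) v"
    by (simp add: Bessel_I_def powr_add mult_ac)
  moreover have "Bessel_I \<mu> v > 0"
    using assms by (intro Bessel_I_pos) auto
  ultimately show ?thesis
    by (simp add: pos_le_divide_eq)
qed

text \<open>The upper bound is a lower bound in disguise: divide the ratio of orders \<mu> + 1 and
  \<mu>, at most 1 + 1/v, by the ratio of orders \<mu> + 1 and \<mu> + s, to which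
  \<open>Bessel_I_ratio_ge\<close> applies with step 1 - s.\<close>

lemma tendsto_Bessel_I_ratio_aux:
  assumes "\<mu> > -1" "0 \<le> s" "s \<le> 1"
  shows "((\<lambda>v. Bessel_I (\<mu> + s) v / Bessel_I \<mu> v) \<longlongrightarrow> 1) at_top"
proof -
  have lim: "((\<lambda>v::real. 1 - c / v) \<longlongrightarrow> 1) at_top" for c
    using tendsto_diff[OF tendsto_const[of 1] tendsto_divide_0[OF tendsto_const[of c] filterlim_at_top_imp_at_infinity[OF filterlim_ident]]]
    by simp
  have succ_le: "Bessel_I (\<mu> + 1) v / Bessel_I \<mu> v \<le> 1 - (-1) / v" if "v \<ge> 1" for v
  proof -
    have "v powr \<mu> * (v * Bessel_Clifford (\<mu> + 1) (v\<^sup>2)) \<le> v powr \<mu> * ((1 + 1 / v) * Bessel_Clifford \<mu> (v\<^sup>2))"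
      using assms that by (intro mult_left_mono Bessel_Clifford_succ_le) auto
    then have "Bessel_I (\<mu> + 1) v \<le> (1 + 1 / v) * Bessel_I \<mu> v"
      using that by (simp add: Bessel_I_def powr_add mult_ac)
    moreover have "Bessel_I \<mu> v > 0"
      using assms that by (intro Bessel_I_pos) auto
    ultimately show ?thesis
      by (simp add: pos_divide_le_eq)
  qed
  have le: "Bessel_I (\<mu> + s) v / Bessel_I \<mu> v \<le> (1 - (-1) / v) / (1 - (1 - s) * (\<mu> + s + 2) / v)"
    if v: "v \<ge> 1" "(1 - s) * (\<mu> + s + 2) < v" for v
  proof -
    have p: "Bessel_I (\<mu> + s) v > 0" "Bessel_I \<mu> v > 0" "Bessel_I (\<mu> + 1) v > 0"
      using assms v by (auto intro!: Bessel_I_pos)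
    have 1: "1 - (1 - s) * (\<mu> + s + 2) / v \<le> Bessel_I (\<mu> + 1) v / Bessel_I (\<mu> + s) v"
      using Bessel_I_ratio_ge[of "\<mu> + s" v "1 - s"] assms v by simp
    have 2: "0 < 1 - (1 - s) * (\<mu> + s + 2) / v"
      using v by simp
    have "Bessel_I (\<mu> + s) v / Bessel_I \<mu> v =
       (Bessel_I (\<mu> + 1) v / Bessel_I \<mu> v) / (Bessel_I (\<mu> + 1) v / Bessel_I (\<mu> + s) v)"
      using p by simp
    also have "\<dots> \<le> (1 - (-1) / v) / (1 - (1 - s) * (\<mu> + s + 2) / v)"
      using succ_le[OF v(1)] 1 2 p v(1) by (intro frac_le) (auto intro: add_nonneg_nonneg)
    finally show ?thesis .
  qed
  show ?thesis
  proof (rule tendsto_sandwich)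
    show "\<forall>\<^sub>F v in at_top. 1 - s * (\<mu> + 2) / v \<le> Bessel_I (\<mu> + s) v / Bessel_I \<mu> v"
      using eventually_ge_at_top[of 1] by eventually_elim (use assms Bessel_I_ratio_ge in auto)
    show "\<forall>\<^sub>F v in at_top. Bessel_I (\<mu> + s) v / Bessel_I \<mu> v \<le>
        (1 - (-1) / v) / (1 - (1 - s) * (\<mu> + s + 2) / v)"
      using eventually_ge_at_top[of 1] eventually_gt_at_top[of "(1 - s) * (\<mu> + s + 2)"]
      by eventually_elim (use le in auto)
    show "((\<lambda>v. 1 - s * (\<mu> + 2) / v) \<longlongrightarrow> 1) at_top"
      by (rule lim)
    show "((\<lambda>v. (1 - (-1) / v) / (1 - (1 - s) * (\<mu> + s + 2) / v)) \<longlongrightarrow> 1) at_top"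
      using tendsto_divide[OF lim[of "-1"] lim[of "(1 - s) * (\<mu> + s + 2)"]] by simp
  qed
qed

text \<open>A larger difference of orders is split into steps of length at most 1, along which the
  quotient telescopes.\<close>

lemma tendsto_Bessel_I_ratio:
  assumes "\<mu> > -1" "\<mu> \<le> \<mu>'"
  shows "((\<lambda>v. Bessel_I \<mu>' v / Bessel_I \<mu> v) \<longlongrightarrow> 1) at_top"
proof -
  have "((\<lambda>v. Bessel_I (\<mu> + s) v / Bessel_I \<mu> v) \<longlongrightarrow> 1) at_top"
    if "0 \<le> s" "s \<le> real n" for n s
    using that
  proof (induction n arbitrary: s)
    case 0
    then show ?case
      using tendsto_Bessel_I_ratio_aux[of \<mu> 0] assms by simp
  next
    case (Suc n)
    show ?case
    proof (cases "s \<le> 1")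
      case True
      then show ?thesis
        using tendsto_Bessel_I_ratio_aux[of \<mu> s] assms Suc.prems by simp
    next
      case False
      have lim: "((\<lambda>v. (Bessel_I (\<mu> + (s - 1) + 1) v / Bessel_I (\<mu> + (s - 1)) v) *
          (Bessel_I (\<mu> + (s - 1)) v / Bessel_I \<mu> v)) \<longlongrightarrow> 1 * 1) at_top"
        using False assms Suc.prems by (intro tendsto_mult Suc.IH tendsto_Bessel_I_ratio_aux) auto
      have ev: "\<forall>\<^sub>F v in at_top. (Bessel_I (\<mu> + (s - 1) + 1) v / Bessel_I (\<mu> + (s - 1)) v) *
          (Bessel_I (\<mu> + (s - 1)) v / Bessel_I \<mu> v) = Bessel_I (\<mu> + s) v / Bessel_I \<mu> v"
        using eventually_gt_at_top[of 0]
      proof eventually_elim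
        case (elim v)
        have "Bessel_I (\<mu> + (s - 1)) v > 0"
          using False assms elim by (intro Bessel_I_pos) auto
        then show ?case by simp
      qed
      show ?thesis
        using Lim_transform_eventually[OF lim ev] by simp
    qed
  qed
  from this[of "\<mu>' - \<mu>" "nat \<lceil>\<mu>' - \<mu>\<rceil>"] show ?thesis
    using assms by simp
qed

section \<open>Gegenbauer polynomials\<close>

unbundle no vec_syntax and fps_syntax

section \<open>Real powers of formal power series with constant term 1\<close>

lemma fps_inverse_binomial: "inverse (fps_binomial c :: 'a::field_char_0 fps) = fps_binomial (- c)"
  by (rule fps_inverse_unique) (simp add: fps_binomial_add_mult[symmetric])

lemma fps_inverse_binomial_compose:
  assumes "q $ 0 = (0 :: 'a::field_char_0)"
  shows "inverse (fps_binomial c oo q) = fps_binomial (- c) oo q"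
  using fps_inverse_compose[OF assms, of "fps_binomial c"] by (simp add: fps_inverse_binomial)

text \<open>The logarithmic derivative of (1 + q)^c, written without division.\<close>

lemma fps_deriv_binomial_compose:
  assumes "q $ 0 = (0 :: 'a::field_char_0)"
  shows "(1 + q) * fps_deriv (fps_binomial c oo q) = fps_const c * fps_deriv q * (fps_binomial c oo q)"
proof -
  have "(1 + fps_X) * fps_deriv (fps_binomial c :: 'a fps) = fps_const c * fps_binomial c"
    by (simp add: fps_binomial_deriv fps_divide_unit mult.assoc fps_inverse_mult
        inverse_mult_eq_1' mult.left_commute[of "1 + fps_X"])
  then have "((1 + fps_X) * fps_deriv (fps_binomial c :: 'a fps)) oo q = (fps_const c * fps_binomial c) oo q"
    by simp
  then have "(1 + q) * (fps_deriv (fps_binomial c) oo q) = fps_const c * (fps_binomial c oo q)"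
    using assms by (simp add: fps_compose_mult_distrib fps_compose_add_distrib)
  then show ?thesis
    using assms by (simp add: fps_compose_deriv mult_ac)
qed

text \<open>The quotient of the two sides has derivative \<open>0\<close>.\<close>

lemma fps_binomial_compose_mult:
  fixes q q1 q2 :: "'a::field_char_0 fps"
  assumes "q $ 0 = 0" "q1 $ 0 = 0" "q2 $ 0 = 0" "1 + q = (1 + q1) * (1 + q2)"
  shows "fps_binomial c oo q = (fps_binomial c oo q1) * (fps_binomial c oo q2)"
proof -
  define F where "F = fps_binomial c oo q"
  define G where "G p = fps_binomial (- c) oo p" for p
  have F: "(1 + q) * fps_deriv F = fps_const c * fps_deriv q * F"
    unfolding F_def using assms(1) by (rule fps_deriv_binomial_compose)
  have G: "(1 + p) * fps_deriv (G p) = fps_const (- c) * fps_deriv p * G p" if "p $ 0 = 0" for p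
    unfolding G_def using that by (rule fps_deriv_binomial_compose)
  have inv: "G p * (fps_binomial c oo p) = 1" if "p $ 0 = 0" for p
    unfolding G_def using that by (simp add: fps_compose_mult_distrib[symmetric] fps_binomial_add_mult[symmetric])
  have q: "fps_deriv q = fps_deriv q1 * (1 + q2) + (1 + q1) * fps_deriv q2"
    using arg_cong[OF assms(4), of fps_deriv] by (simp add: algebra_simps)
  have "(1 + q) * fps_deriv (G q1 * G q2) =
      ((1 + q1) * fps_deriv (G q1)) * (1 + q2) * G q2 + ((1 + q2) * fps_deriv (G q2)) * (1 + q1) * G q1"
    by (simp add: assms(4) algebra_simps)
  also have "\<dots> = fps_const (- c) * fps_deriv q * (G q1 * G q2)"
    unfolding G[OF assms(2)] G[OF assms(3)] q by (simp only: algebra_simps)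
  finally have GG: "(1 + q) * fps_deriv (G q1 * G q2) = fps_const (- c) * fps_deriv q * (G q1 * G q2)" .
  have "(1 + q) * fps_deriv (F * (G q1 * G q2)) =
      ((1 + q) * fps_deriv F) * (G q1 * G q2) + F * ((1 + q) * fps_deriv (G q1 * G q2))"
    unfolding fps_deriv_mult[of F] by (simp only: algebra_simps)
  also have "\<dots> = (fps_const c + fps_const (- c)) * (fps_deriv q * F * (G q1 * G q2))"
    unfolding F GG by (simp only: algebra_simps)
  finally have "(1 + q) * fps_deriv (F * (G q1 * G q2)) = 0"
    by simp
  moreover have "(1 + q) \<noteq> 0"
    using assms(1) by (metis add.right_neutral fps_add_nth fps_one_nth fps_zero_nth zero_neq_one)
  ultimately have "fps_deriv (F * (G q1 * G q2)) = 0"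
    by simp
  then have "F * (G q1 * G q2) = fps_const ((F * (G q1 * G q2)) $ 0)"
    by (simp only: fps_deriv_eq_0_iff)
  also have "\<dots> = 1"
    by (simp add: F_def G_def)
  finally have "F * (G q1 * G q2) * ((fps_binomial c oo q1) * (fps_binomial c oo q2)) =
      (fps_binomial c oo q1) * (fps_binomial c oo q2)"
    by simp
  also have "F * (G q1 * G q2) * ((fps_binomial c oo q1) * (fps_binomial c oo q2)) =
      F * (G q1 * (fps_binomial c oo q1)) * (G q2 * (fps_binomial c oo q2))"
    by (simp only: mult_ac)
  finally show ?thesis
    unfolding inv[OF assms(2)] inv[OF assms(3)] F_def by simp
qed

section \<open>Coefficients and differential equation of the polynomials\<close>

text \<open>The coefficient of t^j in the classical ultraspherical polynomial of degree m and
  parameter c, with generating function (1 - 2tx + x^2)^(-c). Indexing by the power of t, with 0 for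
  the wrong parity, allows plain sums over j.\<close>

definition ultra_coeff :: "real \<Rightarrow> nat \<Rightarrow> nat \<Rightarrow> real" where
  "ultra_coeff c m j = (if j \<le> m \<and> even (m + j)
     then (-1) ^ ((m - j) div 2) * pochhammer c ((m + j) div 2) * 2 ^ j / (fact ((m - j) div 2) * fact j)
     else 0)"

lemma fps_X_minus_const_power_nth:
  fixes b :: "'a::field_char_0"
  shows "((fps_X - fps_const b) ^ i) $ l = of_nat (i choose l) * (- b) ^ (i - l)"
proof -
  have "(fps_X + fps_const (- b)) ^ i = (\<Sum>k\<le>i. of_nat (i choose k) * fps_X ^ k * fps_const (- b) ^ (i - k))"
    by (rule binomial_ring)
  moreover have "fps_X + fps_const (- b) = fps_X - fps_const b"
    by (simp add: fps_const_neg[symmetric] del: fps_const_neg)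
  ultimately have "((fps_X - fps_const b) ^ i) $ l = (\<Sum>k\<le>i. (of_nat (i choose k) * fps_X ^ k * fps_const ((- b) ^ (i - k))) $ l)"
    by (simp add: fps_sum_nth)
  also have "\<dots> = (\<Sum>k\<le>i. if k = l then of_nat (i choose l) * (- b) ^ (i - l) else 0)"
    by (intro sum.cong refl) (auto simp: mult.assoc fps_of_nat[symmetric] simp del: fps_const_neg)
  also have "\<dots> = of_nat (i choose l) * (- b) ^ (i - l)"
    by (cases "l \<le> i") (auto simp: binomial_eq_0)
  finally show ?thesis .
qed

lemma fps_binomial_compose_quadratic_nth:
  fixes a t :: "'a::field_char_0"
  shows "(fps_binomial a oo (fps_X ^ 2 - fps_const (2 * t) * fps_X)) $ m =
    (\<Sum>i=0..m. (a gchoose i) * (of_nat (i choose (m - i)) * (- (2 * t)) ^ (i - (m - i))))"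
proof -
  have "(fps_X ^ 2 - fps_const (2 * t) * fps_X) ^ i $ m = of_nat (i choose (m - i)) * (- (2 * t)) ^ (i - (m - i))"
    if "i \<le> m" for i
  proof -
    have "(fps_X ^ 2 - fps_const (2 * t) * fps_X) ^ i = fps_X ^ i * (fps_X - fps_const (2 * t)) ^ i"
      by (simp add: power_mult_distrib[symmetric] power2_eq_square algebra_simps)
    then show ?thesis
      using that by (simp only: fps_X_power_mult_nth fps_X_minus_const_power_nth) simp
  qed
  then show ?thesis
    unfolding fps_compose_nth by (intro sum.cong refl) auto
qed

text \<open>The binomial coefficient \<open>i choose (m - i)\<close> removes the indices with 2i <
  m; the others are renumbered by the exponent j = 2i - m of t.\<close>

lemma ultra_coeff_sum:
  fixes c t :: real
  shows "(fps_binomial (- c) oo (fps_X ^ 2 - fps_const (2 * t) * fps_X)) $ m =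
    (\<Sum>j\<le>m. ultra_coeff c m j * t ^ j)"
proof -
  have "(\<Sum>i=0..m. (- c gchoose i) * (real (i choose (m - i)) * (- (2 * t)) ^ (i - (m - i)))) =
    (\<Sum>i | i \<le> m \<and> m \<le> 2 * i. (- c gchoose i) * (real (i choose (m - i)) * (- (2 * t)) ^ (i - (m - i))))"
    by (intro sum.mono_neutral_right) (auto simp: binomial_eq_0)
  also have "\<dots> = (\<Sum>j | j \<le> m \<and> even (m + j). ultra_coeff c m j * t ^ j)"
  proof (rule sum.reindex_bij_witness[where i = "\<lambda>j. (m + j) div 2" and j = "\<lambda>i. 2 * i - m"])
    fix i assume i: "i \<in> {i. i \<le> m \<and> m \<le> 2 * i}"
    define j where "j = 2 * i - m"
    have ij: "m + j = 2 * i" "m - j = 2 * (m - i)" "i - (m - i) = j" "m - i \<le> i" "j \<le> m"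
      using i by (auto simp: j_def)
    have "(- c gchoose i) = (-1) ^ i * pochhammer c i / fact i"
      by (simp add: gbinomial_pochhammer)
    moreover have "real (i choose (m - i)) = fact i / (fact (m - i) * fact j)"
      using binomial_fact[OF ij(4), where 'a = real] ij(3) by simp
    moreover have "(-1) ^ i * (- 1) ^ j = ((-1) ^ (m - i) :: real)"
    proof -
      have "i + j = (m - i) + 2 * j"
        using ij i by (auto simp: j_def)
      then have "(-1 :: real) ^ (i + j) = (-1) ^ (m - i) * (-1) ^ (2 * j)"
        by (simp only: power_add)
      then show ?thesis
        by (simp add: power_add[symmetric])
    qed
    moreover have "(- (2 * t)) ^ j = (-1) ^ j * 2 ^ j * t ^ j"
      by (metis mult_minus1 power_mult_distrib mult.assoc)
    ultimately have "(- c gchoose i) * (real (i choose (m - i)) * (- (2 * t)) ^ (i - (m - i))) =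
       (((-1) ^ i * (-1) ^ j) * pochhammer c i * 2 ^ j / (fact (m - i) * fact j)) * t ^ j"
      unfolding ij(3) by simp
    also have "\<dots> = ultra_coeff c m j * t ^ j"
      using ij \<open>(-1) ^ i * (- 1) ^ j = ((-1) ^ (m - i) :: real)\<close> by (simp add: ultra_coeff_def)
    finally show "ultra_coeff c m (2 * i - m) * t ^ (2 * i - m) =
        (- c gchoose i) * (real (i choose (m - i)) * (- (2 * t)) ^ (i - (m - i)))"
      by (simp add: j_def)
  qed auto
  also have "\<dots> = (\<Sum>j\<le>m. ultra_coeff c m j * t ^ j)"
    by (intro sum.mono_neutral_left) (auto simp: ultra_coeff_def)
  finally show ?thesis
    unfolding fps_binomial_compose_quadratic_nth by simp
qed

text \<open>Multiplying the generating function by 1 - x^2 subtracts the coefficient of index m - 2.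
  The guard is essential, since \<open>m - 2\<close> is 0 for m < 2.\<close>

definition Gegenbauer_coeff :: "real \<Rightarrow> nat \<Rightarrow> nat \<Rightarrow> real" where
  "Gegenbauer_coeff \<nu> m j = ultra_coeff (\<nu> + 1) m j -
     (if m \<ge> 2 then ultra_coeff (\<nu> + 1) (m - 2) j else 0)"

definition Gegenbauer_poly :: "real \<Rightarrow> nat \<Rightarrow> real poly" where
  "Gegenbauer_poly \<nu> m = (\<Sum>j\<le>m. monom (Gegenbauer_coeff \<nu> m j) j)"

lemma Gegenbauer_coeff_eq_0: "m < j \<Longrightarrow> Gegenbauer_coeff \<nu> m j = 0"
  by (auto simp: Gegenbauer_coeff_def ultra_coeff_def)

lemma Gegenbauer_coeff_odd: "odd (m + j) \<Longrightarrow> Gegenbauer_coeff \<nu> m j = 0"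
  by (auto simp: Gegenbauer_coeff_def ultra_coeff_def)

lemma coeff_Gegenbauer_poly: "coeff (Gegenbauer_poly \<nu> m) j = Gegenbauer_coeff \<nu> m j"
  by (simp add: Gegenbauer_poly_def coeff_sum Gegenbauer_coeff_eq_0)

lemma poly_Gegenbauer_poly: "poly (Gegenbauer_poly \<nu> m) t = (\<Sum>j\<le>m. Gegenbauer_coeff \<nu> m j * t ^ j)"
  by (simp add: Gegenbauer_poly_def poly_sum poly_monom)

lemma normalized_Gegenbauer_eq_diff:
  fixes \<nu> t :: real
  defines "D \<equiv> fps_binomial (- (\<nu> + 1)) oo (fps_X ^ 2 - fps_const (2 * t) * fps_X)"
  shows "normalized_Gegenbauer \<nu> m t = D $ m - (if m \<ge> 2 then D $ (m - 2) else 0)"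
proof -
  have "normalized_Gegenbauer \<nu> m t = ((1 - fps_X ^ 2) * D) $ m"
    unfolding normalized_Gegenbauer_def D_def
    by (subst fps_divide_unit, simp, subst fps_inverse_binomial_compose) simp_all
  also have "(1 - fps_X ^ 2) * D = D - fps_X ^ 2 * D"
    by (simp add: algebra_simps)
  finally show ?thesis
    by (simp add: fps_X_power_mult_nth)
qed

lemma normalized_Gegenbauer_eq_poly: "normalized_Gegenbauer \<nu> m t = poly (Gegenbauer_poly \<nu> m) t"
proof -
  have "(\<Sum>j\<le>m. ultra_coeff (\<nu> + 1) (m - 2) j * t ^ j) =
      (\<Sum>j\<le>m - 2. ultra_coeff (\<nu> + 1) (m - 2) j * t ^ j)"
    by (intro sum.mono_neutral_right) (auto simp: ultra_coeff_def)
  then show ?thesis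
    unfolding normalized_Gegenbauer_eq_diff ultra_coeff_sum poly_Gegenbauer_poly
      Gegenbauer_coeff_def
    by (simp add: left_diff_distrib sum_subtractf)
qed

text \<open>The two Pochhammer symbols differ by one factor, and \<nu> + j + k and k add up to \<nu>
  + m. Nothing is divided by \<nu>, so \<nu> = 0 (dimension 2) is included, unlike in the usual form
  (\<nu> + m)/\<nu> times the classical polynomial. For m = 0 the formula would give \<nu> instead
  of 1.\<close>

lemma Gegenbauer_coeff_closed_form:
  assumes "m = j + 2 * k" "m \<ge> 1"
  shows "Gegenbauer_coeff \<nu> m j =
    (-1) ^ k * 2 ^ j / (fact k * fact j) * pochhammer (\<nu> + 1) (j + k - 1) * (\<nu> + real m)"
proof -
  have p: "pochhammer (\<nu> + 1) (j + k) = pochhammer (\<nu> + 1) (j + k - 1) * (\<nu> + real (j + k))"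
    using assms pochhammer_Suc[of "\<nu> + 1" "j + k - 1"] by (cases "j + k") auto
  show ?thesis
  proof (cases k)
    case 0
    then show ?thesis
      using assms p by (auto simp: Gegenbauer_coeff_def ultra_coeff_def)
  next
    case (Suc l)
    have 1: "(m + j) div 2 = j + k" "(m - j) div 2 = k" "even (m + j)" "j \<le> m" "m \<ge> 2"
      using assms Suc by auto
    have 2: "(m - 2 + j) div 2 = j + k - 1" "(m - 2 - j) div 2 = l" "even (m - 2 + j)" "j \<le> m - 2"
      using assms Suc by auto
    have "Gegenbauer_coeff \<nu> m j = (-1) ^ k * pochhammer (\<nu> + 1) (j + k) * 2 ^ j / (fact k * fact j)
       - (-1) ^ l * pochhammer (\<nu> + 1) (j + k - 1) * 2 ^ j / (fact l * fact j)"
      unfolding Gegenbauer_coeff_def ultra_coeff_def using 1 2 by simp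
    also have "(-1) ^ l * pochhammer (\<nu> + 1) (j + k - 1) * 2 ^ j / (fact l * fact j) =
       - ((-1) ^ k * 2 ^ j / (fact k * fact j) * pochhammer (\<nu> + 1) (j + k - 1) * real k)"
      unfolding Suc by (simp add: divide_simps del: of_nat_Suc)
    finally show ?thesis
      unfolding p assms(1) by (simp add: algebra_simps add_divide_distrib)
  qed
qed

text \<open>Gegenbauer's differential equation, compared at t^j. For wrong parity or j > m all
  coefficients vanish, for j = m the bracket does; otherwise the closed form applies to both j and j
  + 2.\<close>

lemma Gegenbauer_coeff_rec:
  "real (j + 2) * real (j + 1) * Gegenbauer_coeff \<nu> m (j + 2) =
     (real j * (real j + 2 * \<nu>) - real m * (real m + 2 * \<nu>)) * Gegenbauer_coeff \<nu> m j"
proof -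
  consider "odd (m + j)" | "m < j" | "m = j" | k where "m = j + 2 * Suc k"
  proof -
    have "\<exists>k. m = j + 2 * Suc k" if "even (m + j)" "m > j"
    proof -
      have "even (m - j)" "m - j > 0" using that by auto
      then obtain l where "m - j = 2 * l" by (elim evenE)
      with \<open>m - j > 0\<close> show ?thesis
        by (intro exI[of _ "l - 1"]) auto
    qed
    then show thesis
      using that by (meson linorder_neqE_nat)
  qed
  then show ?thesis
  proof cases
    case 1
    then show ?thesis by (simp add: Gegenbauer_coeff_odd)
  next
    case 2
    then show ?thesis by (simp add: Gegenbauer_coeff_eq_0)
  next
    case 3
    then show ?thesis by (simp add: Gegenbauer_coeff_eq_0)
  next
    case 4
    have 1: "Gegenbauer_coeff \<nu> m j =
      (-1) ^ Suc k * 2 ^ j / (fact (Suc k) * fact j) * pochhammer (\<nu> + 1) (j + k) * (\<nu> + real m)"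
      using Gegenbauer_coeff_closed_form[of m j "Suc k" \<nu>] 4 by simp
    have 2: "Gegenbauer_coeff \<nu> m (j + 2) =
      (-1) ^ k * 2 ^ (j + 2) / (fact k * fact (j + 2)) * pochhammer (\<nu> + 1) (Suc (j + k)) * (\<nu> + real m)"
      using Gegenbauer_coeff_closed_form[of m "j + 2" k \<nu>] 4 by simp
    have f: "fact (j + 2) = real (j + 2) * real (j + 1) * fact j"
      by (simp add: algebra_simps)
    have "real (j + 2) * real (j + 1) * Gegenbauer_coeff \<nu> m (j + 2) =
      (-1) ^ k * 2 ^ (j + 2) / (fact k * fact j) * pochhammer (\<nu> + 1) (Suc (j + k)) * (\<nu> + real m)"
      unfolding 2 f by (simp add: divide_simps del: of_nat_add of_nat_Suc)
    also have "\<dots> = (real j * (real j + 2 * \<nu>) - real m * (real m + 2 * \<nu>)) * Gegenbauer_coeff \<nu> m j"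
      unfolding 1 pochhammer_Suc by (simp add: 4 divide_simps) (simp add: algebra_simps)
    finally show ?thesis .
  qed
qed

text \<open>For \<nu> = (N - 2)/2 this is the Laplacian of the unit sphere in dimension N, acting on
  functions of the inner product with a fixed unit vector.\<close>

definition Gegenbauer_op :: "real \<Rightarrow> real poly \<Rightarrow> real poly" where
  "Gegenbauer_op \<nu> F = [:1, 0, -1:] * pderiv (pderiv F) - [:0, 2 * \<nu> + 1:] * pderiv F"

lemma coeff_Gegenbauer_op:
  "coeff (Gegenbauer_op \<nu> F) k = real (k + 2) * real (k + 1) * coeff F (k + 2) - real k * (real k + 2 * \<nu>) * coeff F k"
proof -
  have *: "[:1, 0, -1:] * p = p - pCons 0 (pCons 0 p)" for p :: "real poly"
    by simp
  have **: "[:0, a:] * p = smult a (pCons 0 p)" for p :: "real poly" and a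
    by simp
  show ?thesis
    unfolding Gegenbauer_op_def * **
    by (cases k; cases "k - 1") (auto simp: coeff_pderiv coeff_pCons algebra_simps split: nat.splits)
qed

lemma Gegenbauer_poly_ODE:
  "Gegenbauer_op \<nu> (Gegenbauer_poly \<nu> m) = smult (- (real m * (real m + 2 * \<nu>))) (Gegenbauer_poly \<nu> m)"
  by (rule poly_eqI)
    (simp only: coeff_Gegenbauer_op coeff_smult coeff_Gegenbauer_poly Gegenbauer_coeff_rec, simp add: algebra_simps)

lemma Gegenbauer_poly_ODE_poly:
  "(1 - t\<^sup>2) * poly (pderiv (pderiv (Gegenbauer_poly \<nu> m))) t - (2 * \<nu> + 1) * t * poly (pderiv (Gegenbauer_poly \<nu> m)) t =
   - (real m * (real m + 2 * \<nu>)) * poly (Gegenbauer_poly \<nu> m) t"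
  using arg_cong[OF Gegenbauer_poly_ODE[of \<nu> m], of "\<lambda>p. poly p t"]
  by (simp add: Gegenbauer_op_def algebra_simps power2_eq_square)

lemma Gegenbauer_coeff_lead: "Gegenbauer_coeff \<nu> m m = 2 ^ m * pochhammer (\<nu> + 1) m / fact m"
  by (auto simp: Gegenbauer_coeff_def ultra_coeff_def)

lemma Gegenbauer_poly_0: "Gegenbauer_poly \<nu> 0 = 1"
  by (simp add: Gegenbauer_poly_def Gegenbauer_coeff_lead)

section \<open>Bounds on [-1, 1] and the Poisson kernel\<close>

text \<open>The coefficient of x^m in (1 - x)^(-2c), which is the value of the ultraspherical
  polynomial at t = 1. It is kept as a convolution because the triangle inequality produces it in
  this form.\<close>

definition binomial_bound :: "real \<Rightarrow> nat \<Rightarrow> real" where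
  "binomial_bound c m = (\<Sum>i\<le>m. pochhammer c i / fact i * (pochhammer c (m - i) / fact (m - i)))"

definition Gegenbauer_bound :: "real \<Rightarrow> nat \<Rightarrow> real" where
  "Gegenbauer_bound \<nu> m = binomial_bound (\<nu> + 1) m + (if m \<ge> 2 then binomial_bound (\<nu> + 1) (m - 2) else 0)"

lemma gbinomial_minus_eq: "(- c gchoose n) = (-1) ^ n * (pochhammer c n / fact n :: 'a::field_char_0)"
  by (simp add: gbinomial_pochhammer)

lemma abs_summable_pochhammer_series:
  fixes c r :: real
  assumes "c > 0" "0 \<le> r" "r < 1"
  shows "summable (\<lambda>n. pochhammer c n / fact n * r ^ n)"
proof -
  have "summable (\<lambda>n. (- c gchoose n) * (- r) ^ n)"
    using gen_binomial_real[of "- r" "- c"] assms by (auto simp: sums_iff)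
  also have "(\<lambda>n. (- c gchoose n) * (- r) ^ n) = (\<lambda>n. pochhammer c n / fact n * r ^ n)"
  proof
    fix n
    have "(- c gchoose n) * (- r) ^ n = ((-1) ^ n * (-1) ^ n) * (pochhammer c n / fact n * r ^ n)"
      unfolding gbinomial_minus_eq power_minus[of r] by (simp only: mult_ac)
    then show "(- c gchoose n) * (- r) ^ n = pochhammer c n / fact n * r ^ n"
      by (simp flip: power_mult_distrib)
  qed
  finally show ?thesis .
qed

lemma binomial_bound_nonneg: "c > 0 \<Longrightarrow> binomial_bound c m \<ge> 0"
  unfolding binomial_bound_def
  by (intro sum_nonneg mult_nonneg_nonneg divide_nonneg_pos less_imp_le[OF pochhammer_pos]) auto

lemma summable_binomial_bound:
  assumes "c > 0" "0 \<le> r" "r < 1"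
  shows "summable (\<lambda>m. binomial_bound c m * r ^ m)"
proof -
  have p: "pochhammer c n > 0" for n
    using assms by (intro pochhammer_pos) auto
  have "summable (\<lambda>n. norm (pochhammer c n / fact n * r ^ n))"
    using abs_summable_pochhammer_series[OF assms] assms by (simp add: abs_mult abs_of_pos[OF p])
  from summable_Cauchy_product[OF this this]
  show ?thesis
    by (rule summable_cong[THEN iffD1, rotated])
      (auto simp: binomial_bound_def sum_distrib_left power_add[symmetric] field_simps intro!: always_eventually sum.cong)
qed

lemma of_real_gbinomial: "of_real (a gchoose n) = (of_real a gchoose n :: complex)"
  by (simp add: gbinomial_prod_rev)

lemma norm_gbinomial_minus:
  fixes c :: real
  assumes "c > 0"
  shows "cmod (- of_real c gchoose n) = pochhammer c n / fact n"
proof -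
  have "pochhammer c n > 0"
    using assms by (intro pochhammer_pos) auto
  moreover have "cmod (- of_real c gchoose n) = \<bar>- c gchoose n\<bar>"
    using of_real_gbinomial[of "- c" n] by (metis norm_of_real of_real_minus)
  ultimately show ?thesis
    by (simp add: gbinomial_minus_eq[of c] abs_mult)
qed

text \<open>For t = cos \<theta> the quadratic 1 - 2tX + X^2 splits into two conjugate linear
  factors, and \<open>fps_binomial_compose_mult\<close> splits its power accordingly.\<close>

lemma fps_binomial_quadratic_complex:
  fixes c \<theta> :: real
  defines "D \<equiv> fps_binomial (- c) oo (fps_X ^ 2 - fps_const (2 * cos \<theta>) * fps_X)"
  shows "complex_of_real (D $ m) =
    (\<Sum>i\<le>m. ((- of_real c gchoose i) * (- cis \<theta>) ^ i) * ((- of_real c gchoose (m - i)) * (- cis (- \<theta>)) ^ (m - i)))"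
proof -
  have "complex_of_real (D $ m) =
    (fps_binomial (- of_real c) oo (fps_X ^ 2 - fps_const (2 * of_real (cos \<theta>)) * fps_X)) $ m"
    unfolding D_def fps_binomial_compose_quadratic_nth by (simp add: of_real_gbinomial)
  also have "fps_binomial (- complex_of_real c) oo (fps_X ^ 2 - fps_const (2 * of_real (cos \<theta>)) * fps_X) =
    (fps_binomial (- of_real c) oo (fps_const (- cis \<theta>) * fps_X)) *
    (fps_binomial (- of_real c) oo (fps_const (- cis (- \<theta>)) * fps_X))"
  proof (rule fps_binomial_compose_mult)
    have 1: "2 * complex_of_real (cos \<theta>) = cis \<theta> + cis (- \<theta>)"
      by (simp add: complex_eq_iff)
    have 2: "cis \<theta> * cis (- \<theta>) = 1"
      by (simp add: cis_mult)
    have *: "(1 + - a * x) * (1 + - b * x) = 1 - (a + b) * x + a * b * x ^ 2" for a b x :: "complex fps"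
      by (simp add: algebra_simps power2_eq_square)
    have "(1 + fps_const (- cis \<theta>) * fps_X) * (1 + fps_const (- cis (- \<theta>)) * fps_X) =
      1 - fps_const (cis \<theta> + cis (- \<theta>)) * fps_X + fps_const (cis \<theta> * cis (- \<theta>)) * fps_X ^ 2"
      unfolding fps_const_add[symmetric] fps_const_mult[symmetric] fps_const_neg[symmetric]
      by (rule *)
    then show "1 + (fps_X\<^sup>2 - fps_const (2 * complex_of_real (cos \<theta>)) * fps_X) =
        (1 + fps_const (- cis \<theta>) * fps_X) * (1 + fps_const (- cis (- \<theta>)) * fps_X)"
      unfolding 1 2 by simp
  qed simp_all
  also have "\<dots> $ m = (\<Sum>i\<le>m. ((- of_real c gchoose i) * (- cis \<theta>) ^ i) *
      ((- of_real c gchoose (m - i)) * (- cis (- \<theta>)) ^ (m - i)))"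
    unfolding fps_compose_linear fps_mult_nth atMost_atLeast0 by (intro sum.cong) (simp_all add: mult_ac)
  finally show ?thesis .
qed

lemma abs_fps_binomial_quadratic_le:
  fixes c t :: real
  assumes "c > 0" "\<bar>t\<bar> \<le> 1"
  shows "\<bar>(fps_binomial (- c) oo (fps_X ^ 2 - fps_const (2 * t) * fps_X)) $ m\<bar> \<le> binomial_bound c m"
proof -
  define \<theta> where "\<theta> = arccos t"
  have t: "t = cos \<theta>"
    using assms by (simp add: \<theta>_def cos_arccos_abs)
  have "\<bar>(fps_binomial (- c) oo (fps_X ^ 2 - fps_const (2 * t) * fps_X)) $ m\<bar> =
    cmod (of_real ((fps_binomial (- c) oo (fps_X ^ 2 - fps_const (2 * t) * fps_X)) $ m))"
    by simp
  also have "\<dots> \<le> binomial_bound c m"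
    unfolding t fps_binomial_quadratic_complex binomial_bound_def
    by (rule sum_norm_le) (simp add: norm_mult norm_power norm_gbinomial_minus[OF assms(1)])
  finally show ?thesis .
qed

text \<open>The two factors sum to conjugate numbers, so the series has the value |1 - z|^(-2c) with
  z = r e^(i\<theta>). Since |1 - z| <= 2, this gives a lower bound that does not depend on t; the
  truncation below relies on this uniformity.\<close>

lemma fps_binomial_quadratic_sums:
  fixes c t r :: real
  assumes "c > 0" "\<bar>t\<bar> \<le> 1" "0 \<le> r" "r < 1"
  defines "D \<equiv> fps_binomial (- c) oo (fps_X ^ 2 - fps_const (2 * t) * fps_X)"
  obtains S where "(\<lambda>m. D $ m * r ^ m) sums S" "S \<ge> (2 powr (- c))\<^sup>2"
proof -
  define \<theta> where "\<theta> = arccos t"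
  have t: "t = cos \<theta>"
    using assms by (simp add: \<theta>_def cos_arccos_abs)
  define z where "z = cis \<theta> * of_real r"
  define A where "A = (1 - z) powr (of_real (- c))"
  have z: "cmod z = r"
    using assms by (simp add: z_def norm_mult)
  have cz: "cnj z = cis (- \<theta>) * of_real r"
    by (simp add: z_def cis_cnj)
  define a where "a n = (- of_real c gchoose n) * (- z) ^ n" for n
  define b where "b n = (- of_real c gchoose n) * (- cnj z) ^ n" for n
  have a: "a sums A"
    using gen_binomial_complex[of "- z" "- of_real c"] z assms(4) unfolding a_def A_def by simp
  have b_eq: "b = (\<lambda>n. cnj (a n))"
  proof
    fix n
    have "(- of_real c gchoose n) = complex_of_real (- c gchoose n)"
      using of_real_gbinomial[of "- c" n] by simp
    then show "b n = cnj (a n)"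
      by (simp add: a_def b_def)
  qed
  have b: "b sums cnj A"
    unfolding b_eq using a by (simp add: sums_cnj)
  have norm_a: "summable (\<lambda>n. norm (a n))"
  proof -
    have "norm (a n) = pochhammer c n / fact n * r ^ n" for n
      by (simp add: a_def norm_mult norm_power z norm_gbinomial_minus[OF assms(1)])
    then show ?thesis
      using abs_summable_pochhammer_series[of c r] assms by simp
  qed
  then have norm_b: "summable (\<lambda>n. norm (b n))"
    by (simp add: b_eq)
  have "(\<lambda>k. \<Sum>i\<le>k. a i * b (k - i)) sums (A * cnj A)"
    using Cauchy_product_sums[OF norm_a norm_b] a b by (simp add: sums_iff)
  also have "(\<lambda>k. \<Sum>i\<le>k. a i * b (k - i)) = (\<lambda>k. of_real (D $ k * r ^ k))"
  proof
    fix k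
    have *: "a i * b (k - i) = ((- of_real c gchoose i) * (- cis \<theta>) ^ i) *
        ((- of_real c gchoose (k - i)) * (- cis (- \<theta>)) ^ (k - i)) * of_real r ^ k" if "i \<le> k" for i
    proof -
      have "(- z) ^ i = (- cis \<theta>) ^ i * of_real r ^ i"
        by (simp add: z_def flip: power_mult_distrib)
      moreover have "(- cnj z) ^ (k - i) = (- cis (- \<theta>)) ^ (k - i) * of_real r ^ (k - i)"
        unfolding cz by (simp flip: power_mult_distrib)
      moreover have "complex_of_real r ^ k = of_real r ^ i * of_real r ^ (k - i)"
        using that by (simp flip: power_add)
      ultimately show ?thesis
        unfolding a_def b_def by (simp only: mult_ac)
    qed
    show "(\<Sum>i\<le>k. a i * b (k - i)) = of_real (D $ k * r ^ k)"
      unfolding D_def t of_real_mult fps_binomial_quadratic_complex sum_distrib_right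
      by (rule sum.cong) (use * in auto)
  qed
  also have "A * cnj A = of_real ((cmod A)\<^sup>2)"
    by (rule complex_norm_square[symmetric])
  finally have "(\<lambda>m. D $ m * r ^ m) sums ((cmod A)\<^sup>2)"
    by (simp only: sums_of_real_iff)
  moreover have "cmod A \<ge> 2 powr (- c)"
  proof -
    have "cmod (1 - z) \<le> 1 + r"
      using norm_triangle_ineq4[of 1 z] z by simp
    moreover have "cmod (1 - z) \<ge> 1 - r"
      using norm_triangle_ineq2[of 1 z] z by simp
    ultimately have "2 powr (- c) \<le> cmod (1 - z) powr (- c)"
      using assms by (intro powr_mono2') auto
    also have "\<dots> = cmod A"
      unfolding A_def by (subst norm_powr_real_powr') auto
    finally show ?thesis .
  qed
  then have "(cmod A)\<^sup>2 \<ge> (2 powr (- c))\<^sup>2"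
    by (intro power_mono) auto
  ultimately show thesis ..
qed

lemma Gegenbauer_bound_nonneg: "\<nu> > -1 \<Longrightarrow> Gegenbauer_bound \<nu> m \<ge> 0"
  by (simp add: Gegenbauer_bound_def binomial_bound_nonneg)

lemma sums_shift_two:
  fixes f :: "nat \<Rightarrow> real"
  assumes "(\<lambda>m. f m * r ^ m) sums S"
  shows "(\<lambda>m. (if m \<ge> 2 then f (m - 2) else 0) * r ^ m) sums (r\<^sup>2 * S)"
proof -
  have "(\<lambda>m. (if m + 2 \<ge> 2 then f (m + 2 - 2) else 0) * r ^ (m + 2)) sums (r\<^sup>2 * S)"
    using sums_mult[OF assms, of "r\<^sup>2"] by (simp add: power2_eq_square mult_ac)
  then show ?thesis
    by (subst (asm) sums_iff_shift) (simp add: numeral_2_eq_2)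
qed

lemma summable_Gegenbauer_bound:
  assumes "\<nu> > -1" "0 \<le> r" "r < 1"
  shows "summable (\<lambda>m. Gegenbauer_bound \<nu> m * r ^ m)"
proof -
  have "(\<lambda>m. binomial_bound (\<nu> + 1) m * r ^ m) sums (\<Sum>m. binomial_bound (\<nu> + 1) m * r ^ m)"
    using assms by (intro summable_sums summable_binomial_bound) auto
  from sums_add[OF this sums_shift_two[OF this]] show ?thesis
    by (simp add: Gegenbauer_bound_def distrib_right sums_iff)
qed

lemma abs_Gegenbauer_le:
  assumes "\<nu> > -1" "\<bar>t\<bar> \<le> 1"
  shows "\<bar>normalized_Gegenbauer \<nu> m t\<bar> \<le> Gegenbauer_bound \<nu> m"
  using abs_fps_binomial_quadratic_le[of "\<nu> + 1" t m] abs_fps_binomial_quadratic_le[of "\<nu> + 1" t "m - 2"] assms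
  unfolding normalized_Gegenbauer_eq_diff Gegenbauer_bound_def by auto

lemma Poisson_kernel_ge:
  assumes "\<nu> > -1" "0 \<le> r" "r < 1" "\<bar>t\<bar> \<le> 1"
  shows "(\<Sum>m. normalized_Gegenbauer \<nu> m t * r ^ m) \<ge> (1 - r\<^sup>2) * (2 powr (- (\<nu> + 1)))\<^sup>2"
proof -
  have "\<nu> + 1 > 0"
    using assms by simp
  then obtain S where S: "(\<lambda>m. (fps_binomial (- (\<nu> + 1)) oo (fps_X ^ 2 - fps_const (2 * t) * fps_X)) $ m * r ^ m) sums S"
      "S \<ge> (2 powr (- (\<nu> + 1)))\<^sup>2"
    by (rule fps_binomial_quadratic_sums[OF _ assms(4,2,3)])
  have "(\<lambda>m. normalized_Gegenbauer \<nu> m t * r ^ m) sums (S - r\<^sup>2 * S)"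
    using sums_diff[OF S(1) sums_shift_two[OF S(1)]]
    by (simp add: normalized_Gegenbauer_eq_diff left_diff_distrib)
  then have "(\<Sum>m. normalized_Gegenbauer \<nu> m t * r ^ m) = (1 - r\<^sup>2) * S"
    by (simp add: sums_iff algebra_simps)
  moreover have "r\<^sup>2 \<le> 1"
    using assms by (simp add: power_le_one)
  ultimately show ?thesis
    using S(2) by (simp add: mult_left_mono)
qed

section \<open>Positivity of the series\<close>

lemma second_derivative_at_local_min:
  fixes f f' :: "real \<Rightarrow> real"
  assumes "\<And>y. (f has_real_derivative f' y) (at y)" "(f' has_real_derivative l) (at x)"
    and "d > 0" "\<And>y. \<bar>x - y\<bar> < d \<Longrightarrow> f x \<le> f y"
  shows "f' x = 0" "l \<ge> 0"
proof -
  show *: "f' x = 0"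
    using DERIV_local_min[OF assms(1,3)] assms(4) by blast
  show "l \<ge> 0"
  proof (rule ccontr)
    assume "\<not> l \<ge> 0"
    then obtain e where e: "e > 0" "\<And>h. 0 < h \<Longrightarrow> h < e \<Longrightarrow> f' (x + h) < 0"
      using DERIV_neg_dec_right[OF assms(2)] * by auto
    define h where "h = min d e / 2"
    have h: "0 < h" "h < d" "h < e"
      using e assms(3) by (auto simp: h_def)
    have "f x > f (x + h)"
    proof (rule DERIV_neg_imp_decreasing_open[where f = f and a = x and b = "x + h"])
      show "\<exists>y. (f has_real_derivative y) (at z) \<and> y < 0" if "x < z" "z < x + h" for z
        using assms(1)[of z] e(2)[of "z - x"] that h by auto
      show "continuous_on {x..x + h} f"
        using assms(1) by (meson DERIV_atLeastAtMost_imp_continuous_on)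
    qed (use h in auto)
    then show False
      using assms(4)[of "x + h"] h by auto
  qed
qed

lemma derivative_at_right_end_min:
  fixes f :: "real \<Rightarrow> real"
  assumes "(f has_real_derivative l) (at x)" "d > 0" "\<And>h. 0 < h \<Longrightarrow> h < d \<Longrightarrow> f x \<le> f (x - h)"
  shows "l \<le> 0"
proof (rule ccontr)
  assume "\<not> l \<le> 0"
  then obtain e where e: "e > 0" "\<And>h. 0 < h \<Longrightarrow> h < e \<Longrightarrow> f (x - h) < f x"
    using DERIV_pos_inc_left[OF assms(1)] by auto
  define h where "h = min d e / 2"
  have "0 < h" "h < d" "h < e"
    using e assms(2) by (auto simp: h_def)
  then show False
    using e(2)[of h] assms(3)[of h] by simp
qed

lemma tendsto_Bessel_exp_at_bot:
  assumes "\<mu> > 0"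
  shows "((\<lambda>x. exp (\<mu> * x) * Bessel_Clifford \<mu> (exp (2 * x))) \<longlongrightarrow> 0) at_bot"
proof -
  have e: "((\<lambda>x. exp (k * x)) \<longlongrightarrow> 0) at_bot" if "k > 0" for k :: real
    using that by (intro filterlim_compose[OF exp_at_bot] filterlim_tendsto_pos_mult_at_bot[OF tendsto_const _ filterlim_ident])
  have "isCont (Bessel_Clifford \<mu>) 0"
    using assms DERIV_isCont[OF DERIV_Bessel_Clifford[of \<mu> 0]] by simp
  then have "((\<lambda>x. Bessel_Clifford \<mu> (exp (2 * x))) \<longlongrightarrow> Bessel_Clifford \<mu> 0) at_bot"
    by (rule isCont_tendsto_compose) (use e[of 2] in simp)
  from tendsto_mult[OF e[OF assms] this] show ?thesis
    by simp
qed

text \<open>In the variables \<open>x = ln v\<close> and \<open>t\<close>, the sum satisfies the elliptic equation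
  \<open>F\<^sub>x\<^sub>x + b\<^sup>2 ((1 - t\<^sup>2) F\<^sub>t\<^sub>t - (2 \<nu> + 1) t F\<^sub>t) = (4 e\<^sup>2\<^sup>x + b\<^sup>2 \<nu>\<^sup>2) F\<close>,
  which is violated at a negative minimum. The equation degenerates at \<open>t = \<plusminus>1\<close> in such a way
  that no boundary condition is needed there.\<close>

lemma Bessel_Gegenbauer_minimum_principle:
  fixes b \<nu> x0 :: real and c :: "nat \<Rightarrow> real"
  assumes "b > 0" "\<nu> \<ge> - 1 / 2" "b * \<nu> > -1" "c 0 \<ge> 0" "M > 0"
    and bd: "\<And>t. \<bar>t\<bar> \<le> 1 \<Longrightarrow> (\<Sum>m<M. c m * (exp (b * (real m + \<nu>) * x0) *
      Bessel_Clifford (b * (real m + \<nu>)) (exp (2 * x0))) * poly (Gegenbauer_poly \<nu> m) t) \<ge> 0"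
    and x: "x \<le> x0" and t: "\<bar>t\<bar> \<le> 1"
  shows "(\<Sum>m<M. c m * (exp (b * (real m + \<nu>) * x) *
      Bessel_Clifford (b * (real m + \<nu>)) (exp (2 * x))) * poly (Gegenbauer_poly \<nu> m) t) \<ge> 0"
proof (rule ccontr)
  assume neg: "\<not> ?thesis"
  let ?p = "Gegenbauer_poly \<nu>"
  define \<mu> where "\<mu> m = b * (real m + \<nu>)" for m
  define f where "f m x = exp (\<mu> m * x) * Bessel_Clifford (\<mu> m) (exp (2 * x))" for m x
  define F where "F x t = (\<Sum>m<M. c m * f m x * poly (?p m) t)" for x t
  have neg: "\<not> F x t \<ge> 0"
    using neg by (simp add: F_def f_def \<mu>_def)
  have bd: "F x0 t \<ge> 0" if "\<bar>t\<bar> \<le> 1" for t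
    using bd[OF that] by (simp add: F_def f_def \<mu>_def)
  have \<mu>: "\<mu> m > -1" for m
    unfolding \<mu>_def using assms(1,3) by (rule Bessel_order_gt)
  have \<mu>_pos: "\<mu> m > 0" if "m \<noteq> 0" for m
  proof -
    have "real m \<ge> 1"
      using that by simp
    then have "real m + \<nu> > 0"
      using assms(2) by linarith
    then show ?thesis
      using assms(1) by (simp add: \<mu>_def)
  qed
  define f1 where "f1 m x = exp (\<mu> m * x) * (\<mu> m * Bessel_Clifford (\<mu> m) (exp (2 * x)) +
    2 * exp (2 * x) * Bessel_Clifford (\<mu> m + 1) (exp (2 * x)))" for m x
  have f: "(f m has_real_derivative f1 m x) (at x)" for m x
    unfolding f_def f1_def by (rule DERIV_Bessel_exp[OF \<mu>])
  have f1: "(f1 m has_real_derivative (4 * exp (2 * x) + (\<mu> m)\<^sup>2) * f m x) (at x)" for m x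
    unfolding f_def f1_def by (rule DERIV2_Bessel_exp[OF \<mu>])
  have f_pos: "f m x > 0" for m x
    unfolding f_def using \<mu> by (intro mult_pos_pos Bessel_Clifford_pos) auto
  \<comment> \<open>\<open>E\<close> controls all terms except m = 0. That one has order b \<nu>,
    possibly nonpositive, and need not tend to 0 as x tends to -\<infinity>; its sign is known
    instead, from c 0 >= 0 and \<open>Gegenbauer_poly_0\<close>.\<close>
  define E where "E x = (\<Sum>m\<in>{1..<M}. \<bar>c m\<bar> * f m x * Gegenbauer_bound \<nu> m)" for x
  have F_ge: "F x t \<ge> - E x" if "\<bar>t\<bar> \<le> 1" for x t
  proof -
    have "- E x \<le> (\<Sum>m\<in>{1..<M}. c m * f m x * poly (?p m) t)"
      unfolding E_def sum_negf[symmetric]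
    proof (rule sum_mono)
      fix m
      have "\<bar>c m * f m x * poly (?p m) t\<bar> = \<bar>c m\<bar> * f m x * \<bar>poly (?p m) t\<bar>"
        using f_pos[of m x] by (simp add: abs_mult)
      also have "\<dots> \<le> \<bar>c m\<bar> * f m x * Gegenbauer_bound \<nu> m"
        using abs_Gegenbauer_le[of \<nu> t m] that assms(2) f_pos[of m x]
        by (intro mult_left_mono) (auto simp: normalized_Gegenbauer_eq_poly)
      finally show "- (\<bar>c m\<bar> * f m x * Gegenbauer_bound \<nu> m) \<le> c m * f m x * poly (?p m) t"
        by linarith
    qed
    moreover have "F x t = c 0 * f 0 x + (\<Sum>m\<in>{1..<M}. c m * f m x * poly (?p m) t)"
      unfolding F_def lessThan_atLeast0 using assms(5)
      by (subst sum.atLeast_Suc_lessThan) (auto simp: Gegenbauer_poly_0)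
    moreover have "c 0 * f 0 x \<ge> 0"
      using assms(4) f_pos[of 0 x] by simp
    ultimately show ?thesis
      by linarith
  qed
  have "(E \<longlongrightarrow> (\<Sum>m\<in>{1..<M}. \<bar>c m\<bar> * 0 * Gegenbauer_bound \<nu> m)) at_bot"
    unfolding E_def f_def using \<mu>_pos
    by (intro tendsto_intros tendsto_Bessel_exp_at_bot) auto
  then have "\<forall>\<^sub>F y in at_bot. E y < - F x t"
    using neg by (intro order_tendstoD(2)) auto
  then obtain X0 where X0: "\<And>y. y \<le> X0 \<Longrightarrow> E y < - F x t"
    by (auto simp: eventually_at_bot_linorder)
  \<comment> \<open>On the edge x = X of the rectangle \<open>S\<close> the sum stays above the
    negative value \<open>F x t\<close>, so a minimum over \<open>S\<close> cannot lie there. Taking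
    the minimum with x keeps the point (x, t) inside.\<close>
  define X where "X = min X0 x"
  define S where "S = {X..x0} \<times> {-1..(1::real)}"
  have F_cont: "continuous_on S (\<lambda>p. F (fst p) (snd p))"
  proof -
    have "continuous_on UNIV (f m)" for m
      using f by (meson DERIV_continuous_on has_field_derivative_at_within)
    then have "continuous_on S (\<lambda>p. f m (fst p))" for m
      by (rule continuous_on_compose2) (auto intro!: continuous_intros)
    then show ?thesis
      unfolding F_def by (intro continuous_intros)
  qed
  have "compact S" "(x, t) \<in> S"
    unfolding S_def using x t by (auto simp: X_def intro!: compact_Times)
  then obtain p where p: "p \<in> S" "\<And>q. q \<in> S \<Longrightarrow> F (fst p) (snd p) \<le> F (fst q) (snd q)"
    using continuous_attains_inf[OF _ _ F_cont] by blast
  obtain xs ts where xt: "p = (xs, ts)"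
    by (cases p)
  have min: "F xs ts \<le> F y s" if "y \<in> {X..x0}" "s \<in> {-1..1}" for y s
    using p(2)[of "(y, s)"] that by (simp add: S_def xt)
  have in_S: "X \<le> xs" "xs \<le> x0" "-1 \<le> ts" "ts \<le> 1"
    using p(1) by (auto simp: S_def xt)
  have ts: "\<bar>ts\<bar> \<le> 1"
    using in_S by (simp add: abs_le_iff)
  have le: "F xs ts \<le> F x t"
    using min[of x t] x t by (auto simp: X_def abs_le_iff)
  have "xs \<noteq> x0"
    using le neg bd[OF ts] by auto
  moreover have "xs \<noteq> X"
  proof
    assume "xs = X"
    then have "E xs < - F x t"
      by (intro X0) (simp add: X_def)
    then show False
      using F_ge[OF ts, of xs] le by auto
  qed
  ultimately have xs: "X < xs" "xs < x0"
    using in_S by auto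
  define G where "G y = (\<Sum>m<M. c m * f1 m y * poly (?p m) ts)" for y
  define F2 where "F2 = (\<Sum>m<M. c m * ((4 * exp (2 * xs) + (\<mu> m)\<^sup>2) * f m xs) * poly (?p m) ts)"
  have Fx: "((\<lambda>y. F y ts) has_real_derivative G y) (at y)" for y
    unfolding F_def G_def by (auto intro!: derivative_eq_intros f sum.cong simp: mult_ac)
  have Fxx: "(G has_real_derivative F2) (at xs)"
    unfolding F2_def G_def by (auto intro!: derivative_eq_intros f1 sum.cong simp: mult_ac)
  have "F2 \<ge> 0"
  proof (rule second_derivative_at_local_min(2)[OF Fx Fxx])
    show "min (xs - X) (x0 - xs) > 0"
      using xs by auto
    show "F xs ts \<le> F y ts" if "\<bar>xs - y\<bar> < min (xs - X) (x0 - xs)" for y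
      using that in_S by (intro min) (auto simp: abs_less_iff)
  qed
  define H where "H s = (\<Sum>m<M. c m * f m xs * poly (pderiv (?p m)) s)" for s
  define H2 where "H2 = (\<Sum>m<M. c m * f m xs * poly (pderiv (pderiv (?p m))) ts)"
  have Ft: "((\<lambda>s. F xs s) has_real_derivative H s) (at s)" for s
    unfolding F_def H_def by (auto intro!: derivative_eq_intros poly_DERIV sum.cong)
  have Ftt: "(H has_real_derivative H2) (at ts)"
    unfolding H_def H2_def by (auto intro!: derivative_eq_intros poly_DERIV sum.cong)
  have min_t: "F xs ts \<le> F xs s" if "s \<in> {-1..1}" for s
    using that xs by (intro min) auto
  \<comment> \<open>At an endpoint the coefficient 1 - ts^2 removes the second derivative, a
    one-sided minimum fixes the sign of \<open>H ts\<close>, and 2 \<nu> + 1 >= 0 gives the product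
    the right sign.\<close>
  have L: "(1 - ts\<^sup>2) * H2 - (2 * \<nu> + 1) * ts * H ts \<ge> 0"
  proof -
    consider "-1 < ts \<and> ts < 1" | "ts = 1" | "ts = -1"
      using in_S by fastforce
    then show ?thesis
    proof cases
      case 1
      have "H ts = 0 \<and> H2 \<ge> 0"
        using second_derivative_at_local_min[OF Ft Ftt, of "min (ts + 1) (1 - ts)"] 1 min_t
        by (auto simp: abs_less_iff)
      moreover have "ts\<^sup>2 \<le> 1"
        using ts by (simp add: abs_square_le_1)
      ultimately show ?thesis
        by simp
    next
      case 2
      have "H ts \<le> 0"
        using derivative_at_right_end_min[OF Ft, of ts 1] min_t 2 by auto
      then show ?thesis
        using 2 assms(2) by (auto simp: mult_nonneg_nonpos)
    next
      case 3
      have "((\<lambda>s. F xs (- s)) has_real_derivative - H (- s)) (at s)" for s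
        using Ft[of "- s"] by (simp add: DERIV_mirror)
      then have "- H ts \<le> 0"
        using derivative_at_right_end_min[of "\<lambda>s. F xs (- s)" "- H ts" 1 1] min_t 3 by fastforce
      then show ?thesis
        using 3 assms(2) by (auto simp: mult_nonpos_nonneg)
    qed
  qed
  \<comment> \<open>The dependence on m cancels, because the square of \<open>\<mu> m\<close> equals
    b^2 m (m + 2 \<nu>) + b^2 \<nu>^2 and the Gegenbauer equation contributes the negative of the
    first summand.\<close>
  have "F2 + b\<^sup>2 * ((1 - ts\<^sup>2) * H2 - (2 * \<nu> + 1) * ts * H ts) = (4 * exp (2 * xs) + b\<^sup>2 * \<nu>\<^sup>2) * F xs ts"
  proof -
    have "F2 + b\<^sup>2 * ((1 - ts\<^sup>2) * H2 - (2 * \<nu> + 1) * ts * H ts) =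
      (\<Sum>m<M. c m * f m xs * ((4 * exp (2 * xs) + (\<mu> m)\<^sup>2) * poly (?p m) ts +
        b\<^sup>2 * ((1 - ts\<^sup>2) * poly (pderiv (pderiv (?p m))) ts -
         (2 * \<nu> + 1) * ts * poly (pderiv (?p m)) ts)))"
      unfolding F2_def H2_def H_def
      by (simp add: sum_distrib_left sum.distrib sum_subtractf algebra_simps)
    also have "\<dots> = (\<Sum>m<M. (4 * exp (2 * xs) + b\<^sup>2 * \<nu>\<^sup>2) * (c m * f m xs * poly (?p m) ts))"
      unfolding Gegenbauer_poly_ODE_poly \<mu>_def
      by (intro sum.cong refl) (simp add: algebra_simps power2_eq_square)
    finally show ?thesis
      by (simp add: F_def sum_distrib_left)
  qed
  moreover have "F2 + b\<^sup>2 * ((1 - ts\<^sup>2) * H2 - (2 * \<nu> + 1) * ts * H ts) \<ge> 0"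
    using \<open>F2 \<ge> 0\<close> L by (intro add_nonneg_nonneg mult_nonneg_nonneg) auto
  moreover have "(4 * exp (2 * xs) + b\<^sup>2 * \<nu>\<^sup>2) * F xs ts < 0"
    using le neg by (intro mult_pos_neg) (auto intro!: add_pos_nonneg)
  ultimately show False
    by linarith
qed

text \<open>For \<open>v = 0\<close> and \<open>m = 0\<close> the first factor must be \<open>1\<close>; this is why it is not written
  as \<open>v powr (b * real m)\<close>.\<close>

definition Bessel_term :: "real \<Rightarrow> real \<Rightarrow> real \<Rightarrow> real \<Rightarrow> nat \<Rightarrow> real" where
  "Bessel_term b \<nu> v z m = (v powr b) ^ m * Bessel_Clifford (b * (real m + \<nu>)) z"

text \<open>The parameter \<kappa> = 2^(1/b) turns \<kappa>^(-bm) into 2^(-m). The ratio 1/2 is one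
  choice below 1, and the generating series of \<open>Gegenbauer_bound\<close> converges at every
  such ratio.\<close>

lemma abs_Bessel_term_le:
  assumes "b > 0" "b * \<nu> > -1" "v \<ge> 0" "\<bar>z\<bar> = v\<^sup>2"
  shows "\<bar>Bessel_term b \<nu> v z m\<bar> \<le> 2 * exp (2 + (2 * 2 powr (1 / b) + 1) * v) * (1 / 2) ^ m"
proof (cases "v = 0")
  case True
  have "\<bar>Bessel_Clifford (b * \<nu>) z\<bar> \<le> 2 * exp 2" if "z = 0"
    using abs_Bessel_Clifford_le[of "b * \<nu>" 0 1 z] assms(2) that by simp
  then show ?thesis
    using True assms by (cases m) (auto simp: Bessel_term_def)
next
  case False
  define \<kappa> where "\<kappa> = 2 powr (1 / b)"
  have \<kappa>: "\<kappa> \<ge> 1"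
    using assms by (simp add: \<kappa>_def ge_one_powr_ge_zero)
  have "\<kappa> powr (- (b * real m)) = 2 powr (- real m)"
    using assms by (simp add: \<kappa>_def powr_powr)
  also have "\<dots> = (1 / 2) ^ m"
    by (simp add: powr_minus powr_realpow power_one_over inverse_eq_divide)
  finally have 1: "\<kappa> powr (- (b * real m)) = (1 / 2) ^ m" .
  have 2: "(v powr b) ^ m = v powr (b * real m)"
    using False assms by (simp add: powr_powr[symmetric] powr_realpow)
  have "v powr (b * real m) * \<bar>Bessel_Clifford (b * \<nu> + b * real m) z\<bar> \<le>
      2 * exp (2 + (2 * \<kappa> + 1) * v) * \<kappa> powr (- (b * real m))"
    using assms \<kappa> by (intro powr_mult_Bessel_Clifford_le) auto
  then show ?thesis
    unfolding Bessel_term_def abs_mult 1 power_abs[symmetric] 2 by (simp add: \<kappa>_def algebra_simps)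
qed

lemma
  assumes "b > 0" "\<nu> > -1" "b * \<nu> > -1" "v \<ge> 0" "\<bar>z\<bar> = v\<^sup>2"
  defines "f \<equiv> \<lambda>m. \<bar>Bessel_term b \<nu> v z m\<bar> * Gegenbauer_bound \<nu> m"
    and "C \<equiv> 2 * exp (2 + (2 * 2 powr (1 / b) + 1) * v)"
  shows summable_Bessel_Gegenbauer_bound: "summable f"
    and suminf_Bessel_Gegenbauer_bound: "suminf f \<le> C * (\<Sum>m. Gegenbauer_bound \<nu> m * (1 / 2) ^ m)"
proof -
  have le: "f m \<le> C * (Gegenbauer_bound \<nu> m * (1 / 2) ^ m)" for m
    using mult_right_mono[OF abs_Bessel_term_le[OF assms(1,3,4,5), of m] Gegenbauer_bound_nonneg[OF assms(2), of m]]
    by (simp add: f_def C_def mult_ac)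
  have S: "summable (\<lambda>m. Gegenbauer_bound \<nu> m * (1 / 2) ^ m)"
    using assms by (intro summable_Gegenbauer_bound) auto
  show S': "summable f"
    by (rule summable_comparison_test'[where g = "\<lambda>m. C * (Gegenbauer_bound \<nu> m * (1 / 2) ^ m)"])
      (use le S Gegenbauer_bound_nonneg[OF assms(2)] in \<open>auto simp: f_def abs_mult intro!: summable_mult\<close>)
  show "suminf f \<le> C * (\<Sum>m. Gegenbauer_bound \<nu> m * (1 / 2) ^ m)"
    unfolding suminf_mult[OF S, symmetric] by (rule suminf_le[OF le S' summable_mult[OF S]])
qed

section \<open>Truncation, damping and their removal\<close>

text \<open>The Poisson kernel is at least \<open>\<delta>\<close> > 0 and the tail of its majorant
  is below \<open>\<delta>\<close>, both uniformly in t. Hence one cutoff M serves all t, as the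
  boundary condition of the minimum principle requires.\<close>

lemma truncated_Poisson_kernel_nonneg:
  assumes "\<nu> > -1" "0 \<le> r" "r < 1"
  shows "\<forall>\<^sub>F M in sequentially. \<forall>t. \<bar>t\<bar> \<le> 1 \<longrightarrow> (\<Sum>m<M. normalized_Gegenbauer \<nu> m t * r ^ m) \<ge> 0"
proof -
  define \<delta> where "\<delta> = (1 - r\<^sup>2) * (2 powr (- (\<nu> + 1)))\<^sup>2"
  have "r\<^sup>2 < 1"
    using assms by (simp add: abs_square_less_1)
  then have "\<delta> > 0"
    by (simp add: \<delta>_def)
  have S: "summable (\<lambda>m. Gegenbauer_bound \<nu> m * r ^ m)"
    by (rule summable_Gegenbauer_bound[OF assms])
  have "(\<lambda>M. (\<Sum>m. Gegenbauer_bound \<nu> m * r ^ m) - (\<Sum>m<M. Gegenbauer_bound \<nu> m * r ^ m)) \<longlonglongrightarrow>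
      (\<Sum>m. Gegenbauer_bound \<nu> m * r ^ m) - (\<Sum>m. Gegenbauer_bound \<nu> m * r ^ m)"
    by (intro tendsto_intros summable_LIMSEQ S)
  then have "\<forall>\<^sub>F M in sequentially. (\<Sum>m. Gegenbauer_bound \<nu> m * r ^ m) - (\<Sum>m<M. Gegenbauer_bound \<nu> m * r ^ m) < \<delta>"
    using \<open>\<delta> > 0\<close> by (intro order_tendstoD(2)) auto
  then show ?thesis
  proof eventually_elim
    case (elim M)
    show ?case
    proof (intro allI impI)
      fix t :: real
      assume t: "\<bar>t\<bar> \<le> 1"
      have le: "normalized_Gegenbauer \<nu> m t * r ^ m \<le> Gegenbauer_bound \<nu> m * r ^ m" for m
        using abs_Gegenbauer_le[OF assms(1) t, of m] assms by (intro mult_right_mono) auto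
      have S2: "summable (\<lambda>m. normalized_Gegenbauer \<nu> m t * r ^ m)"
        by (rule summable_comparison_test'[OF S])
          (use abs_Gegenbauer_le[OF assms(1) t] assms in \<open>auto simp: abs_mult intro!: mult_right_mono\<close>)
      have "(\<Sum>m. normalized_Gegenbauer \<nu> m t * r ^ m) - (\<Sum>m<M. normalized_Gegenbauer \<nu> m t * r ^ m) =
         (\<Sum>m. normalized_Gegenbauer \<nu> (m + M) t * r ^ (m + M))"
        using suminf_split_initial_segment[OF S2, of M] by simp
      also have "\<dots> \<le> (\<Sum>m. Gegenbauer_bound \<nu> (m + M) * r ^ (m + M))"
        using le summable_ignore_initial_segment[OF S, of M] summable_ignore_initial_segment[OF S2, of M]
        by (intro suminf_le) auto
      also have "\<dots> = (\<Sum>m. Gegenbauer_bound \<nu> m * r ^ m) - (\<Sum>m<M. Gegenbauer_bound \<nu> m * r ^ m)"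
        using suminf_split_initial_segment[OF S, of M] by simp
      finally show "(\<Sum>m<M. normalized_Gegenbauer \<nu> m t * r ^ m) \<ge> 0"
        using elim Poisson_kernel_ge[OF assms t] by (simp add: \<delta>_def)
    qed
  qed
qed

text \<open>The boundary values at \<open>v0\<close> are normalised so that they become a truncated Poisson
  kernel; since ratios of modified Bessel functions of different order tend to \<open>1\<close>, the
  normalisation disappears in the limit \<open>v0 \<rightarrow> \<infinity>\<close>.\<close>

lemma truncated_Bessel_Gegenbauer_nonneg:
  assumes "b > 0" "\<nu> \<ge> - 1 / 2" "b * \<nu> > -1" "v > 0" "0 < r" "\<bar>t\<bar> \<le> 1" "M > 0"
    and nonneg: "\<And>t. \<bar>t\<bar> \<le> 1 \<Longrightarrow> (\<Sum>m<M. normalized_Gegenbauer \<nu> m t * r ^ m) \<ge> 0"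
  shows "(\<Sum>m<M. Bessel_I (b * (real m + \<nu>)) v * normalized_Gegenbauer \<nu> m t * r ^ m) \<ge> 0"
proof -
  define \<mu> where "\<mu> m = b * (real m + \<nu>)" for m
  have \<mu>: "\<mu> m > -1" "\<mu> 0 \<le> \<mu> m" for m
    unfolding \<mu>_def using assms(1) Bessel_order_gt[OF assms(1,3)] by (simp_all add: distrib_left)
  define I where "I m v = Bessel_I (\<mu> m) v" for m v
  have I_pos: "I m v > 0" if "v > 0" for m v
    unfolding I_def using \<mu> that by (intro Bessel_I_pos)
  have I_exp: "exp (\<mu> m * ln v) * Bessel_Clifford (\<mu> m) (exp (2 * ln v)) = I m v" if "v > 0" for m v
  proof -
    have "exp (2 * ln v) = v\<^sup>2"
      using that by (simp add: exp_double)
    then show ?thesis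
      using that by (simp add: I_def Bessel_I_def powr_def)
  qed
  \<comment> \<open>The common factor \<open>I 0 v0\<close> does not affect the sign, but gives the
    coefficients the finite limits r^m as v0 tends to \<infinity>.\<close>
  have "(\<Sum>m<M. r ^ m * (I 0 v0 / I m v0) * I m v * poly (Gegenbauer_poly \<nu> m) t) \<ge> 0" if "v0 \<ge> v" for v0
  proof -
    have v0: "v0 > 0"
      using that assms by simp
    have "(\<Sum>m<M. r ^ m * (I 0 v0 / I m v0) * (exp (\<mu> m * ln v) * Bessel_Clifford (\<mu> m) (exp (2 * ln v))) *
        poly (Gegenbauer_poly \<nu> m) t) \<ge> 0"
      unfolding \<mu>_def
    proof (rule Bessel_Gegenbauer_minimum_principle[OF assms(1-3) _ assms(7) _ _ assms(6)])
      show "r ^ 0 * (I 0 v0 / I 0 v0) \<ge> 0"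
        by simp
      show "ln v \<le> ln v0"
        using assms that by simp
      fix s :: real
      assume s: "\<bar>s\<bar> \<le> 1"
      have "(\<Sum>m<M. r ^ m * (I 0 v0 / I m v0) * (exp (\<mu> m * ln v0) * Bessel_Clifford (\<mu> m) (exp (2 * ln v0))) *
          poly (Gegenbauer_poly \<nu> m) s) = I 0 v0 * (\<Sum>m<M. normalized_Gegenbauer \<nu> m s * r ^ m)"
        unfolding I_exp[OF v0] sum_distrib_left normalized_Gegenbauer_eq_poly
        using I_pos[OF v0] by (intro sum.cong refl) (simp add: less_imp_neq[THEN not_sym])
      also have "\<dots> \<ge> 0"
        using nonneg[OF s] I_pos[OF v0, of 0] by simp
      finally show "0 \<le> (\<Sum>m<M. r ^ m * (I 0 v0 / I m v0) *
          (exp (b * (real m + \<nu>) * ln v0) * Bessel_Clifford (b * (real m + \<nu>)) (exp (2 * ln v0))) *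
          poly (Gegenbauer_poly \<nu> m) s)"
        unfolding \<mu>_def .
    qed
    then show ?thesis
      unfolding I_exp[OF assms(4)] .
  qed
  then have "\<forall>\<^sub>F v0 in at_top. (\<Sum>m<M. r ^ m * (I 0 v0 / I m v0) * I m v * poly (Gegenbauer_poly \<nu> m) t) \<ge> 0"
    using eventually_ge_at_top[of v] by (rule eventually_mono[rotated])
  moreover have "((\<lambda>v0. \<Sum>m<M. r ^ m * (I 0 v0 / I m v0) * I m v * poly (Gegenbauer_poly \<nu> m) t) \<longlongrightarrow>
     (\<Sum>m<M. r ^ m * 1 * I m v * poly (Gegenbauer_poly \<nu> m) t)) at_top"
  proof (intro tendsto_intros)
    fix m
    have "((\<lambda>v0. inverse (I m v0 / I 0 v0)) \<longlongrightarrow> inverse 1) at_top"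
      unfolding I_def using \<mu> by (intro tendsto_inverse tendsto_Bessel_I_ratio) auto
    then show "((\<lambda>v0. I 0 v0 / I m v0) \<longlongrightarrow> 1) at_top"
      by simp
  qed
  ultimately have "(\<Sum>m<M. r ^ m * 1 * I m v * poly (Gegenbauer_poly \<nu> m) t) \<ge> 0"
    by (intro tendsto_lowerbound) auto
  then show ?thesis
    by (simp add: I_def \<mu>_def normalized_Gegenbauer_eq_poly mult_ac)
qed

text \<open>The cutoff M obtained for the Poisson kernel depends on r and is not controlled as r
  tends to 1, so M cannot be fixed in that limit. Instead the damped sum up to a fixed K is bounded
  below by minus a tail of the majorant \<open>T\<close>, uniformly in r. Then r tends to 1, and
  afterwards K to \<infinity>.\<close>

theorem Bessel_Gegenbauer_series_nonneg:
  assumes "b > 0" "\<nu> \<ge> - 1 / 2" "b * \<nu> > -1" "v \<ge> 0" "\<bar>t\<bar> \<le> 1"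
  shows "(\<Sum>m. Bessel_term b \<nu> v (v\<^sup>2) m * normalized_Gegenbauer \<nu> m t) \<ge> 0" (is "suminf ?f \<ge> 0")
proof (cases "v = 0")
  case True
  have "?f sums sum ?f {0}"
    using True by (intro sums_finite) (auto simp: Bessel_term_def)
  moreover have "Bessel_Clifford (b * \<nu>) 0 > 0"
    using assms by (intro Bessel_Clifford_pos) auto
  ultimately show ?thesis
    using True by (simp add: sums_iff Bessel_term_def normalized_Gegenbauer_eq_poly Gegenbauer_poly_0)
next
  case False
  then have v: "v > 0"
    using assms by simp
  have \<nu>: "\<nu> > -1"
    using assms by simp
  define A where "A = Bessel_term b \<nu> v (v\<^sup>2)"
  define C where "C m = normalized_Gegenbauer \<nu> m t" for m
  note \<mu> = Bessel_order_gt[OF assms(1,3)]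
  have A: "A m > 0" for m
    unfolding A_def Bessel_term_def using v \<mu> by (intro mult_pos_pos Bessel_Clifford_pos) auto
  have A_eq: "Bessel_I (b * (real m + \<nu>)) v = v powr (b * \<nu>) * A m" for m
    using v by (simp add: A_def Bessel_term_def Bessel_I_def distrib_left powr_add powr_powr[symmetric] powr_realpow)
  have C: "\<bar>C m\<bar> \<le> Gegenbauer_bound \<nu> m" for m
    unfolding C_def by (rule abs_Gegenbauer_le[OF \<nu> assms(5)])
  define T where "T m = A m * Gegenbauer_bound \<nu> m" for m
  have T: "summable T"
    using summable_Bessel_Gegenbauer_bound[OF assms(1) \<nu> assms(3,4), of "v\<^sup>2"] A
    unfolding T_def[abs_def] A_def[symmetric] by (simp add: abs_of_pos)
  have AC: "\<bar>A m * C m\<bar> \<le> T m" for m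
    unfolding T_def abs_mult using A[of m] C[of m] by (intro mult_mono) auto
  have S: "summable (\<lambda>m. A m * C m)"
    by (rule summable_comparison_test'[OF T]) (use AC in auto)
  have tail: "(\<Sum>m<K. A m * C m * r ^ m) \<ge> - (\<Sum>m. T (m + K))" if r: "0 < r" "r < 1" for r K
  proof -
    have "\<forall>\<^sub>F M in sequentially. (\<Sum>m<M. A m * C m * r ^ m) \<ge> 0"
      using truncated_Poisson_kernel_nonneg[OF \<nu> less_imp_le[OF r(1)] r(2)] eventually_gt_at_top[of 0]
    proof eventually_elim
      case (elim M)
      have "(\<Sum>m<M. Bessel_I (b * (real m + \<nu>)) v * normalized_Gegenbauer \<nu> m t * r ^ m) \<ge> 0"
        using elim by (intro truncated_Bessel_Gegenbauer_nonneg assms v r) auto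
      also have "(\<Sum>m<M. Bessel_I (b * (real m + \<nu>)) v * normalized_Gegenbauer \<nu> m t * r ^ m) =
          v powr (b * \<nu>) * (\<Sum>m<M. A m * C m * r ^ m)"
        unfolding A_eq C_def sum_distrib_left by (simp add: mult_ac)
      finally show ?case
        using v by (simp add: zero_le_mult_iff)
    qed
    then have "\<forall>\<^sub>F M in sequentially. M \<ge> K \<and> (\<Sum>m<M. A m * C m * r ^ m) \<ge> 0"
      using eventually_ge_at_top[of K] by eventually_elim simp
    then obtain M where M: "M \<ge> K" "(\<Sum>m<M. A m * C m * r ^ m) \<ge> 0"
      by (auto dest: eventually_happens)
    have "(\<Sum>m<M. A m * C m * r ^ m) = (\<Sum>m<K. A m * C m * r ^ m) + (\<Sum>m\<in>{K..<M}. A m * C m * r ^ m)"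
      unfolding lessThan_atLeast0 using M(1) by (intro sum.atLeastLessThan_concat[symmetric]) auto
    also have "(\<Sum>m\<in>{K..<M}. A m * C m * r ^ m) \<le> (\<Sum>m\<in>{K..<M}. T m)"
    proof (rule sum_mono)
      fix m
      have "A m * C m * r ^ m \<le> \<bar>A m * C m\<bar> * r ^ m"
        using r by (intro mult_right_mono) auto
      also have "\<dots> \<le> \<bar>A m * C m\<bar> * 1"
        using r by (intro mult_left_mono power_le_one) auto
      finally show "A m * C m * r ^ m \<le> T m"
        using AC[of m] by simp
    qed
    also have "(\<Sum>m\<in>{K..<M}. T m) = (\<Sum>m<M - K. T (m + K))"
      using M(1) sum.shift_bounds_nat_ivl[of T 0 K "M - K"] by (simp add: lessThan_atLeast0)
    also have "\<dots> \<le> (\<Sum>m. T (m + K))"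
      using T AC by (intro sum_le_suminf) (auto simp: summable_iff_shift intro: order_trans[OF abs_ge_zero])
    finally show ?thesis
      using M(2) by simp
  qed
  have "(\<Sum>m<K. A m * C m) \<ge> - (\<Sum>m. T (m + K))" for K
  proof -
    have "((\<lambda>r. \<Sum>m<K. A m * C m * r ^ m) \<longlongrightarrow> (\<Sum>m<K. A m * C m * 1 ^ m)) (at_left 1)"
      by (intro tendsto_intros)
    moreover have "\<forall>\<^sub>F r in at_left 1. (\<Sum>m<K. A m * C m * r ^ m) \<ge> - (\<Sum>m. T (m + K))"
      using eventually_at_left_real[of 0 1] by (rule eventually_mono) (use tail in auto)
    ultimately show ?thesis
      using tendsto_lowerbound[of _ _ "at_left (1::real)"] by fastforce
  qed
  moreover have "(\<lambda>K. - (\<Sum>m. T (m + K))) \<longlonglongrightarrow> - 0"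
  proof (intro tendsto_minus)
    have "(\<lambda>K. suminf T - sum T {..<K}) \<longlonglongrightarrow> suminf T - suminf T"
      by (intro tendsto_intros summable_LIMSEQ T)
    then show "(\<lambda>K. \<Sum>m. T (m + K)) \<longlonglongrightarrow> 0"
      using suminf_minus_initial_segment[OF T] by simp
  qed
  ultimately have "- 0 \<le> (\<Sum>m. A m * C m)"
    by (intro LIMSEQ_le[OF _ summable_LIMSEQ[OF S]]) auto
  then show ?thesis
    by (simp add: A_def C_def)
qed

section \<open>Polar coordinates\<close>

text \<open>Up to the factor \<open>1 / DIM('a)\<close>, this is the integral of \<open>G (sgn \<xi>)\<close> over the unit sphere
  if \<open>G\<close> is homogeneous of degree \<open>0\<close>.\<close>

definition angular_integral :: "('a::euclidean_space \<Rightarrow> real) \<Rightarrow> real" where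
  "angular_integral G = (\<integral>\<xi>. indicator (cball 0 1) \<xi> * G \<xi> \<partial>lborel)"

text \<open>Bounded measurable functions on the sphere, extended constantly along rays. This
  replaces a surface measure by Lebesgue measure on the unit ball.\<close>

definition homogeneous_zero :: "('a::euclidean_space \<Rightarrow> real) \<Rightarrow> bool" where
  "homogeneous_zero G \<longleftrightarrow> G \<in> borel_measurable borel \<and> (\<exists>K. \<forall>\<xi>. \<bar>G \<xi>\<bar> \<le> K) \<and>
     (\<forall>c \<xi>. c > 0 \<longrightarrow> G (c *\<^sub>R \<xi>) = G \<xi>)"

lemma sets_cball [measurable]: "cball (c :: 'a::euclidean_space) r \<in> sets borel"
  by simp

lemma integrable_indicator_ball:
  fixes G :: "'a::euclidean_space \<Rightarrow> real"
  assumes "homogeneous_zero G"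
  shows "integrable lborel (\<lambda>\<xi>. indicator (cball 0 1) \<xi> * G \<xi>)"
proof -
  obtain K where K: "\<And>\<xi>. \<bar>G \<xi>\<bar> \<le> K"
    using assms by (auto simp: homogeneous_zero_def)
  have [measurable]: "G \<in> borel_measurable borel"
    using assms by (simp add: homogeneous_zero_def)
  have "integrable lborel (\<lambda>\<xi>. indicator (cball 0 1 :: 'a set) \<xi> * K)"
    by (intro integrable_mult_left integrable_real_indicator emeasure_bounded_finite) auto
  then show ?thesis
  proof (rule Bochner_Integration.integrable_bound)
    show "AE x in lborel. norm (indicator (cball 0 1) x * G x) \<le> norm (indicator (cball 0 1) x * K)"
      by (intro AE_I2) (auto simp: indicator_def intro: order_trans[OF K abs_ge_self])
  next
    show "(\<lambda>\<xi>. indicator (cball 0 1) \<xi> * G \<xi>) \<in> borel_measurable lborel"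
      unfolding measurable_lborel1 by measurable
  qed
qed

text \<open>Both measures agree on every half-line up to \<zeta>: scaling by \<rho> = \<zeta>^(1/a)
  reduces the ball of radius \<rho> to the unit ball without changing G. The variable is |\<xi>|^a
  instead of |\<xi>| because kernel and weight depend on \<xi> through this power and the
  direction.\<close>

lemma distr_norm_powr:
  fixes G :: "'a::euclidean_space \<Rightarrow> real" and a :: real
  assumes "homogeneous_zero G" "\<And>\<xi>. G \<xi> \<ge> 0" "a > 0"
  shows "distr (density lborel (\<lambda>\<xi>. ennreal (G \<xi>))) borel (\<lambda>\<xi>. norm \<xi> powr a) =
    density lborel (\<lambda>z. ennreal (angular_integral G * (real DIM('a) / a) *
      (indicator {0<..} z * z powr (real DIM('a) / a - 1))))" (is "?M = ?N")
proof (rule measure_eqI_generator_eq[where E = "range (\<lambda>a::real. {..a})" and \<Omega> = UNIV and A = "\<lambda>n. {..real n}"])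
  define n where "n = real DIM('a)"
  let ?I = "\<lambda>\<rho> \<xi>. ennreal (indicator (cball 0 \<rho>) \<xi> * G \<xi>)"
  let ?v = "\<lambda>\<zeta>. if \<zeta> > 0 then ennreal (angular_integral G * \<zeta> powr (n / a)) else 0"
  have n: "n > 0"
    by (simp add: n_def)
  have meas [measurable]: "G \<in> borel_measurable borel"
    using assms by (simp add: homogeneous_zero_def)
  have nonneg: "angular_integral G \<ge> 0"
    unfolding angular_integral_def using assms(2) by (intro Bochner_Integration.integral_nonneg) auto
  have ball: "(\<integral>\<^sup>+\<xi>. ?I 1 \<xi> \<partial>lborel) = ennreal (angular_integral G)"
    unfolding angular_integral_def using assms(2) integrable_indicator_ball[OF assms(1)]
    by (intro nn_integral_eq_integral) auto
  have pre [measurable]: "(\<lambda>\<xi>::'a. norm \<xi> powr a) -` {..\<zeta>} \<in> sets borel" for \<zeta>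
    by (rule measurable_sets_borel[of _ borel]) measurable
  have M: "emeasure ?M {..\<zeta>} = (?v \<zeta>)" for \<zeta>
  proof (cases "\<zeta> > 0")
    case True
    define \<rho> where "\<rho> = \<zeta> powr (1 / a)"
    have \<rho>: "\<rho> > 0"
      using True by (simp add: \<rho>_def)
    have iff: "norm \<xi> powr a \<le> \<zeta> \<longleftrightarrow> norm \<xi> \<le> \<rho>" for \<xi> :: 'a
    proof -
      have "\<zeta> = \<rho> powr a"
        using True assms(3) by (simp add: \<rho>_def powr_powr)
      then show ?thesis
        using assms(3) \<rho> by (metis norm_ge_zero order_less_imp_le powr_less_mono2 powr_mono2 not_le)
    qed
    have "emeasure ?M {..\<zeta>} = (\<integral>\<^sup>+\<xi>. ?I \<rho> \<xi> \<partial>lborel)"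
      by (subst emeasure_distr, simp, simp, subst emeasure_density)
        (auto simp: iff indicator_def ennreal_mult[symmetric] intro!: nn_integral_cong)
    also have "\<dots> = (\<integral>\<^sup>+\<xi>. ennreal (\<rho> ^ DIM('a)) * ?I 1 \<xi> \<partial>lborel)"
    proof -
      have meas_ind: "(\<lambda>\<xi>. ?I \<rho> \<xi>) \<in> borel_measurable borel"
        by measurable
      have "(\<integral>\<^sup>+\<xi>. ?I \<rho> \<xi> \<partial>lborel) =
          (\<integral>\<^sup>+\<xi>. ?I \<rho> \<xi>
            \<partial>density (distr lborel borel (\<lambda>x. 0 + \<rho> *\<^sub>R x)) (\<lambda>_. ennreal (\<bar>\<rho>\<bar> ^ DIM('a))))"
        using lborel_affine[of \<rho> "0 :: 'a"] \<rho> by simp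
      also have "\<dots> = (\<integral>\<^sup>+\<xi>. ennreal (\<bar>\<rho>\<bar> ^ DIM('a)) * ?I \<rho> \<xi>
            \<partial>distr lborel borel (\<lambda>x. 0 + \<rho> *\<^sub>R x))"
        by (rule nn_integral_density) (use meas_ind in simp_all)
      also have "\<dots> = (\<integral>\<^sup>+\<xi>. ennreal (\<bar>\<rho>\<bar> ^ DIM('a)) *
          ennreal (indicator (cball 0 \<rho>) (0 + \<rho> *\<^sub>R \<xi>) * G (0 + \<rho> *\<^sub>R \<xi>)) \<partial>lborel)"
        by (rule nn_integral_distr) measurable
      also have "\<dots> = (\<integral>\<^sup>+\<xi>. ennreal (\<rho> ^ DIM('a)) * ?I 1 \<xi> \<partial>lborel)"
        using \<rho> assms(1) by (intro nn_integral_cong) (simp add: homogeneous_zero_def indicator_def)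
      finally show ?thesis .
    qed
    also have "\<dots> = ennreal (\<rho> ^ DIM('a)) * ennreal (angular_integral G)"
      by (subst nn_integral_cmult) (auto simp: ball)
    also have "\<rho> ^ DIM('a) = \<zeta> powr (n / a)"
      using True by (simp add: \<rho>_def n_def powr_powr flip: powr_realpow)
    finally show ?thesis
      using True nonneg by (simp add: ennreal_mult[symmetric] mult.commute)
  next
    case False
    have "emeasure ?M {..\<zeta>} = (\<integral>\<^sup>+\<xi>. ennreal (G \<xi>) * indicator {\<xi>. norm \<xi> powr a \<le> \<zeta>} \<xi> \<partial>lborel)"
      by (subst emeasure_distr, simp, simp, subst emeasure_density) (auto intro!: nn_integral_cong simp: indicator_def)
    also have "\<dots> = (\<integral>\<^sup>+\<xi>. 0 \<partial>(lborel :: 'a measure))"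
    proof (rule nn_integral_cong_AE)
      have "AE \<xi> in lborel. \<xi> \<noteq> (0 :: 'a)"
        by (rule AE_lborel_singleton)
      then show "AE \<xi> in lborel. ennreal (G \<xi>) * indicator {\<xi>. norm \<xi> powr a \<le> \<zeta>} \<xi> = 0"
      proof eventually_elim
        case (elim \<xi>)
        then have "norm \<xi> powr a > 0"
          by simp
        then have "\<not> norm \<xi> powr a \<le> \<zeta>"
          using False by linarith
        then show ?case
          by simp
      qed
    qed
    finally show ?thesis
      using False by simp
  qed
  have N: "emeasure ?N {..\<zeta>} = (?v \<zeta>)" for \<zeta>
  proof (cases "\<zeta> > 0")
    case True
    let ?J = "\<lambda>z. ennreal (indicator {0..\<zeta>} z * z powr (n / a - 1))"
    have hi: "((\<lambda>z. z powr (n / a - 1)) has_integral (\<zeta> powr (n / a - 1 + 1) / (n / a - 1 + 1))) {0..\<zeta>}"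
      using True n assms(3) by (intro has_integral_powr_from_0) auto
    have "(\<integral>\<^sup>+z. ?J z \<partial>lborel) = ennreal (\<zeta> powr (n / a) / (n / a))"
      using nn_integral_has_integral_lebesgue[OF _ hi] by simp
    have "emeasure ?N {..\<zeta>} = (\<integral>\<^sup>+z. ennreal (angular_integral G * (n / a)) *
        ?J z \<partial>lborel)"
      using n assms(3) nonneg unfolding n_def[symmetric]
      by (subst emeasure_density)
        (auto simp: indicator_def ennreal_mult[symmetric] intro!: nn_integral_cong)
    also have "\<dots> = ennreal (angular_integral G * (n / a)) * ennreal (\<zeta> powr (n / a) / (n / a))"
      by (subst nn_integral_cmult) (use \<open>_ = ennreal (\<zeta> powr (n / a) / (n / a))\<close> in auto)
    also have "\<dots> = ennreal (angular_integral G * \<zeta> powr (n / a))"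
      using n assms(3) nonneg by (subst ennreal_mult[symmetric]) auto
    finally show ?thesis
      using True by simp
  next
    case False
    then show ?thesis
      by (subst emeasure_density) (auto simp: nn_integral_0_iff_AE indicator_def intro!: AE_I2)
  qed
  show "Int_stable (range (\<lambda>a::real. {..a}))"
    by (auto simp: Int_stable_def)
  show "emeasure ?M X = emeasure ?N X" if "X \<in> range (\<lambda>a::real. {..a})" for X
    using that M N by auto
  show "emeasure ?M {..real i} \<noteq> \<infinity>" for i
    unfolding M by simp
  show "sets ?M = sigma_sets UNIV (range (\<lambda>a::real. {..a}))" "sets ?N = sigma_sets UNIV (range (\<lambda>a::real. {..a}))"
    by (simp_all add: borel_eq_atMost)
  show "(\<Union>i. {..real i}) = UNIV"
    using real_arch_simple by auto
qed auto

lemma polar_integral_nonneg: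
  fixes G :: "'a::euclidean_space \<Rightarrow> real" and R :: "real \<Rightarrow> real" and a :: real
  assumes "homogeneous_zero G" "\<And>\<xi>. G \<xi> \<ge> 0" "a > 0"
    and [measurable]: "R \<in> borel_measurable borel"
    and int: "integrable lborel (\<lambda>z. indicator {0<..} z * (R z * z powr (real DIM('a) / a - 1)))"
  shows "integrable lborel (\<lambda>\<xi>. R (norm \<xi> powr a) * G \<xi>)" (is ?A)
    and "(\<integral>\<xi>. R (norm \<xi> powr a) * G \<xi> \<partial>lborel) = angular_integral G * (real DIM('a) / a) *
       (\<integral>z. indicator {0<..} z * (R z * z powr (real DIM('a) / a - 1)) \<partial>lborel)" (is ?B)
proof -
  have [measurable]: "G \<in> borel_measurable borel"
    using assms by (simp add: homogeneous_zero_def)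
  define k where "k = angular_integral G * (real DIM('a) / a)"
  have "angular_integral G \<ge> 0"
    unfolding angular_integral_def using assms(2) by (intro Bochner_Integration.integral_nonneg) auto
  then have k: "k \<ge> 0"
    using assms(3) by (simp add: k_def)
  define w where "w z = k * (indicator {0<..} z * z powr (real DIM('a) / a - 1))" for z :: real
  have w [measurable]: "w \<in> borel_measurable borel" "\<And>z. w z \<ge> 0"
    using k by (auto simp: w_def[abs_def])
  have eq: "distr (density lborel (\<lambda>\<xi>. ennreal (G \<xi>))) borel (\<lambda>\<xi>. norm \<xi> powr a) = density lborel w"
    unfolding w_def k_def by (rule distr_norm_powr[OF assms(1-3)])
  have w_eq: "w z *\<^sub>R R z = k * (indicator {0<..} z * (R z * z powr (real DIM('a) / a - 1)))" for z
    by (simp add: w_def)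
  have "integrable lborel (\<lambda>z. w z *\<^sub>R R z)"
    unfolding w_eq by (intro integrable_mult_right int)
  then have "integrable (density lborel w) R"
    using w by (subst integrable_density) auto
  then have "integrable (density lborel (\<lambda>\<xi>. ennreal (G \<xi>))) (\<lambda>\<xi>. R (norm \<xi> powr a))"
    unfolding eq[symmetric] by (subst (asm) integrable_distr_eq) auto
  then show ?A
    using assms(2) by (subst (asm) integrable_density) (auto simp: mult.commute)
  have "(\<integral>\<xi>. R (norm \<xi> powr a) * G \<xi> \<partial>lborel) = (\<integral>\<xi>. R (norm \<xi> powr a) \<partial>density lborel (\<lambda>\<xi>. ennreal (G \<xi>)))"
    using assms(2) by (subst integral_density) (auto simp: mult.commute)
  also have "\<dots> = (\<integral>z. R z \<partial>density lborel w)"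
    unfolding eq[symmetric] by (subst integral_distr) auto
  also have "\<dots> = (\<integral>z. w z *\<^sub>R R z \<partial>lborel)"
    using w by (subst integral_density) auto
  also have "\<dots> = k * (\<integral>z. indicator {0<..} z * (R z * z powr (real DIM('a) / a - 1)) \<partial>lborel)"
    unfolding w_eq by simp
  finally show ?B
    unfolding k_def .
qed

lemma homogeneous_zero_const: "homogeneous_zero (\<lambda>_. c)"
  by (auto simp: homogeneous_zero_def)

text \<open>A signed G cannot be a density, so it is written as the difference of the nonnegative
  functions G + K and K, with K a bound of G.\<close>

lemma polar_integral:
  fixes G :: "'a::euclidean_space \<Rightarrow> real" and R :: "real \<Rightarrow> real" and a :: real
  assumes "homogeneous_zero G" "a > 0" "R \<in> borel_measurable borel"
    and "integrable lborel (\<lambda>z. indicator {0<..} z * (R z * z powr (real DIM('a) / a - 1)))"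
  shows "integrable lborel (\<lambda>\<xi>. R (norm \<xi> powr a) * G \<xi>)" (is ?A)
    and "(\<integral>\<xi>. R (norm \<xi> powr a) * G \<xi> \<partial>lborel) = angular_integral G * (real DIM('a) / a) *
       (\<integral>z. indicator {0<..} z * (R z * z powr (real DIM('a) / a - 1)) \<partial>lborel)" (is ?B)
proof -
  obtain K where K: "\<And>\<xi>. \<bar>G \<xi>\<bar> \<le> K"
    using assms(1) by (auto simp: homogeneous_zero_def)
  define H where "H \<xi> = G \<xi> + K" for \<xi>
  have H_nonneg: "H \<xi> \<ge> 0" for \<xi>
    using K[of \<xi>] by (simp add: H_def)
  have "\<bar>H \<xi>\<bar> \<le> 2 * K" for \<xi>
    using K[of \<xi>] by (simp add: H_def)
  then have H: "homogeneous_zero H"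
    using assms(1) unfolding homogeneous_zero_def by (auto simp: H_def[abs_def])
  have K_nonneg: "K \<ge> 0"
    using K[of 0] by simp
  note 1 = polar_integral_nonneg[OF H H_nonneg assms(2-4)]
  note 2 = polar_integral_nonneg[OF homogeneous_zero_const[of K] K_nonneg assms(2-4)]
  have eq: "R (norm \<xi> powr a) * G \<xi> = R (norm \<xi> powr a) * H \<xi> - R (norm \<xi> powr a) * K" for \<xi>
    by (simp add: H_def algebra_simps)
  show ?A
    unfolding eq by (intro Bochner_Integration.integrable_diff 1(1) 2(1))
  have "angular_integral G = angular_integral H - angular_integral (\<lambda>_::'a. K)"
    unfolding angular_integral_def
    using Bochner_Integration.integral_diff[OF integrable_indicator_ball[OF H]
        integrable_indicator_ball[OF homogeneous_zero_const[of K]]]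
    by (simp add: H_def algebra_simps)
  then show ?B
    unfolding eq Bochner_Integration.integral_diff[OF 1(1) 2(1)] 1(2) 2(2)
    by (simp add: left_diff_distrib diff_divide_distrib)
qed

section \<open>Orthogonality on the sphere\<close>

lemma lborel_integral_translate:
  fixes f :: "'a::euclidean_space \<Rightarrow> real"
  assumes [measurable]: "f \<in> borel_measurable borel"
  shows "integrable lborel (\<lambda>\<xi>. f (\<xi> + a)) \<longleftrightarrow> integrable lborel f" (is ?A)
    and "(\<integral>\<xi>. f (\<xi> + a) \<partial>lborel) = (\<integral>\<xi>. f \<xi> \<partial>lborel)" (is ?B)
proof -
  have eq: "lborel = distr lborel borel (\<lambda>\<xi>::'a. \<xi> + a)"
    using lborel_distr_plus[of a] by (simp add: add.commute[of _ a])
  show ?A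
    by (subst (2) eq) (simp add: integrable_distr_eq)
  show ?B
    by (subst (2) eq) (simp add: integral_distr)
qed

text \<open>Integrating \<open>h (\<xi> + w) - h \<xi>\<close> gives \<open>0\<close> by translation invariance.\<close>

lemma integral_directional_derivative_eq_0:
  fixes h h' :: "'a::euclidean_space \<Rightarrow> real"
  assumes deriv: "\<And>\<xi> s. ((\<lambda>s. h (\<xi> + s *\<^sub>R w)) has_real_derivative h' (\<xi> + s *\<^sub>R w)) (at s)"
    and h: "integrable lborel h" and h': "integrable lborel h'" and cont: "continuous_on UNIV h'"
  shows "(\<integral>\<xi>. h' \<xi> \<partial>lborel) = 0"
proof -
  have [measurable]: "h \<in> borel_measurable borel" "h' \<in> borel_measurable borel"
    using h h' by (auto dest: borel_measurable_integrable)
  \<comment> \<open>The double integral is computed twice: integrating over s first gives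
    \<open>h (\<xi> + w) - h \<xi>\<close>, integrating over \<xi> first gives a value that does not
    depend on s in [0, 1].\<close>
  define f where "f = (\<lambda>(s :: real, \<xi>). h' (\<xi> + s *\<^sub>R w) * indicator {0..1} s)"
  have f_meas: "f \<in> borel_measurable (lborel \<Otimes>\<^sub>M lborel)"
    unfolding f_def by measurable
  have int_f: "integrable (lborel \<Otimes>\<^sub>M lborel) f"
  proof (rule lborel_pair.Fubini_integrable[OF f_meas])
    have "(\<integral>\<xi>. norm (f (s, \<xi>)) \<partial>lborel) = indicator {0..1} s * (\<integral>\<xi>. \<bar>h' \<xi>\<bar> \<partial>lborel)" for s
    proof -
      have "(\<integral>\<xi>. norm (f (s, \<xi>)) \<partial>lborel) = (\<integral>\<xi>. indicator {0..1} s * \<bar>h' (\<xi> + s *\<^sub>R w)\<bar> \<partial>lborel)"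
        by (simp add: f_def abs_mult mult.commute)
      also have "\<dots> = indicator {0..1} s * (\<integral>\<xi>. \<bar>h' (\<xi> + s *\<^sub>R w)\<bar> \<partial>lborel)"
        by (rule integral_mult_right_zero)
      finally show ?thesis
        using lborel_integral_translate(2)[of "\<lambda>\<xi>. \<bar>h' \<xi>\<bar>" "s *\<^sub>R w"] by simp
    qed
    then show "integrable lborel (\<lambda>s. \<integral>\<xi>. norm (f (s, \<xi>)) \<partial>lborel)"
      by (simp add: emeasure_bounded_finite)
    show "AE s in lborel. integrable lborel (\<lambda>\<xi>. f (s, \<xi>))"
      using h' lborel_integral_translate(1)[of h'] by (auto simp: f_def)
  qed
  have "(\<integral>s. (\<integral>\<xi>. f (s, \<xi>) \<partial>lborel) \<partial>lborel) = (\<integral>\<xi>. (\<integral>s. f (s, \<xi>) \<partial>lborel) \<partial>lborel)"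
    by (rule lborel_pair.Fubini_integral[symmetric]) (use int_f in \<open>simp add: case_prod_unfold\<close>)
  moreover have "(\<integral>s. f (s, \<xi>) \<partial>lborel) = h (\<xi> + w) - h \<xi>" for \<xi>
  proof -
    have "(\<integral>s. h' (\<xi> + s *\<^sub>R w) * indicator {0..1} s \<partial>lborel) = h (\<xi> + 1 *\<^sub>R w) - h (\<xi> + 0 *\<^sub>R w)"
    proof (rule integral_FTC_Icc_real)
      have "continuous_on UNIV (\<lambda>s. h' (\<xi> + s *\<^sub>R w))"
        by (rule continuous_on_compose2[OF cont]) (auto intro!: continuous_intros)
      then show "isCont (\<lambda>s. h' (\<xi> + s *\<^sub>R w)) s" for s
        by (simp add: continuous_on_eq_continuous_at)
    qed (use deriv in auto)
    then show ?thesis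
      by (simp add: f_def)
  qed
  moreover have "(\<integral>\<xi>. f (s, \<xi>) \<partial>lborel) = indicator {0..1} s * (\<integral>\<xi>. h' \<xi> \<partial>lborel)" for s
    using lborel_integral_translate(2)[of h' "s *\<^sub>R w"] by (simp add: f_def mult.commute)
  moreover have "(\<integral>\<xi>. h (\<xi> + w) - h \<xi> \<partial>lborel) = 0"
    using h lborel_integral_translate[of h w] by simp
  ultimately show ?thesis
    by simp
qed

text \<open>The mean of \<open>(\<omega> \<bullet> \<xi>)\<^sup>p (\<eta> \<bullet> \<xi>)\<^sup>q\<close> for a standard Gaussian vector \<open>\<xi>\<close> and unit vectors \<open>\<omega>, \<eta>\<close>,
  as a polynomial in \<open>\<omega> \<bullet> \<eta>\<close>. The recursion is Gaussian integration by parts.\<close>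

fun Gauss_moment :: "nat \<Rightarrow> nat \<Rightarrow> real poly" where
  "Gauss_moment 0 0 = 1"
| "Gauss_moment 0 (Suc q) = of_nat q * Gauss_moment 0 (q - 1)"
| "Gauss_moment (Suc p) q = of_nat p * Gauss_moment (p - 1) q + of_nat q * ([:0, 1:] * Gauss_moment p (q - 1))"

text \<open>Integration by parts in the other vector. The defining recursion lowers the first
  argument as long as possible, so this mirrored form has to be proved; expanding crosswise by both
  recursions leads to the same terms.\<close>

lemma Gauss_moment_Suc_right:
  "Gauss_moment p (Suc q) = of_nat q * Gauss_moment p (q - 1) + of_nat p * ([:0, 1:] * Gauss_moment (p - 1) q)"
proof (induction p arbitrary: q rule: less_induct)
  case (less p)
  let ?G = Gauss_moment
  show ?case
  proof (cases p)
    case 0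
    then show ?thesis by simp
  next
    case (Suc r)
    define X :: "real poly" where "X = [:0, 1:]"
    \<comment> \<open>For r = 0 the truncated index \<open>r - 1\<close> would be wrong; the factor
      \<open>of_nat r\<close> on both sides makes the equation hold there as well.\<close>
    have 1: "of_nat r * ?G (r - 1) (Suc q) =
       of_nat r * (of_nat q * ?G (r - 1) (q - 1) + of_nat (r - 1) * (X * ?G (r - 1 - 1) q))"
      using less.IH[of "r - 1" q] Suc unfolding X_def by (cases r) auto
    have 2: "of_nat r * ?G r q = of_nat r * (of_nat (r - 1) * ?G (r - 1 - 1) q +
       of_nat q * (X * ?G (r - 1) (q - 1)))"
      unfolding X_def by (cases r) auto
    have 3: "of_nat q * ?G r q = of_nat q * (of_nat (q - 1) * ?G r (q - 1 - 1) +
       of_nat r * (X * ?G (r - 1) (q - 1)))"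
      using less.IH[of r "q - 1"] Suc unfolding X_def by (cases q) auto
    have "?G p (Suc q) = of_nat r * ?G (r - 1) (Suc q) + of_nat (Suc q) * (X * ?G r q)"
      unfolding Suc X_def by simp
    also have "\<dots> = of_nat q * (of_nat r * ?G (r - 1) (q - 1)) +
       X * (of_nat r * (of_nat (r - 1) * ?G (r - 1 - 1) q)) + of_nat q * (X * ?G r q) + X * ?G r q"
      unfolding 1 by (simp add: algebra_simps)
    also have "of_nat r * (of_nat (r - 1) * ?G (r - 1 - 1) q) =
       of_nat r * ?G r q - of_nat r * (of_nat q * (X * ?G (r - 1) (q - 1)))"
      unfolding 2 by (simp add: algebra_simps)
    also have "of_nat q * (X * ?G r q) = X * (of_nat q * (of_nat (q - 1) * ?G r (q - 1 - 1) +
       of_nat r * (X * ?G (r - 1) (q - 1))))"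
      unfolding 3[symmetric] by (simp add: algebra_simps)
    finally have "?G p (Suc q) = of_nat q * (of_nat r * ?G (r - 1) (q - 1) +
        of_nat (q - 1) * (X * ?G r (q - 1 - 1))) + of_nat (Suc r) * (X * ?G r q)"
      by (simp add: algebra_simps)
    also have "of_nat r * ?G (r - 1) (q - 1) + of_nat (q - 1) * (X * ?G r (q - 1 - 1)) =
        ?G p (q - 1)"
      unfolding Suc X_def by simp
    finally show ?thesis
      unfolding Suc X_def by simp
  qed
qed

lemma Gauss_moment_commute: "Gauss_moment p q = Gauss_moment q p"
proof (induction "p + q" arbitrary: p q rule: less_induct)
  case less
  show ?case
  proof (cases p)
    case 0
    then show ?thesis
      using less[of 0 "q - 2"] by (cases q) (auto simp: less Gauss_moment_Suc_right)
  next
    case (Suc r)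
    have "Gauss_moment (r - 1) q = Gauss_moment q (r - 1)"
      by (rule less) (use Suc in auto)
    moreover have "Gauss_moment r (q - 1) = Gauss_moment (q - 1) r"
      by (rule less) (use Suc in auto)
    ultimately show ?thesis
      unfolding Suc by (simp add: Gauss_moment_Suc_right)
  qed
qed

text \<open>Differentiating a Gaussian mean of f(X) g(Y) in the correlation of X and Y gives the
  mean of f'(X) g'(Y); here f and g are powers.\<close>

lemma pderiv_Gauss_moment:
  "pderiv (Gauss_moment p q) = of_nat p * of_nat q * Gauss_moment (p - 1) (q - 1)"
proof (induction p arbitrary: q rule: less_induct)
  case (less p)
  let ?G = Gauss_moment
  show ?case
  proof (cases p)
    case 0
    have "pderiv (?G 0 q) = 0"
      by (induction q rule: less_induct) (metis (no_types, opaque_lifting) Gauss_moment.simps(1,2) diff_le_self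
          le_imp_less_Suc mult_zero_right not0_implies_Suc pderiv_1 pderiv_mult pderiv_of_nat add.right_neutral mult_zero_left)
    then show ?thesis
      using 0 by simp
  next
    case (Suc r)
    define X :: "real poly" where "X = [:0, 1:]"
    have X: "pderiv X = 1"
      by (simp add: X_def pderiv_pCons)
    have 1: "of_nat r * pderiv (?G (r - 1) q) =
       of_nat r * (of_nat (r - 1) * of_nat q * ?G (r - 1 - 1) (q - 1))"
      using less[of "r - 1" q] Suc by (cases r) auto
    have 2: "of_nat r * ?G r (q - 1) = of_nat r * (of_nat (r - 1) * ?G (r - 1 - 1) (q - 1) +
       of_nat (q - 1) * (X * ?G (r - 1) (q - 1 - 1)))"
      unfolding X_def by (cases r) auto
    have "pderiv (?G p q) = of_nat r * pderiv (?G (r - 1) q) +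
       of_nat q * (?G r (q - 1) + X * pderiv (?G r (q - 1)))"
      unfolding Suc Gauss_moment.simps X_def[symmetric] by (simp add: pderiv_add pderiv_mult pderiv_of_nat X algebra_simps)
    also have "\<dots> = of_nat q * (of_nat r * (of_nat (r - 1) * ?G (r - 1 - 1) (q - 1) +
       of_nat (q - 1) * (X * ?G (r - 1) (q - 1 - 1)))) + of_nat q * ?G r (q - 1)"
      unfolding 1 using less[of r "q - 1"] Suc by (simp add: algebra_simps)
    also have "\<dots> = of_nat p * of_nat q * ?G r (q - 1)"
      unfolding 2[symmetric] Suc by (simp add: algebra_simps)
    finally show ?thesis
      by (simp add: Suc)
  qed
qed

text \<open>As a function of \<eta> the moment extends to a homogeneous polynomial of degree q, so
  the spherical Laplacian is the Euclidean one minus q (q + N - 2). The latter turns (\<eta>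
  \<bullet> \<xi>)^q into q (q - 1) |\<xi>|^2 (\<eta> \<bullet> \<xi>)^(q - 2), and |\<xi>|^2
  contributes the factor N + p + q - 2 to the Gaussian mean.\<close>

lemma Gauss_moment_Laplace:
  fixes N :: real
  shows "[:1, 0, -1:] * pderiv (pderiv (Gauss_moment p q)) - [:0, N - 1:] * pderiv (Gauss_moment p q) =
    smult (real q * real (q - 1) * (N + real (p + q) - 2)) (Gauss_moment p (q - 2)) -
    smult (real q * (real q + N - 2)) (Gauss_moment p q)"
proof -
  define X :: "real poly" where "X = [:0, 1:]"
  have c: "[:1, 0, -1:] = 1 - X * X" "[:0, N - 1:] = ([:N:] - 1) * X"
    by (simp_all add: X_def one_pCons)
  have X: "pderiv X = 1"
    by (simp add: X_def pderiv_pCons)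
  have s: "smult k P = [:k:] * P" for k and P :: "real poly"
    by simp
  have n: "[:real k:] = of_nat k" for k
    by (simp add: of_nat_poly)
  consider "q = 0" | "q = 1" | r where "q = Suc (Suc r)" "p = 0" | r l where "q = Suc (Suc r)" "p = Suc l"
    by (metis One_nat_def not0_implies_Suc)
  then show ?thesis
  proof cases
    case 1
    then show ?thesis
      by (simp add: pderiv_Gauss_moment)
  next
    case 2
    have "Gauss_moment p (Suc 0) = of_nat p * (X * Gauss_moment (p - 1) 0)"
      using Gauss_moment_Suc_right[of p 0] by (simp add: X_def)
    then show ?thesis
      unfolding c s 2 by (simp add: pderiv_Gauss_moment pderiv_mult pderiv_of_nat algebra_simps one_pCons X)
  next
    case 3
    have "Gauss_moment 0 (Suc (Suc r)) = of_nat (Suc r) * Gauss_moment 0 r"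
      by simp
    moreover have "pderiv (Gauss_moment 0 k) = 0" for k
      by (simp add: pderiv_Gauss_moment)
    ultimately show ?thesis
      unfolding 3 s by (simp add: n[symmetric] pderiv_smult algebra_simps)
  next
    case 4
    define A where "A = Gauss_moment p q"
    define W where "W = Gauss_moment l (Suc r)"
    define Y where "Y = Gauss_moment p r"
    define Z where "Z = Gauss_moment (l - 1) r"
    define V where "V = Gauss_moment l (r - 1)"
    have A: "A = of_nat (Suc r) * Y + of_nat p * (X * W)"
      using Gauss_moment_Suc_right[of p "Suc r"] 4 by (simp add: A_def Y_def W_def X_def)
    have Y: "Y = of_nat l * Z + of_nat r * (X * V)"
      using 4 by (simp add: Y_def Z_def V_def X_def)
    have W: "W = of_nat r * V + of_nat l * (X * Z)"
      using Gauss_moment_Suc_right[of l r] by (simp add: W_def V_def Z_def X_def)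
    have d1: "pderiv A = of_nat p * of_nat q * W"
      using pderiv_Gauss_moment[of p q] 4 by (simp add: A_def W_def del: Gauss_moment.simps)
    have d2: "pderiv (of_nat p * of_nat q * W) = of_nat p * of_nat q * (of_nat l * of_nat (Suc r) * Z)"
      by (simp add: W_def Z_def pderiv_Gauss_moment pderiv_mult pderiv_of_nat)
    have k1: "[:real q * real (q - 1) * (N + real (p + q) - 2):] = of_nat q * of_nat (Suc r) * ([:N:] + of_nat p + of_nat r)"
      by (simp add: 4 n[symmetric] one_pCons algebra_simps)
    have k2: "[:real q * (real q + N - 2):] = of_nat q * ([:N:] + of_nat r)"
      by (simp add: 4 n[symmetric] one_pCons algebra_simps)
    \<comment> \<open>After substitution only the moments \<open>Z\<close> and \<open>V\<close> are
      left, and the claim is an identity in a commutative ring.\<close>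
    have "(1 - X * X) * (of_nat p * of_nat q * (of_nat l * of_nat (Suc r) * Z)) - ([:N:] - 1) * X * (of_nat p * of_nat q * W) =
      of_nat q * of_nat (Suc r) * ([:N:] + of_nat p + of_nat r) * Y - of_nat q * ([:N:] + of_nat r) * A"
      unfolding A Y W of_nat_Suc by (simp only: algebra_simps)
    moreover have "q - 2 = r"
      using 4 by simp
    ultimately show ?thesis
      unfolding c s A_def[symmetric] d1 d2 k1 k2 by (simp only: Y_def)
  qed
qed

lemma Gauss_moment_odd: "odd (p + q) \<Longrightarrow> Gauss_moment p q = 0"
proof (induction p q rule: Gauss_moment.induct)
  case (2 q)
  then show ?case by (cases q) auto
next
  case (3 p q)
  then show ?case by (cases p; cases q) auto
qed simp

lemma coeff_Gauss_moment_eq_0: "p < k \<or> odd (p + k) \<Longrightarrow> coeff (Gauss_moment p q) k = 0"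
proof (induction p q arbitrary: k rule: Gauss_moment.induct)
  case 1
  then show ?case by (cases k) auto
next
  case (2 q)
  then show ?case
    by (simp add: of_nat_poly)
next
  case (3 p q)
  have "coeff (of_nat p * Gauss_moment (p - 1) q) k = 0"
    using "3.IH"(1)[of k] "3.prems" by (cases p) (auto simp: of_nat_poly)
  moreover have "coeff ([:0, 1:] * Gauss_moment p (q - 1)) k = 0"
    using "3.IH"(2)[of "k - 1"] "3.prems" by (cases k) auto
  ultimately show ?case
    by (cases k) (auto simp: of_nat_poly)
qed

lemma coeff_Gauss_moment_lead: "coeff (Gauss_moment p p) p = fact p"
proof (induction p)
  case (Suc p)
  have "coeff (of_nat p * Gauss_moment (p - 1) (Suc p)) (Suc p) = 0"
    by (cases p) (simp_all add: of_nat_poly coeff_Gauss_moment_eq_0)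
  then show ?case
    using Suc by (simp add: of_nat_poly del: Gauss_moment.simps(2))
qed simp

section \<open>The pairing of two Gegenbauer polynomials\<close>

text \<open>\<open>w d\<close> will be the factor that converts the Gaussian mean of a homogeneous
  function of degree d into its mean over the sphere.\<close>

definition sphere_moment :: "(nat \<Rightarrow> real) \<Rightarrow> nat \<Rightarrow> nat \<Rightarrow> real poly" where
  "sphere_moment w p q = smult (w (p + q)) (Gauss_moment p q)"

text \<open>The spherical mean of the product of two Gegenbauer polynomials in \<omega> \<bullet>
  \<xi> and \<eta> \<bullet> \<xi>, as a polynomial in \<omega> \<bullet> \<eta>.\<close>

definition Gegenbauer_pairing :: "(nat \<Rightarrow> real) \<Rightarrow> real \<Rightarrow> nat \<Rightarrow> nat \<Rightarrow> real poly" where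
  "Gegenbauer_pairing w \<nu> m n =
     (\<Sum>i\<le>m. \<Sum>j\<le>n. smult (Gegenbauer_coeff \<nu> m i * Gegenbauer_coeff \<nu> n j) (sphere_moment w i j))"

lemma pderiv_sum: "pderiv (\<Sum>i\<in>A. F i) = (\<Sum>i\<in>A. pderiv (F i))"
  by (induction A rule: infinite_finite_induct) (auto simp: pderiv_add)

lemma smult_sum_right: "smult c (\<Sum>i\<in>A. F i) = (\<Sum>i\<in>A. smult c (F i))"
  by (induction A rule: infinite_finite_induct) (auto simp: smult_add_right)

lemma Gegenbauer_op_sum: "Gegenbauer_op \<nu> (\<Sum>i\<in>A. F i) = (\<Sum>i\<in>A. Gegenbauer_op \<nu> (F i))"
  by (simp only: Gegenbauer_op_def pderiv_sum sum_distrib_left sum_subtractf)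

lemma Gegenbauer_op_smult: "Gegenbauer_op \<nu> (smult c F) = smult c (Gegenbauer_op \<nu> F)"
  by (simp only: Gegenbauer_op_def pderiv_smult mult_smult_right smult_diff_right)

text \<open>With N = 2 \<nu> + 2 the recursion of w absorbs the factor N + p + q - 2 of the Gaussian
  case, as it should, since |\<xi>|^2 = 1 on the sphere.\<close>

lemma Gegenbauer_op_sphere_moment:
  assumes "\<And>d. w d = (2 * \<nu> + 2 + real d) * w (d + 2)"
  shows "Gegenbauer_op \<nu> (sphere_moment w p q) =
    smult (real q * real (q - 1)) (sphere_moment w p (q - 2)) - smult (real q * (real q + 2 * \<nu>)) (sphere_moment w p q)"
proof -
  have w: "real q * real (q - 1) * w (p + (q - 2)) = w (p + q) * (real q * real (q - 1) * (2 * \<nu> + real (p + q)))"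
  proof (cases "q \<ge> 2")
    case True
    have "p + (q - 2) + 2 = p + q" "real (p + (q - 2)) = real (p + q) - 2"
      using True by auto
    then show ?thesis
      using assms[of "p + (q - 2)"] by (simp add: algebra_simps)
  next
    case False
    then have "q = 0 \<or> q = 1" by auto
    then show ?thesis by auto
  qed
  have eq: "Gegenbauer_op \<nu> (Gauss_moment p q) =
     smult (real q * real (q - 1) * (2 * \<nu> + real (p + q))) (Gauss_moment p (q - 2)) -
     smult (real q * (real q + 2 * \<nu>)) (Gauss_moment p q)"
    using Gauss_moment_Laplace[of p q "2 * \<nu> + 2"] unfolding Gegenbauer_op_def by (simp add: algebra_simps)
  show ?thesis
    unfolding sphere_moment_def Gegenbauer_op_smult eq smult_diff_right smult_smult w
    by (simp only: mult.commute)
qed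

text \<open>Shifting the first part by two indices collects the coefficients of \<open>S j\<close>,
  and \<open>Gegenbauer_coeff_rec\<close> evaluates them; the factor j (j - 1) kills the two terms
  lost in the shift.\<close>

lemma Gegenbauer_coeff_summation_by_parts:
  fixes S :: "nat \<Rightarrow> real poly"
  shows "(\<Sum>j\<le>n. smult (Gegenbauer_coeff \<nu> n j) (smult (real j * real (j - 1)) (S (j - 2)) - smult (real j * (real j + 2 * \<nu>)) (S j))) =
    smult (- (real n * (real n + 2 * \<nu>))) (\<Sum>j\<le>n. smult (Gegenbauer_coeff \<nu> n j) (S j))"
proof -
  define f where "f j = smult (Gegenbauer_coeff \<nu> n j * (real j * real (j - 1))) (S (j - 2))" for j
  have "(\<Sum>j\<le>n. f j) = (\<Sum>j<Suc (Suc (Suc n)). f j)"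
    by (intro sum.mono_neutral_left) (auto simp: f_def Gegenbauer_coeff_eq_0)
  also have "\<dots> = (\<Sum>j<Suc n. f (Suc (Suc j)))"
    unfolding sum.lessThan_Suc_shift[of _ "Suc (Suc n)"] sum.lessThan_Suc_shift[of _ "Suc n"]
    by (simp add: f_def)
  also have "\<dots> = (\<Sum>j\<le>n. smult (real (j + 2) * real (j + 1) * Gegenbauer_coeff \<nu> n (j + 2)) (S j))"
    unfolding lessThan_Suc_atMost by (intro sum.cong) (simp_all add: f_def mult_ac)
  finally have f: "(\<Sum>j\<le>n. f j) =
    (\<Sum>j\<le>n. smult ((real j * (real j + 2 * \<nu>) - real n * (real n + 2 * \<nu>)) * Gegenbauer_coeff \<nu> n j) (S j))"
    unfolding Gegenbauer_coeff_rec .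
  have "(\<Sum>j\<le>n. smult (Gegenbauer_coeff \<nu> n j) (smult (real j * real (j - 1)) (S (j - 2)) - smult (real j * (real j + 2 * \<nu>)) (S j))) =
    (\<Sum>j\<le>n. f j) - (\<Sum>j\<le>n. smult (real j * (real j + 2 * \<nu>) * Gegenbauer_coeff \<nu> n j) (S j))"
    by (simp add: f_def smult_diff_right sum_subtractf mult_ac)
  also have "\<dots> = (\<Sum>j\<le>n. smult (- (real n * (real n + 2 * \<nu>))) (smult (Gegenbauer_coeff \<nu> n j) (S j)))"
    unfolding f sum_subtractf[symmetric] smult_diff_left[symmetric]
    by (intro sum.cong refl) (simp add: algebra_simps)
  also have "\<dots> = smult (- (real n * (real n + 2 * \<nu>))) (\<Sum>j\<le>n. smult (Gegenbauer_coeff \<nu> n j) (S j))"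
    by (rule smult_sum_right[symmetric])
  finally show ?thesis .
qed

lemma Gegenbauer_pairing_commute: "Gegenbauer_pairing w \<nu> m n = Gegenbauer_pairing w \<nu> n m"
  unfolding Gegenbauer_pairing_def sphere_moment_def
  by (subst sum.swap) (simp add: add.commute mult.commute Gauss_moment_commute)

lemma Gegenbauer_op_pairing:
  assumes "\<And>d. w d = (2 * \<nu> + 2 + real d) * w (d + 2)"
  shows "Gegenbauer_op \<nu> (Gegenbauer_pairing w \<nu> m n) =
    smult (- (real n * (real n + 2 * \<nu>))) (Gegenbauer_pairing w \<nu> m n)"
proof -
  have *: "Gegenbauer_pairing w \<nu> m n = (\<Sum>i\<le>m. smult (Gegenbauer_coeff \<nu> m i)
      (\<Sum>j\<le>n. smult (Gegenbauer_coeff \<nu> n j) (sphere_moment w i j)))"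
    unfolding Gegenbauer_pairing_def smult_sum_right smult_smult ..
  have "Gegenbauer_op \<nu> (Gegenbauer_pairing w \<nu> m n) = (\<Sum>i\<le>m. smult (Gegenbauer_coeff \<nu> m i)
     (\<Sum>j\<le>n. smult (Gegenbauer_coeff \<nu> n j) (smult (real j * real (j - 1)) (sphere_moment w i (j - 2)) -
       smult (real j * (real j + 2 * \<nu>)) (sphere_moment w i j))))"
    unfolding * Gegenbauer_op_sum Gegenbauer_op_smult Gegenbauer_op_sphere_moment[OF assms] ..
  also have "\<dots> = smult (- (real n * (real n + 2 * \<nu>))) (Gegenbauer_pairing w \<nu> m n)"
    unfolding Gegenbauer_coeff_summation_by_parts * smult_sum_right[of _ _ "{..m}"]
    by (intro sum.cong refl) (simp add: mult.commute)
  finally show ?thesis .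
qed

text \<open>At the degree d of a nonzero F the equation gives (m - d)(m + d + 2 \<nu>) = 0. By d < m
  and equal parity m + d >= 2, so for \<nu> >= -1/2 both factors are positive.\<close>

lemma Gegenbauer_op_unique:
  assumes "\<nu> \<ge> - 1 / 2" "Gegenbauer_op \<nu> F = smult (- (real m * (real m + 2 * \<nu>))) F"
    and "\<And>k. k \<ge> m \<or> odd (m + k) \<Longrightarrow> coeff F k = 0"
  shows "F = 0"
proof (rule ccontr)
  assume "F \<noteq> 0"
  define d where "d = degree F"
  have lead: "coeff F d \<noteq> 0"
    using \<open>F \<noteq> 0\<close> by (simp add: d_def)
  then have "\<not> (d \<ge> m \<or> odd (m + d))"
    using assms(3) by blast
  then have d: "d < m" "even (m + d)"
    by (auto simp: not_le)
  have "coeff F (d + 2) = 0"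
    by (intro coeff_eq_0) (simp add: d_def)
  then have "(real m * (real m + 2 * \<nu>) - real d * (real d + 2 * \<nu>)) * coeff F d = 0"
    using arg_cong[OF assms(2), of "\<lambda>P. coeff P d"] unfolding coeff_Gegenbauer_op by (simp add: algebra_simps)
  then have "real m * (real m + 2 * \<nu>) - real d * (real d + 2 * \<nu>) = 0"
    using lead by simp
  then have "(real m - real d) * (real m + real d + 2 * \<nu>) = 0"
    by (simp add: algebra_simps)
  moreover have "m + d \<ge> 2"
    using d by (cases "m + d = 1") auto
  then have "real m + real d + 2 * \<nu> > 0"
    using assms(1) by linarith
  ultimately show False
    using d by simp
qed

text \<open>By symmetry the pairing is an eigenvector of \<open>Gegenbauer_op \<nu>\<close> for the eigenvalues of \<open>m\<close> and of \<open>n\<close>.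
  The parity of the polynomials takes care of \<open>\<nu> = - 1 / 2\<close>, where \<open>m = 0\<close> and \<open>m = 1\<close> have the same
  eigenvalue.\<close>

theorem Gegenbauer_pairing_eq:
  assumes \<nu>: "\<nu> \<ge> - 1 / 2" and w: "\<And>d. w d = (2 * \<nu> + 2 + real d) * w (d + 2)" and w0: "w 0 = 1"
  shows "Gegenbauer_pairing w \<nu> m n = (if m = n then Gegenbauer_poly \<nu> m else 0)"
proof -
  let ?P = "Gegenbauer_pairing w \<nu>"
  have odd_0: "Gegenbauer_coeff \<nu> m i * Gegenbauer_coeff \<nu> n j * coeff (sphere_moment w i j) k = 0"
    if "odd (m + n) \<or> odd (m + k)" for i j k m n
  proof (rule ccontr)
    assume "\<not> ?thesis"
    then have "even (m + i)" "even (n + j)" "coeff (Gauss_moment i j) k \<noteq> 0"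
      using Gegenbauer_coeff_odd by (auto simp: sphere_moment_def)
    moreover from this(3) have "even (i + j)" "even (i + k)"
      using Gauss_moment_odd coeff_Gauss_moment_eq_0 by force+
    ultimately show False
      using that by presburger
  qed
  show ?thesis
  proof (cases "m = n")
    case False
    show ?thesis
    proof (cases "odd (m + n)")
      case True
      have "?P m n = 0"
        by (rule poly_eqI) (simp add: Gegenbauer_pairing_def coeff_sum odd_0[OF disjI1[OF True]])
      then show ?thesis
        using False by simp
    next
      case even: False
      have "m + n \<ge> 2"
        using even False by (cases "m + n = 0") presburger+
      then have "real m + real n + 2 * \<nu> > 0"
        using \<nu> by linarith
      then have "(real m - real n) * (real m + real n + 2 * \<nu>) \<noteq> 0"
        using False by simp
      then have ne: "- (real m * (real m + 2 * \<nu>)) \<noteq> - (real n * (real n + 2 * \<nu>))"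
        by (simp add: algebra_simps)
      have "smult (- (real m * (real m + 2 * \<nu>))) (?P m n) =
          smult (- (real n * (real n + 2 * \<nu>))) (?P m n)"
        using Gegenbauer_op_pairing[OF w, of m n] Gegenbauer_op_pairing[OF w, of n m]
        by (metis Gegenbauer_pairing_commute)
      then have "smult (- (real m * (real m + 2 * \<nu>)) - - (real n * (real n + 2 * \<nu>))) (?P m n) = 0"
        unfolding smult_diff_left by simp
      then show ?thesis
        using ne False by (simp only: smult_eq_0_iff) auto
    qed
  next
    case True
    define F where "F = ?P m m - Gegenbauer_poly \<nu> m"
    let ?a = "Gegenbauer_coeff \<nu> m m"
    \<comment> \<open>The differential equation alone would leave a scalar factor open. This value
      of w gives \<open>?a * fact m * w (m + m) = 1\<close>, so that the leading coefficient of the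
      pairing, quadratic in \<open>?a\<close>, reduces to \<open>?a\<close>.\<close>
    have "w (2 * k) * (2 ^ k * pochhammer (\<nu> + 1) k) = 1" for k
    proof (induction k)
      case (Suc k)
      have "w (2 * Suc k) * (2 ^ Suc k * pochhammer (\<nu> + 1) (Suc k)) =
          ((2 * \<nu> + 2 + real (2 * k)) * w (2 * k + 2)) * (2 ^ k * pochhammer (\<nu> + 1) k)"
        by (simp add: pochhammer_Suc algebra_simps)
      then show ?case
        using Suc unfolding w[symmetric] by simp
    qed (simp add: w0)
    then have wm: "w (m + m) * (2 ^ m * pochhammer (\<nu> + 1) m) = 1"
      by (simp add: mult_2)
    have lead: "coeff (?P m m) m = ?a"
    proof -
      have "coeff (?P m m) m =
        (\<Sum>i\<le>m. \<Sum>j\<le>m. if j = m then if i = m then ?a * ?a * (w (m + m) * fact m) else 0 else 0)"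
        unfolding Gegenbauer_pairing_def coeff_sum
      proof (intro sum.cong refl)
        fix i j assume ij: "i \<in> {..m}" "j \<in> {..m}"
        have "coeff (Gauss_moment i j) m = (if i = m \<and> j = m then fact m else 0)"
          using ij coeff_Gauss_moment_eq_0[of i m j] coeff_Gauss_moment_eq_0[of j m i]
            Gauss_moment_commute[of i j] coeff_Gauss_moment_lead[of m]
          by (cases "i = m"; cases "j = m") auto
        then show "coeff (smult (Gegenbauer_coeff \<nu> m i * Gegenbauer_coeff \<nu> m j) (sphere_moment w i j)) m =
           (if j = m then if i = m then ?a * ?a * (w (m + m) * fact m) else 0 else 0)"
          by (auto simp: sphere_moment_def)
      qed
      also have "\<dots> = ?a * (?a * fact m * w (m + m))"
        by simp
      also have "?a * fact m * w (m + m) = 1"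
        using wm by (simp add: Gegenbauer_coeff_lead mult_ac)
      finally show ?thesis by simp
    qed
    have "F = 0"
    proof (rule Gegenbauer_op_unique[OF \<nu>])
      have "Gegenbauer_op \<nu> F = Gegenbauer_op \<nu> (?P m m) - Gegenbauer_op \<nu> (Gegenbauer_poly \<nu> m)"
        unfolding F_def Gegenbauer_op_def pderiv_diff right_diff_distrib by (simp add: algebra_simps)
      also have "Gegenbauer_op \<nu> (Gegenbauer_poly \<nu> m) = smult (- (real m * (real m + 2 * \<nu>))) (Gegenbauer_poly \<nu> m)"
        by (rule Gegenbauer_poly_ODE)
      finally show "Gegenbauer_op \<nu> F = smult (- (real m * (real m + 2 * \<nu>))) F"
        unfolding F_def smult_diff_right Gegenbauer_op_pairing[OF w] by simp
      fix k assume k: "k \<ge> m \<or> odd (m + k)"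
      consider "k = m" | "k > m" | "odd (m + k)"
        using k by linarith
      then show "coeff F k = 0"
      proof cases
        case 1
        then show ?thesis
          by (simp add: F_def lead coeff_Gegenbauer_poly)
      next
        case 2
        then have "coeff (?P m m) k = 0"
          unfolding Gegenbauer_pairing_def coeff_sum
          by (intro sum.neutral ballI) (simp add: sphere_moment_def coeff_Gauss_moment_eq_0)
        then show ?thesis
          using 2 by (simp add: F_def coeff_Gegenbauer_poly Gegenbauer_coeff_eq_0)
      next
        case 3
        then have "coeff (?P m m) k = 0"
          by (simp add: Gegenbauer_pairing_def coeff_sum odd_0[OF disjI2[OF 3]])
        then show ?thesis
          using 3 by (simp add: F_def coeff_Gegenbauer_poly Gegenbauer_coeff_odd)
      qed
    qed
    then show ?thesis
      using True by (simp add: F_def)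
  qed
qed

section \<open>From Gaussian integrals to the sphere\<close>

lemma abs_inner_sgn_le: "\<bar>\<omega> \<bullet> sgn \<xi>\<bar> \<le> norm (\<omega> :: 'a::euclidean_space)"
proof -
  have "\<bar>\<omega> \<bullet> sgn \<xi>\<bar> \<le> norm \<omega> * norm (sgn \<xi>)"
    by (rule Cauchy_Schwarz_ineq2)
  also have "\<dots> \<le> norm \<omega> * 1"
    by (intro mult_left_mono) (auto simp: norm_sgn)
  finally show ?thesis by simp
qed

lemma borel_measurable_inner_sgn [measurable]:
  "(\<lambda>\<xi>. \<omega> \<bullet> sgn \<xi>) \<in> borel_measurable (borel :: 'a::euclidean_space measure)"
  unfolding sgn_div_norm by measurable

lemma homogeneous_zero_monomial:
  "homogeneous_zero (\<lambda>\<xi>::'a::euclidean_space. (\<omega> \<bullet> sgn \<xi>) ^ p * (\<eta> \<bullet> sgn \<xi>) ^ q)"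
  unfolding homogeneous_zero_def
proof (intro conjI exI allI impI)
  show "\<bar>(\<omega> \<bullet> sgn \<xi>) ^ p * (\<eta> \<bullet> sgn \<xi>) ^ q\<bar> \<le> norm \<omega> ^ p * norm \<eta> ^ q" for \<xi>
    unfolding abs_mult power_abs by (intro mult_mono power_mono abs_inner_sgn_le) auto
qed (measurable, simp add: sgn_scaleR)

lemma angular_integral_sum:
  assumes "\<And>i. i \<in> I \<Longrightarrow> homogeneous_zero (G i)"
  shows "angular_integral (\<lambda>\<xi>. \<Sum>i\<in>I. c i * G i \<xi>) = (\<Sum>i\<in>I. c i * angular_integral (G i))"
proof -
  have "angular_integral (\<lambda>\<xi>. \<Sum>i\<in>I. c i * G i \<xi>) = (\<integral>\<xi>. (\<Sum>i\<in>I. c i * (indicator (cball 0 1) \<xi> * G i \<xi>)) \<partial>lborel)"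
    unfolding angular_integral_def by (simp add: sum_distrib_left mult_ac)
  also have "\<dots> = (\<Sum>i\<in>I. \<integral>\<xi>. c i * (indicator (cball 0 1) \<xi> * G i \<xi>) \<partial>lborel)"
    using assms by (intro Bochner_Integration.integral_sum integrable_mult_right integrable_indicator_ball)
  finally show ?thesis
    by (simp add: angular_integral_def)
qed

definition Gauss_integral :: "'a::euclidean_space \<Rightarrow> 'a \<Rightarrow> nat \<Rightarrow> nat \<Rightarrow> real" where
  "Gauss_integral \<omega> \<eta> p q = (\<integral>\<xi>. (\<omega> \<bullet> \<xi>) ^ p * (\<eta> \<bullet> \<xi>) ^ q * exp (- (\<xi> \<bullet> \<xi>) / 2) \<partial>lborel)"

lemma
  fixes \<omega> \<eta> :: "'a::euclidean_space"
  shows integrable_Gaussian_monomial: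
      "integrable lborel (\<lambda>\<xi>. (\<omega> \<bullet> \<xi>) ^ p * (\<eta> \<bullet> \<xi>) ^ q * exp (- (\<xi> \<bullet> \<xi>) / 2))" (is ?A)
    and Gauss_integral_polar: "Gauss_integral \<omega> \<eta> p q =
      angular_integral (\<lambda>\<xi>. (\<omega> \<bullet> sgn \<xi>) ^ p * (\<eta> \<bullet> sgn \<xi>) ^ q) * (real DIM('a) / 2) *
      (Gamma (real (p + q + DIM('a)) / 2) * 2 powr (real (p + q + DIM('a)) / 2))" (is ?B)
proof -
  define R where "R z = z powr (real (p + q) / 2) * exp (- (1 / 2 * z))" for z :: real
  define G where "G \<xi> = (\<omega> \<bullet> sgn \<xi>) ^ p * (\<eta> \<bullet> sgn \<xi>) ^ q" for \<xi> :: 'a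
  define s where "s = real (p + q + DIM('a)) / 2 - 1"
  have "real (p + q + DIM('a)) > 0"
    by (simp only: of_nat_0_less_iff) simp
  then have s: "s > -1"
    by (simp add: s_def)
  have eq: "indicator {0<..} z * (R z * z powr (real DIM('a) / 2 - 1)) =
      indicator {0<..} z * (z powr s * exp (- (1 / 2 * z)))" for z :: real
    by (auto simp: R_def s_def indicator_def add_divide_distrib add_diff_eq simp flip: powr_add)
  have [measurable]: "R \<in> borel_measurable borel"
    unfolding R_def[abs_def] by measurable
  have hG: "homogeneous_zero G"
    unfolding G_def[abs_def] by (rule homogeneous_zero_monomial)
  have [measurable]: "G \<in> borel_measurable borel"
    using hG by (simp add: homogeneous_zero_def)
  note P = polar_integral[where a = 2 and R = R, OF hG, unfolded eq, OF _ _ Gamma_real_integrable[OF s]]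
  \<comment> \<open>Equality can fail at \<xi> = 0: for p + q = 0 the left side contains
    \<open>0 powr 0\<close>, which is 0, whereas the right side is 1.\<close>
  have AE_eq: "AE \<xi> in lborel. R (norm \<xi> powr 2) * G \<xi> = (\<omega> \<bullet> \<xi>) ^ p * (\<eta> \<bullet> \<xi>) ^ q * exp (- (\<xi> \<bullet> \<xi>) / 2)"
  proof -
    have "AE \<xi> in lborel. \<xi> \<noteq> (0 :: 'a)"
      by (rule AE_lborel_singleton)
    then show ?thesis
    proof eventually_elim
      case (elim \<xi>)
      then have n: "norm \<xi> > 0" by simp
      have "(norm \<xi> powr 2) powr (real (p + q) / 2) = norm \<xi> ^ (p + q)"
        using n by (simp only: powr_powr) (simp add: powr_realpow flip: of_nat_add)
      moreover have "norm \<xi> powr 2 = \<xi> \<bullet> \<xi>"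
        using n by (simp add: power2_norm_eq_inner)
      moreover have "\<omega> \<bullet> \<xi> = norm \<xi> * (\<omega> \<bullet> sgn \<xi>)" "\<eta> \<bullet> \<xi> = norm \<xi> * (\<eta> \<bullet> sgn \<xi>)"
        using n by (simp_all add: sgn_div_norm)
      ultimately show ?case
        unfolding R_def G_def by (simp only: power_mult_distrib power_add) simp
    qed
  qed
  show ?A
    by (rule integrable_cong_AE_imp[OF P(1) _ AE_eq]) auto
  have "Gauss_integral \<omega> \<eta> p q = (\<integral>\<xi>. R (norm \<xi> powr 2) * G \<xi> \<partial>lborel)"
    unfolding Gauss_integral_def
    by (intro integral_cong_AE) (use AE_eq in \<open>auto elim: eventually_mono\<close>)
  also have "\<dots> = angular_integral G * (real DIM('a) / 2) * (Gamma (s + 1) / (1 / 2) powr (s + 1))"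
    using P(2) by (simp only: Gamma_real_integral_eq[OF s, of "1 / 2"]) simp
  also have "Gamma (s + 1) / (1 / 2) powr (s + 1) =
      Gamma (real (p + q + DIM('a)) / 2) * 2 powr (real (p + q + DIM('a)) / 2)"
    by (simp add: s_def powr_divide)
  finally show ?B
    unfolding G_def[abs_def] .
qed

text \<open>The derivative of the integrand in direction \<omega> integrates to 0, and
  differentiating the exponential supplies the additional factor \<omega> \<bullet> \<xi>.\<close>

lemma Gauss_integral_Suc:
  fixes \<omega> \<eta> :: "'a::euclidean_space"
  assumes "norm \<omega> = 1"
  shows "Gauss_integral \<omega> \<eta> (Suc p) q =
    real p * Gauss_integral \<omega> \<eta> (p - 1) q + real q * (\<omega> \<bullet> \<eta>) * Gauss_integral \<omega> \<eta> p (q - 1)"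
proof -
  define e where "e p q \<xi> = (\<omega> \<bullet> \<xi>) ^ p * (\<eta> \<bullet> \<xi>) ^ q * exp (- (\<xi> \<bullet> \<xi>) / 2)" for p q and \<xi> :: 'a
  have e: "integrable lborel (e p q)" for p q
    unfolding e_def by (rule integrable_Gaussian_monomial)
  define h' where "h' \<xi> = real p * e (p - 1) q \<xi> + real q * (\<omega> \<bullet> \<eta>) * e p (q - 1) \<xi> - e (Suc p) q \<xi>" for \<xi>
  have \<omega>: "\<omega> \<bullet> \<omega> = 1"
    using assms by (simp add: norm_eq_1)
  have "(\<integral>\<xi>. h' \<xi> \<partial>lborel) = 0"
  proof (rule integral_directional_derivative_eq_0[where h = "e p q" and w = \<omega>])
    show "((\<lambda>s. e p q (\<xi> + s *\<^sub>R \<omega>)) has_real_derivative h' (\<xi> + s *\<^sub>R \<omega>)) (at s)" for \<xi> s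
    proof -
      have 1: "((\<lambda>s. \<omega> \<bullet> (\<xi> + s *\<^sub>R \<omega>)) has_real_derivative 1) (at s)"
        unfolding inner_add_right inner_scaleR_right \<omega> by (auto intro!: derivative_eq_intros)
      have 2: "((\<lambda>s. \<eta> \<bullet> (\<xi> + s *\<^sub>R \<omega>)) has_real_derivative (\<omega> \<bullet> \<eta>)) (at s)"
        unfolding inner_add_right inner_scaleR_right by (auto intro!: derivative_eq_intros simp: inner_commute)
      have 3: "((\<lambda>s. - ((\<xi> + s *\<^sub>R \<omega>) \<bullet> (\<xi> + s *\<^sub>R \<omega>)) / 2) has_real_derivative - (\<omega> \<bullet> (\<xi> + s *\<^sub>R \<omega>))) (at s)"
        unfolding inner_add_right inner_add_left inner_scaleR_right inner_scaleR_left \<omega>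
        by (auto intro!: derivative_eq_intros simp: inner_commute)
      show ?thesis
        unfolding e_def h'_def
        by (rule derivative_eq_intros 1 2 3 refl)+ (simp add: algebra_simps)
    qed
    show "integrable lborel (e p q)" "integrable lborel h'"
      unfolding h'_def by (intro e Bochner_Integration.integrable_diff Bochner_Integration.integrable_add integrable_mult_right)+
    show "continuous_on UNIV h'"
      unfolding h'_def e_def by (intro continuous_intros) auto
  qed
  then have "real p * (\<integral>\<xi>. e (p - 1) q \<xi> \<partial>lborel) + real q * (\<omega> \<bullet> \<eta>) * (\<integral>\<xi>. e p (q - 1) \<xi> \<partial>lborel) -
      (\<integral>\<xi>. e (Suc p) q \<xi> \<partial>lborel) = 0"
    unfolding h'_def using e by simp
  then show ?thesis
    by (simp add: Gauss_integral_def e_def)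
qed

lemma Gauss_integral_commute: "Gauss_integral \<omega> \<eta> p q = Gauss_integral \<eta> \<omega> q p"
  by (simp add: Gauss_integral_def mult.commute)

lemma Gauss_integral_eq:
  fixes \<omega> \<eta> :: "'a::euclidean_space"
  assumes "norm \<omega> = 1" "norm \<eta> = 1"
  shows "Gauss_integral \<omega> \<eta> p q = Gauss_integral \<omega> \<eta> 0 0 * poly (Gauss_moment p q) (\<omega> \<bullet> \<eta>)"
proof (induction p q rule: Gauss_moment.induct)
  case (2 q)
  have "Gauss_integral \<omega> \<eta> 0 (Suc q) = real q * Gauss_integral \<omega> \<eta> 0 (q - 1)"
    using Gauss_integral_Suc[OF assms(2), of \<omega> q 0] by (simp add: Gauss_integral_commute[of \<eta>])
  then show ?case
    using 2 by simp
next
  case (3 p q)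
  then show ?case
    unfolding Gauss_integral_Suc[OF assms(1)] by (simp add: algebra_simps)
qed simp

text \<open>In polar coordinates the Gaussian integral of a monomial is its angular integral times a
  radial constant depending only on the degree d, essentially \<open>\<kappa> d\<close>. So w is a
  ratio of such constants, and its recursion is the functional equation of Gamma.\<close>

theorem angular_integral_Gegenbauer:
  fixes \<omega> \<eta> :: "'a::euclidean_space"
  assumes "norm \<omega> = 1" "norm \<eta> = 1"
  defines "\<nu> \<equiv> (real DIM('a) - 2) / 2"
  shows "angular_integral (\<lambda>\<xi>::'a. normalized_Gegenbauer \<nu> m (\<omega> \<bullet> sgn \<xi>) * normalized_Gegenbauer \<nu> n (\<eta> \<bullet> sgn \<xi>)) =
    (if m = n then angular_integral (\<lambda>_::'a. 1) * normalized_Gegenbauer \<nu> m (\<omega> \<bullet> \<eta>) else 0)"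
    (is "angular_integral ?G = _")
proof -
  define \<kappa> where "\<kappa> d = Gamma (real (d + DIM('a)) / 2) * 2 powr (real (d + DIM('a)) / 2)" for d :: nat
  define w where "w d = \<kappa> 0 / \<kappa> d" for d
  have \<nu>: "\<nu> \<ge> - 1 / 2"
    using DIM_positive[where 'a = 'a] by (simp add: \<nu>_def)
  have \<kappa>_pos: "\<kappa> d > 0" for d
    unfolding \<kappa>_def by (intro mult_pos_pos Gamma_real_pos) (simp_all add: add_nonneg_pos)
  have \<kappa>: "\<kappa> (d + 2) = (2 * \<nu> + 2 + real d) * \<kappa> d" for d
  proof -
    define x where "x = real (d + DIM('a)) / 2"
    have x: "x > 0"
      by (simp add: x_def add_nonneg_pos)
    have "Gamma (x + 1) = x * Gamma x"
      using x by (intro Gamma_plus1) (auto elim!: nonpos_Ints_cases)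
    moreover have "\<kappa> (d + 2) = Gamma (x + 1) * 2 powr (x + 1)"
    proof -
      have "real (d + 2 + DIM('a)) / 2 = x + 1"
        by (simp add: x_def)
      then show ?thesis
        by (simp only: \<kappa>_def)
    qed
    moreover have "\<kappa> d = Gamma x * 2 powr x"
      by (simp only: \<kappa>_def x_def)
    ultimately have "\<kappa> (d + 2) = 2 * x * \<kappa> d"
      by (simp add: powr_add)
    moreover have "2 * \<nu> + 2 + real d = 2 * x"
      by (simp add: x_def \<nu>_def field_simps)
    ultimately show ?thesis
      by simp
  qed
  have w: "w d = (2 * \<nu> + 2 + real d) * w (d + 2)" for d
    using \<kappa>[of d] \<kappa>_pos[of d] \<kappa>_pos[of "d + 2"] by (auto simp: w_def field_simps)
  have w0: "w 0 = 1"
    using \<kappa>_pos[of 0] by (simp add: w_def)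
  have mono: "angular_integral (\<lambda>\<xi>::'a. (\<omega> \<bullet> sgn \<xi>) ^ p * (\<eta> \<bullet> sgn \<xi>) ^ q) =
    angular_integral (\<lambda>_::'a. 1) * poly (sphere_moment w p q) (\<omega> \<bullet> \<eta>)" for p q
  proof -
    have "angular_integral (\<lambda>\<xi>::'a. (\<omega> \<bullet> sgn \<xi>) ^ p * (\<eta> \<bullet> sgn \<xi>) ^ q) * (real DIM('a) / 2) * \<kappa> (p + q) =
      angular_integral (\<lambda>_::'a. 1) * (real DIM('a) / 2) * \<kappa> 0 * poly (Gauss_moment p q) (\<omega> \<bullet> \<eta>)"
      using Gauss_integral_polar[of \<omega> \<eta> p q] Gauss_integral_polar[of \<omega> \<eta> 0 0] Gauss_integral_eq[OF assms(1,2), of p q]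
      by (simp add: \<kappa>_def)
    then show ?thesis
      using \<kappa>_pos[of "p + q"] by (simp add: sphere_moment_def w_def field_simps)
  qed
  define c where "c = (\<lambda>(i, j). Gegenbauer_coeff \<nu> m i * Gegenbauer_coeff \<nu> n j)"
  define e where "e = (\<lambda>(i, j) \<xi>::'a. (\<omega> \<bullet> sgn \<xi>) ^ i * (\<eta> \<bullet> sgn \<xi>) ^ j)"
  have "?G = (\<lambda>\<xi>. \<Sum>ij\<in>{..m} \<times> {..n}. c ij * e ij \<xi>)"
    unfolding normalized_Gegenbauer_eq_poly poly_Gegenbauer_poly sum_product sum.cartesian_product
    by (intro ext sum.cong refl) (auto simp: c_def e_def mult_ac)
  moreover have "homogeneous_zero (e ij)" for ij
    unfolding e_def case_prod_unfold by (rule homogeneous_zero_monomial)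
  ultimately have "angular_integral ?G = (\<Sum>ij\<in>{..m} \<times> {..n}. c ij * angular_integral (e ij))"
    by (simp add: angular_integral_sum)
  also have "\<dots> = angular_integral (\<lambda>_::'a. 1) * poly (Gegenbauer_pairing w \<nu> m n) (\<omega> \<bullet> \<eta>)"
    unfolding Gegenbauer_pairing_def poly_sum sum.cartesian_product sum_distrib_left
    by (intro sum.cong refl) (auto simp: c_def e_def mono mult.left_commute)
  finally show ?thesis
    by (simp add: Gegenbauer_pairing_eq[OF \<nu> w w0] normalized_Gegenbauer_eq_poly)
qed

section \<open>Weber's integral\<close>

lemma gbinomial_Gamma_shift:
  fixes \<mu> :: real
  assumes "\<mu> > -1"
  shows "(\<mu> + real l + real r gchoose r) = Gamma (\<mu> + real l + real r + 1) * rGamma (\<mu> + real l + 1) / fact r"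
proof -
  have "\<mu> + real l + 1 \<notin> \<int>\<^sub>\<le>\<^sub>0"
    using assms by (auto elim!: nonpos_Ints_cases)
  then have "pochhammer (\<mu> + real l + 1) r = Gamma (\<mu> + real l + 1 + real r) / Gamma (\<mu> + real l + 1)"
    by (rule pochhammer_Gamma)
  then show ?thesis
    by (simp add: gbinomial_pochhammer' rGamma_inverse_Gamma field_simps)
qed

text \<open>Vandermonde's convolution for the binomial coefficient of i + (\<mu> + j) over j,
  rewritten with Gamma. The summand of index l already contains a Bessel coefficient of order
  \<mu>.\<close>

lemma Gamma_Vandermonde:
  fixes \<mu> :: real
  assumes "\<mu> > -1"
  shows "Gamma (\<mu> + real (i + j) + 1) * (rGamma (\<mu> + real i + 1) / fact i * (rGamma (\<mu> + real j + 1) / fact j)) =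
    (\<Sum>l | l \<le> i \<and> l \<le> j. rGamma (\<mu> + real l + 1) / fact l / (fact (i - l) * fact (j - l)))"
    (is "?G * (?r / _ * _) = sum ?s ?L")
proof -
  define g where "g = Gamma (\<mu> + real j + 1)"
  have g: "g > 0"
    unfolding g_def using assms by (intro Gamma_real_pos) auto
  have "?G * ?r / fact j = (real i + (\<mu> + real j) gchoose j)"
    using gbinomial_Gamma_shift[OF assms, of i j] by (simp add: algebra_simps)
  also have "\<dots> = (\<Sum>l=0..j. (real i gchoose l) * (\<mu> + real j gchoose (j - l)))"
    by (rule gbinomial_Vandermonde[symmetric])
  also have "\<dots> = (\<Sum>l\<in>?L. (real i gchoose l) * (\<mu> + real j gchoose (j - l)))"
    by (intro sum.mono_neutral_right) (auto simp: binomial_gbinomial[symmetric] binomial_eq_0)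
  also have "\<dots> = (\<Sum>l\<in>?L. fact i * g * ?s l)"
  proof (intro sum.cong refl)
    fix l assume l: "l \<in> ?L"
    have "(real i gchoose l) = fact i / (fact l * fact (i - l))"
      using l binomial_fact[of l i, where 'a = real] by (simp add: binomial_gbinomial)
    moreover have "(\<mu> + real j gchoose (j - l)) = g * rGamma (\<mu> + real l + 1) / fact (j - l)"
      using gbinomial_Gamma_shift[OF assms, of l "j - l"] l by (simp add: of_nat_diff g_def)
    ultimately show "(real i gchoose l) * (\<mu> + real j gchoose (j - l)) = fact i * g * ?s l"
      by simp
  qed
  also have "\<dots> = fact i * g * sum ?s ?L"
    by (rule sum_distrib_left[symmetric])
  finally have V: "?G * ?r / fact j = fact i * g * sum ?s ?L" .
  have "?G * (?r / fact i * (rGamma (\<mu> + real j + 1) / fact j)) = (?G * ?r / fact j) / (fact i * g)"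
  proof -
    have "rGamma (\<mu> + real j + 1) = 1 / g"
      by (simp add: g_def rGamma_inverse_Gamma inverse_eq_divide)
    then show ?thesis
      by simp
  qed
  then show ?thesis
    unfolding V using g by simp
qed

definition Bessel_product_coeff :: "real \<Rightarrow> real \<Rightarrow> real \<Rightarrow> nat \<Rightarrow> real" where
  "Bessel_product_coeff \<mu> x y k =
     (\<Sum>i\<le>k. (rGamma (\<mu> + real i + 1) / fact i * x ^ i) * (rGamma (\<mu> + real (k - i) + 1) / fact (k - i) * y ^ (k - i)))"

text \<open>\<open>Bessel_Clifford \<mu> (z * s\<^sup>2)\<close> as a power series in s itself,
  padded with zeros at odd indices, so that its Cauchy product with an exponential series can be
  formed.\<close>

definition even_Bessel_coeff :: "real \<Rightarrow> real \<Rightarrow> nat \<Rightarrow> real" where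
  "even_Bessel_coeff \<mu> z n = (if even n then rGamma (\<mu> + real (n div 2) + 1) / fact (n div 2) * z ^ (n div 2) else 0)"

text \<open>The Gamma factor is the integral of z^k against z^\<mu> e^(-z). After
  \<open>Gamma_Vandermonde\<close>, the pairs (i, l) are renumbered as (l, i - l), and the binomial
  theorem sums over the second index to a power of x + y.\<close>

lemma Gamma_mult_Bessel_product_coeff:
  assumes "\<mu> > -1"
  shows "Gamma (\<mu> + real k + 1) * Bessel_product_coeff \<mu> x y k =
    (\<Sum>n\<le>k. even_Bessel_coeff \<mu> (x * y) n * ((x + y) ^ (k - n) / fact (k - n)))"
proof -
  define t where "t i l = rGamma (\<mu> + real l + 1) / fact l / (fact (i - l) * fact (k - i - l)) * (x ^ i * y ^ (k - i))" for i l
  have "Gamma (\<mu> + real k + 1) * ((rGamma (\<mu> + real i + 1) / fact i * x ^ i) *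
      (rGamma (\<mu> + real (k - i) + 1) / fact (k - i) * y ^ (k - i))) = (\<Sum>l | l \<le> i \<and> l \<le> k - i. t i l)"
    if "i \<le> k" for i
    using arg_cong[OF Gamma_Vandermonde[OF assms, of i "k - i"], of "\<lambda>u. u * (x ^ i * y ^ (k - i))"] that
    by (simp add: t_def sum_distrib_left sum_distrib_right mult_ac)
  then have "Gamma (\<mu> + real k + 1) * Bessel_product_coeff \<mu> x y k = (\<Sum>i\<le>k. \<Sum>l | l \<le> i \<and> l \<le> k - i. t i l)"
    unfolding Bessel_product_coeff_def sum_distrib_left by (intro sum.cong) auto
  also have "\<dots> = (\<Sum>(i, l)\<in>(SIGMA i:{..k}. {l. l \<le> i \<and> l \<le> k - i}). t i l)"
    by (rule sum.Sigma) auto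
  also have "\<dots> = (\<Sum>(l, r)\<in>(SIGMA l:{l. 2 * l \<le> k}. {..k - 2 * l}). t (l + r) l)"
    by (rule sum.reindex_bij_witness[where i = "\<lambda>(l, r). (l + r, l)" and j = "\<lambda>(i, l). (l, i - l)"]) auto
  also have "\<dots> = (\<Sum>l | 2 * l \<le> k. \<Sum>r\<le>k - 2 * l. t (l + r) l)"
    by (rule sum.Sigma[symmetric]) (auto intro: finite_subset[of _ "{..k}"])
  also have "\<dots> = (\<Sum>l | 2 * l \<le> k. even_Bessel_coeff \<mu> (x * y) (2 * l) * ((x + y) ^ (k - 2 * l) / fact (k - 2 * l)))"
  proof (intro sum.cong refl)
    fix l assume l: "l \<in> {l. 2 * l \<le> k}"
    have "t (l + r) l = (rGamma (\<mu> + real l + 1) / fact l * (x * y) ^ l / fact (k - 2 * l)) *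
        (of_nat ((k - 2 * l) choose r) * x ^ r * y ^ (k - 2 * l - r))" if "r \<le> k - 2 * l" for r
    proof -
      have "k - (l + r) = l + (k - 2 * l - r)"
        using l that by auto
      then have "y ^ (k - (l + r)) = y ^ l * y ^ (k - 2 * l - r)"
        by (simp add: power_add)
      moreover have "k - (l + r) - l = k - 2 * l - r"
        by simp
      ultimately show ?thesis
        unfolding t_def using binomial_fact[OF that, where 'a = real]
        by (simp add: power_add power_mult_distrib)
    qed
    then have "(\<Sum>r\<le>k - 2 * l. t (l + r) l) = (rGamma (\<mu> + real l + 1) / fact l * (x * y) ^ l / fact (k - 2 * l)) *
        (\<Sum>r\<le>k - 2 * l. of_nat ((k - 2 * l) choose r) * x ^ r * y ^ (k - 2 * l - r))"
      by (simp add: sum_distrib_left)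
    also have "(\<Sum>r\<le>k - 2 * l. of_nat ((k - 2 * l) choose r) * x ^ r * y ^ (k - 2 * l - r)) = (x + y) ^ (k - 2 * l)"
      by (rule binomial_ring[symmetric])
    finally show "(\<Sum>r\<le>k - 2 * l. t (l + r) l) = even_Bessel_coeff \<mu> (x * y) (2 * l) * ((x + y) ^ (k - 2 * l) / fact (k - 2 * l))"
      by (simp add: even_Bessel_coeff_def)
  qed
  also have "\<dots> = (\<Sum>n | even n \<and> n \<le> k. even_Bessel_coeff \<mu> (x * y) n * ((x + y) ^ (k - n) / fact (k - n)))"
    by (rule sum.reindex_bij_witness[where i = "\<lambda>n. n div 2" and j = "\<lambda>l. 2 * l"]) auto
  also have "\<dots> = (\<Sum>n\<le>k. even_Bessel_coeff \<mu> (x * y) n * ((x + y) ^ (k - n) / fact (k - n)))"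
    by (intro sum.mono_neutral_left) (auto simp: even_Bessel_coeff_def)
  finally show ?thesis .
qed

lemma even_Bessel_sums:
  assumes "\<mu> > -1"
  shows "(\<lambda>n. even_Bessel_coeff \<mu> z n * s ^ n) sums Bessel_Clifford \<mu> (z * s\<^sup>2)" (is ?A)
    and "summable (\<lambda>n. norm (even_Bessel_coeff \<mu> z n * s ^ n))" (is ?B)
proof -
  have inj: "strict_mono (\<lambda>n::nat. 2 * n)"
    by (auto simp: strict_mono_def)
  have eq: "even_Bessel_coeff \<mu> z (2 * n) * s ^ (2 * n) = rGamma (\<mu> + real n + 1) / fact n * (z * s\<^sup>2) ^ n" for n
    by (simp add: even_Bessel_coeff_def power_mult power_mult_distrib)
  have 0: "even_Bessel_coeff \<mu> z n * s ^ n = 0" if "n \<notin> range (\<lambda>n. 2 * n)" for n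
    using that by (auto simp: even_Bessel_coeff_def elim!: evenE)
  have "(\<lambda>n. even_Bessel_coeff \<mu> z (2 * n) * s ^ (2 * n)) sums Bessel_Clifford \<mu> (z * s\<^sup>2)"
    unfolding eq by (rule Bessel_Clifford_sums[OF assms])
  then show ?A
    using sums_mono_reindex[OF inj, of "\<lambda>n. even_Bessel_coeff \<mu> z n * s ^ n"] 0 by simp
  have "summable (\<lambda>n. \<bar>even_Bessel_coeff \<mu> z (2 * n) * s ^ (2 * n)\<bar>)"
    unfolding eq using Bessel_Clifford_sums_abs(1)[of \<mu> 0 1 "z * s\<^sup>2"] assms by simp
  then show ?B
    using summable_mono_reindex[OF inj, of "\<lambda>n. norm (even_Bessel_coeff \<mu> z n * s ^ n)"] 0 by simp
qed

lemma Bessel_product_coeff_sums: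
  assumes "\<mu> > -1"
  shows "(\<lambda>k. Gamma (\<mu> + real k + 1) * Bessel_product_coeff \<mu> x y k * s ^ k) sums
    (Bessel_Clifford \<mu> (x * y * s\<^sup>2) * exp ((x + y) * s))"
proof -
  define e where "e n = ((x + y) * s) ^ n / fact n" for n
  have "e sums exp ((x + y) * s)"
    using exp_converges[of "(x + y) * s"] by (simp add: e_def[abs_def] divide_inverse mult.commute)
  moreover have "summable (\<lambda>n. norm (e n))"
    using summable_norm_exp[of "(x + y) * s"] by (simp add: e_def divide_inverse mult.commute)
  ultimately have "(\<lambda>k. \<Sum>n\<le>k. (even_Bessel_coeff \<mu> (x * y) n * s ^ n) * e (k - n)) sums
      (Bessel_Clifford \<mu> (x * y * s\<^sup>2) * exp ((x + y) * s))"
    using Cauchy_product_sums[OF even_Bessel_sums(2)[OF assms, of "x * y" s]] even_Bessel_sums(1)[OF assms, of "x * y" s]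
    by (simp add: sums_iff)
  also have "(\<lambda>k. \<Sum>n\<le>k. (even_Bessel_coeff \<mu> (x * y) n * s ^ n) * e (k - n)) =
     (\<lambda>k. Gamma (\<mu> + real k + 1) * Bessel_product_coeff \<mu> x y k * s ^ k)"
  proof
    fix k
    have "(even_Bessel_coeff \<mu> (x * y) n * s ^ n) * e (k - n) =
       even_Bessel_coeff \<mu> (x * y) n * ((x + y) ^ (k - n) / fact (k - n)) * s ^ k" if "n \<le> k" for n
    proof -
      have "s ^ k = s ^ n * s ^ (k - n)"
        using that by (simp flip: power_add)
      then show ?thesis
        by (simp add: e_def power_mult_distrib)
    qed
    then show "(\<Sum>n\<le>k. (even_Bessel_coeff \<mu> (x * y) n * s ^ n) * e (k - n)) =
       Gamma (\<mu> + real k + 1) * Bessel_product_coeff \<mu> x y k * s ^ k"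
      unfolding Gamma_mult_Bessel_product_coeff[OF assms] sum_distrib_right by (intro sum.cong) auto
  qed
  finally show ?thesis .
qed

lemma Bessel_product_sums:
  assumes "\<mu> > -1"
  shows "(\<lambda>k. Bessel_product_coeff \<mu> x y k * z ^ k) sums (Bessel_Clifford \<mu> (x * z) * Bessel_Clifford \<mu> (y * z))" (is ?A)
    and "summable (\<lambda>k. \<bar>Bessel_product_coeff \<mu> x y k * z ^ k\<bar>)" (is ?B)
proof -
  define a where "a v j = rGamma (\<mu> + real j + 1) / fact j * v ^ j" for v j
  have a: "a v sums Bessel_Clifford \<mu> v" "summable (\<lambda>j. norm (a v j))" for v
    unfolding a_def[abs_def] using Bessel_Clifford_sums[OF assms] Bessel_Clifford_sums_abs(1)[of \<mu> 0 1] assms by auto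
  have eq: "(\<Sum>i\<le>k. a (p * q) i * a (r * q) (k - i)) = Bessel_product_coeff \<mu> p r k * q ^ k" for p q r k
  proof -
    have "a (p * q) i * a (r * q) (k - i) = a p i * a r (k - i) * q ^ k" if "i \<le> k" for i
    proof -
      have "q ^ k = q ^ i * q ^ (k - i)"
        using that by (simp flip: power_add)
      then show ?thesis
        by (simp add: a_def power_mult_distrib)
    qed
    then show ?thesis
      unfolding Bessel_product_coeff_def sum_distrib_right a_def[symmetric] by (intro sum.cong) auto
  qed
  show ?A
    using Cauchy_product_sums[OF a(2)[of "x * z"] a(2)[of "y * z"]] a(1)[of "x * z"] a(1)[of "y * z"]
    unfolding eq by (simp add: sums_iff)
  have "summable (\<lambda>k. Bessel_product_coeff \<mu> \<bar>x\<bar> \<bar>y\<bar> k * \<bar>z\<bar> ^ k)"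
    using summable_Cauchy_product[OF a(2)[of "\<bar>x\<bar> * \<bar>z\<bar>"] a(2)[of "\<bar>y\<bar> * \<bar>z\<bar>"]] unfolding eq .
  then show ?B
  proof (rule summable_comparison_test')
    fix k :: nat
    have r: "rGamma (\<mu> + real i + 1) > 0" for i
      using assms by (intro rGamma_pos) auto
    have "\<bar>Bessel_product_coeff \<mu> x y k\<bar> \<le> Bessel_product_coeff \<mu> \<bar>x\<bar> \<bar>y\<bar> k"
      unfolding Bessel_product_coeff_def using r
      by (intro order_trans[OF sum_abs] sum_mono) (simp add: abs_mult power_abs abs_of_pos del: of_nat_diff)
    then show "norm \<bar>Bessel_product_coeff \<mu> x y k * z ^ k\<bar> \<le> Bessel_product_coeff \<mu> \<bar>x\<bar> \<bar>y\<bar> k * \<bar>z\<bar> ^ k"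
      by (simp add: abs_mult power_abs mult_right_mono)
  qed
qed

text \<open>The product of the two Bessel functions is expanded in powers of z and integrated
  termwise. Since x, y >= 0 the coefficients \<open>c k\<close> are nonnegative, so the integrated
  norms form the generating series of \<open>Bessel_product_coeff_sums\<close> at s = 1/\<tau>, and
  the integral is the same series at s = -1/\<tau>.\<close>

lemma Weber_integral:
  assumes \<mu>: "\<mu> > -1" and "x \<ge> 0" "y \<ge> 0" "\<tau> > 0"
  defines "f \<equiv> \<lambda>z. indicator {0<..} z * (Bessel_Clifford \<mu> (- (x * z)) * Bessel_Clifford \<mu> (- (y * z)) * (z powr \<mu> * exp (- (\<tau> * z))))"
  shows "(\<integral>z. f z \<partial>lborel) =
      exp (- ((x + y) / \<tau>)) * Bessel_Clifford \<mu> (x * y / \<tau>\<^sup>2) / \<tau> powr (\<mu> + 1)"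
proof -
  define c where "c k = Bessel_product_coeff \<mu> x y k" for k
  define g where "g k z = (-1) ^ k * c k * (indicator {0<..} z * (z powr (\<mu> + real k) * exp (- (\<tau> * z))))" for k z
  have c: "c k \<ge> 0" for k
    unfolding c_def Bessel_product_coeff_def using assms rGamma_pos
    by (intro sum_nonneg mult_nonneg_nonneg divide_nonneg_pos less_imp_le[OF rGamma_pos]) auto
  have g_eq: "g k z = indicator {0<..} z * (z powr \<mu> * exp (- (\<tau> * z))) * (c k * (- z) ^ k)" for k z
    by (cases "z > 0") (simp_all add: g_def powr_add powr_realpow power_minus[of z])
  have s: "\<mu> + real k > -1" for k
    using \<mu> by linarith
  have int_g: "integrable lborel (g k)" for k
    unfolding g_def using s assms by (intro integrable_mult_right Gamma_real_integrable)
  have integral: "(\<integral>z. indicator {0<..} z * (z powr (\<mu> + real k) * exp (- (\<tau> * z))) \<partial>lborel) =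
      Gamma (\<mu> + real k + 1) * (1 / \<tau>) ^ k / \<tau> powr (\<mu> + 1)" for k
  proof -
    have "\<tau> powr (\<mu> + real k + 1) = \<tau> ^ k * \<tau> powr (\<mu> + 1)"
      using assms by (simp add: powr_realpow[symmetric] flip: powr_add) (simp add: algebra_simps)
    then show ?thesis
      using Gamma_real_integral_eq[OF s assms(4), of k] by (simp add: power_one_over)
  qed
  have norm_g: "(\<integral>z. norm (g k z) \<partial>lborel) = (Gamma (\<mu> + real k + 1) * c k * (1 / \<tau>) ^ k) / \<tau> powr (\<mu> + 1)" for k
  proof -
    have "norm (g k z) = c k * (indicator {0<..} z * (z powr (\<mu> + real k) * exp (- (\<tau> * z))))" for z
      using c[of k] by (simp add: g_def abs_mult power_abs)
    then show ?thesis
      by (simp add: integral)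
  qed
  have summ: "AE z in lborel. summable (\<lambda>k. norm (g k z))"
  proof (rule AE_I2)
    fix z
    have "norm (g k z) = \<bar>indicator {0<..} z * (z powr \<mu> * exp (- (\<tau> * z)))\<bar> * \<bar>Bessel_product_coeff \<mu> x y k * (- z) ^ k\<bar>" for k
      unfolding g_eq c_def by (simp only: real_norm_def abs_mult mult.assoc)
    then show "summable (\<lambda>k. norm (g k z))"
      by (simp only:) (intro summable_mult Bessel_product_sums(2) \<mu>)
  qed
  have summ_norm: "summable (\<lambda>k. \<integral>z. norm (g k z) \<partial>lborel)"
    unfolding norm_g c_def by (intro summable_divide sums_summable[OF Bessel_product_coeff_sums] \<mu>)
  have f_eq: "f z = (\<Sum>k. g k z)" for z
  proof -
    have "(\<lambda>k. g k z) sums (indicator {0<..} z * (z powr \<mu> * exp (- (\<tau> * z))) *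
        (Bessel_Clifford \<mu> (x * - z) * Bessel_Clifford \<mu> (y * - z)))"
      unfolding g_eq c_def by (intro sums_mult Bessel_product_sums(1) \<mu>)
    then show ?thesis
      by (simp add: f_def sums_iff mult_ac)
  qed
  have "(\<lambda>k. \<integral>z. g k z \<partial>lborel) sums (\<integral>z. (\<Sum>k. g k z) \<partial>lborel)"
    by (rule sums_integral[OF int_g summ summ_norm])
  moreover have "(\<integral>z. g k z \<partial>lborel) = (Gamma (\<mu> + real k + 1) * c k * (- (1 / \<tau>)) ^ k) / \<tau> powr (\<mu> + 1)" for k
    unfolding g_def by (simp add: integral power_minus[of "1 / \<tau>"])
  moreover have "(\<lambda>k. (Gamma (\<mu> + real k + 1) * c k * (- (1 / \<tau>)) ^ k) / \<tau> powr (\<mu> + 1)) sums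
      ((Bessel_Clifford \<mu> (x * y * (- (1 / \<tau>))\<^sup>2) * exp ((x + y) * - (1 / \<tau>))) / \<tau> powr (\<mu> + 1))"
    unfolding c_def by (intro sums_divide Bessel_product_coeff_sums \<mu>)
  ultimately have "(\<integral>z. (\<Sum>k. g k z) \<partial>lborel) =
     (Bessel_Clifford \<mu> (x * y * (- (1 / \<tau>))\<^sup>2) * exp ((x + y) * - (1 / \<tau>))) / \<tau> powr (\<mu> + 1)"
    by (simp only: sums_unique2)
  then show ?thesis
    unfolding f_eq by (simp add: power_divide mult.commute)
qed

section \<open>The heat kernel\<close>

text \<open>With z = |\<xi>|^a and P = |x|^a / a^2 the Bessel argument w of the kernel satisfies
  (w/2)^2 = -Pz.\<close>

definition radial_part :: "real \<Rightarrow> real \<Rightarrow> real \<Rightarrow> nat \<Rightarrow> real \<Rightarrow> real" where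
  "radial_part a \<nu> P m z = Bessel_term (2 / a) \<nu> (sqrt (P * z)) (- (P * z)) m"

lemma sqrt_powr: "x \<ge> 0 \<Longrightarrow> sqrt x powr (2 / a) = x powr (1 / a)"
  by (simp add: powr_half_sqrt[symmetric] powr_powr)

lemma abs_radial_part_le:
  assumes "a > 0" "2 / a * \<nu> > -1" "P \<ge> 0" "z \<ge> 0"
  shows "\<bar>radial_part a \<nu> P m z\<bar> \<le> 2 * exp (2 + (2 * 2 powr (a / 2) + 1) * sqrt (P * z)) * (1 / 2) ^ m"
  using abs_Bessel_term_le[of "2 / a" \<nu> "sqrt (P * z)" "- (P * z)" m] assms by (simp add: radial_part_def)

lemma
  assumes "a > 0" "\<nu> > -1" "2 / a * \<nu> > -1" "P \<ge> 0" "z \<ge> 0" "\<bar>u\<bar> \<le> 1"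
  defines "f \<equiv> \<lambda>m. \<bar>radial_part a \<nu> P m z * normalized_Gegenbauer \<nu> m u\<bar>"
  shows summable_radial_part_Gegenbauer: "summable f"
    and suminf_radial_part_Gegenbauer: "suminf f \<le>
      2 * exp (2 + (2 * 2 powr (a / 2) + 1) * sqrt (P * z)) * (\<Sum>m. Gegenbauer_bound \<nu> m * (1 / 2) ^ m)"
proof -
  have b: "2 / a > 0" "1 / (2 / a) = a / 2"
    using assms by auto
  have v: "sqrt (P * z) \<ge> 0" "\<bar>- (P * z)\<bar> = (sqrt (P * z))\<^sup>2"
    using assms by auto
  note S = summable_Bessel_Gegenbauer_bound[OF b(1) assms(2,3) v]
  have le: "f m \<le> \<bar>Bessel_term (2 / a) \<nu> (sqrt (P * z)) (- (P * z)) m\<bar> * Gegenbauer_bound \<nu> m" for m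
    unfolding f_def radial_part_def abs_mult by (intro mult_left_mono abs_Gegenbauer_le assms) auto
  show S': "summable f"
    by (rule summable_comparison_test'[OF S]) (use le in \<open>auto simp: f_def\<close>)
  show "suminf f \<le> 2 * exp (2 + (2 * 2 powr (a / 2) + 1) * sqrt (P * z)) * (\<Sum>m. Gegenbauer_bound \<nu> m * (1 / 2) ^ m)"
    using suminf_le[OF le S' S] suminf_Bessel_Gegenbauer_bound[OF b(1) assms(2,3) v] unfolding b(2) by linarith
qed

lemma principal_power_neg_imaginary:
  assumes "v \<ge> 0" "b > 0"
  shows "principal_power (- (\<i> * of_real v)) (b * real m) = of_real ((v powr b) ^ m) * cis (- (pi / 2 * (b * real m)))"
proof (cases "m = 0 \<or> v = 0")
  case True
  then show ?thesis
    using assms by (cases m) (auto simp: principal_power_def)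
next
  case False
  then have v: "v > 0" and m: "m \<noteq> 0"
    using assms by auto
  have "Arg (- (\<i> * of_real v)) = - (pi / 2)"
  proof (rule cis_Arg_unique)
    show "sgn (- (\<i> * of_real v)) = cis (- (pi / 2))"
      using v by (simp add: sgn_div_norm norm_mult scaleR_conv_of_real complex_eq_iff power2_eq_square)
  qed (use pi_gt_zero in linarith)+
  moreover have "v powr (b * real m) = (v powr b) ^ m"
    using v by (simp add: powr_powr[symmetric] powr_realpow)
  ultimately show ?thesis
    using v m assms by (simp add: principal_power_def norm_mult mult_ac)
qed

lemma normalized_Bessel_I_neg_imaginary:
  assumes "\<mu> > -1"
  shows "normalized_Bessel_I \<mu> (- (2 * \<i> * of_real v)) = of_real (Bessel_Clifford \<mu> (- v\<^sup>2))"
proof -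
  have "(- (2 * \<i> * complex_of_real v) / 2) ^ (2 * j) * of_real (rGamma (\<mu> + real j + 1) / fact j) =
    of_real (rGamma (\<mu> + real j + 1) / fact j * (- v\<^sup>2) ^ j)" for j
  proof -
    have "(- (2 * \<i> * complex_of_real v) / 2)\<^sup>2 = of_real (- v\<^sup>2)"
      by (simp add: power_mult_distrib power_divide)
    then show ?thesis
      unfolding power_mult by simp
  qed
  then show ?thesis
    unfolding normalized_Bessel_I_def Bessel_Clifford_def
    by (simp only: suminf_of_real[OF summable_Bessel_Clifford[OF assms]])
qed

text \<open>For x = 0 the vector \<open>sgn x\<close> is 0, not a unit vector. Any unit vector
  \<omega> may replace it, because then the radial parts with m >= 1 vanish and the polynomial of
  index 0 is constant. Thus the bounds and the orthogonality for unit vectors cover all x.\<close>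

lemma B_kernel_eq:
  fixes x \<xi> \<omega> :: "real ^ 'n"
  assumes "a > 0" "2 / a * \<nu> > -1" "x = norm x *\<^sub>R \<omega>" "norm \<omega> = 1" "\<nu> = (real CARD('n) - 2) / 2"
  shows "B_kernel a x \<xi> = of_real (Gamma (2 / a * \<nu> + 1)) *
    (\<Sum>m. cis (- (pi / a * real m)) * of_real (radial_part a \<nu> (norm x powr a / a\<^sup>2) m (norm \<xi> powr a) *
      normalized_Gegenbauer \<nu> m (\<omega> \<bullet> sgn \<xi>)))"
proof -
  define v where "v = (norm x * norm \<xi>) powr (a / 2) / a"
  define P where "P = norm x powr a / a\<^sup>2"
  define z where "z = norm \<xi> powr a"
  have v: "v \<ge> 0"
    using assms by (simp add: v_def)
  have v2: "v\<^sup>2 = P * z"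
  proof -
    have "(r powr (a / 2))\<^sup>2 = r powr a" for r
      by (simp add: power2_eq_square flip: powr_add)
    then show ?thesis
      by (simp add: v_def P_def z_def power_divide powr_mult power_mult_distrib)
  qed
  then have v_sqrt: "v = sqrt (P * z)"
    using v real_sqrt_unique by metis
  have w: "of_real (2 * (norm x * norm \<xi>) powr (a / 2)) / (of_real a * \<i>) = - (2 * \<i> * complex_of_real v)"
    using assms by (simp add: v_def complex_eq_iff Re_divide Im_divide power2_eq_square)
  have "principal_power (- (2 * \<i> * complex_of_real v) / 2) (2 / a * real m) *
          normalized_Bessel_I (2 / a * (real m + \<nu>)) (- (2 * \<i> * complex_of_real v)) *
          of_real (normalized_Gegenbauer \<nu> m (sgn x \<bullet> sgn \<xi>)) =
        cis (- (pi / a * real m)) * of_real (radial_part a \<nu> P m z * normalized_Gegenbauer \<nu> m (\<omega> \<bullet> sgn \<xi>))" for m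
  proof -
    have 1: "principal_power (- (2 * \<i> * complex_of_real v) / 2) (2 / a * real m) =
        of_real ((v powr (2 / a)) ^ m) * cis (- (pi / a * real m))"
      using principal_power_neg_imaginary[OF v, of "2 / a" m] assms(1) by simp
    have 2: "normalized_Bessel_I (2 / a * (real m + \<nu>)) (- (2 * \<i> * complex_of_real v)) =
        of_real (Bessel_Clifford (2 / a * (real m + \<nu>)) (- (P * z)))"
      unfolding v2[symmetric] using assms(1,2) by (intro normalized_Bessel_I_neg_imaginary Bessel_order_gt) auto
    show ?thesis
    proof (cases "x = 0 \<and> m \<noteq> 0")
      case True
      then show ?thesis
        using assms(1) unfolding 1 2 by (simp add: radial_part_def Bessel_term_def P_def v_sqrt)
    next
      case False
      have "normalized_Gegenbauer \<nu> m (sgn x \<bullet> sgn \<xi>) = normalized_Gegenbauer \<nu> m (\<omega> \<bullet> sgn \<xi>)"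
      proof (cases "x = 0")
        case True
        then show ?thesis
          using False by (simp add: normalized_Gegenbauer_eq_poly Gegenbauer_poly_0)
      next
        case False
        then have "sgn x = \<omega>"
          using assms(3) by (metis sgn_div_norm norm_eq_zero scaleR_left_imp_eq scaleR_scaleR right_inverse scaleR_one)
        then show ?thesis by simp
      qed
      then show ?thesis
        unfolding 1 2 by (simp add: radial_part_def Bessel_term_def v_sqrt mult_ac)
    qed
  qed
  then show ?thesis
    unfolding B_kernel_def assms(5)[symmetric] I_series_def w P_def[symmetric] z_def[symmetric]
    by (simp only:)
qed

section \<open>Integration against the heat weight\<close>

text \<open>Completing the square gives c sqrt(z) <= c^2 / (2\<tau>) + \<tau> z / 2, so half of the
  exponential decay absorbs the growth of f.\<close>

lemma radial_weight_integrable: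
  fixes f :: "real \<Rightarrow> real"
  assumes "\<tau> > 0" "s > -1" "f \<in> borel_measurable borel" "\<And>z. z > 0 \<Longrightarrow> \<bar>f z\<bar> \<le> C * exp (c * sqrt z)"
  shows "integrable lborel (\<lambda>z. indicator {0<..} z * (f z * exp (- (\<tau> * z)) * z powr s))"
    (is "integrable _ ?f")
proof (rule Bochner_Integration.integrable_bound)
  show "integrable lborel (\<lambda>z. (\<bar>C\<bar> * exp (c\<^sup>2 / (2 * \<tau>))) * (indicator {0<..} z * (z powr s * exp (- (\<tau> / 2 * z)))))"
    (is "integrable _ ?g")
    using assms by (intro integrable_mult_right Gamma_real_integrable) auto
  show "?f \<in> borel_measurable lborel"
    using assms(3) by simp
  show "AE z in lborel. norm (?f z) \<le> norm (?g z)"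
  proof (rule AE_I2)
    fix z :: real
    show "norm (?f z) \<le> norm (?g z)"
    proof (cases "z > 0")
      case True
      have "0 \<le> (c - \<tau> * sqrt z)\<^sup>2"
        by simp
      also have "\<dots> = c\<^sup>2 - 2 * \<tau> * (c * sqrt z) + \<tau>\<^sup>2 * z"
        using True by (simp add: power2_diff power_mult_distrib)
      finally have "2 * \<tau> * (c * sqrt z) \<le> c\<^sup>2 + \<tau>\<^sup>2 * z"
        by simp
      then have "c * sqrt z \<le> c\<^sup>2 / (2 * \<tau>) + \<tau> / 2 * z"
        using assms(1) by (simp add: field_simps power2_eq_square)
      then have "exp (c * sqrt z + (- (\<tau> * z))) \<le> exp (c\<^sup>2 / (2 * \<tau>) + (- (\<tau> / 2 * z)))"
        by simp
      then have e: "exp (c * sqrt z) * exp (- (\<tau> * z)) \<le> exp (c\<^sup>2 / (2 * \<tau>)) * exp (- (\<tau> / 2 * z))"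
        unfolding exp_add .
      have "\<bar>f z\<bar> \<le> \<bar>C\<bar> * exp (c * sqrt z)"
        using assms(4)[OF True] by (rule order_trans) (simp add: mult_right_mono)
      then have "\<bar>f z\<bar> * exp (- (\<tau> * z)) \<le> \<bar>C\<bar> * exp (c * sqrt z) * exp (- (\<tau> * z))"
        by (intro mult_right_mono) auto
      also have "\<dots> \<le> \<bar>C\<bar> * (exp (c\<^sup>2 / (2 * \<tau>)) * exp (- (\<tau> / 2 * z)))"
        unfolding mult.assoc by (intro mult_left_mono e) auto
      finally have "\<bar>f z\<bar> * exp (- (\<tau> * z)) * z powr s \<le>
          \<bar>C\<bar> * (exp (c\<^sup>2 / (2 * \<tau>)) * exp (- (\<tau> / 2 * z))) * z powr s"
        by (intro mult_right_mono) auto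
      then show ?thesis
        using True by (simp add: abs_mult mult_ac)
    qed simp
  qed
qed

lemma borel_measurable_radial_part [measurable]:
  assumes "a > 0" "2 / a * \<nu> > -1"
  shows "radial_part a \<nu> P m \<in> borel_measurable borel"
proof -
  have "2 / a * (real m + \<nu>) > -1"
    using assms by (intro Bessel_order_gt) auto
  then have "continuous_on UNIV (Bessel_Clifford (2 / a * (real m + \<nu>)))"
    using DERIV_Bessel_Clifford by (meson DERIV_continuous_on has_field_derivative_at_within)
  then have [measurable]: "Bessel_Clifford (2 / a * (real m + \<nu>)) \<in> borel_measurable borel"
    by (rule borel_measurable_continuous_onI)
  show ?thesis
    unfolding radial_part_def[abs_def] Bessel_term_def by measurable
qed

lemma homogeneous_zero_Gegenbauer:
  fixes \<omega> \<eta> :: "'a::euclidean_space"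
  assumes "norm \<omega> = 1" "norm \<eta> = 1" "\<nu> > -1"
  shows "homogeneous_zero (\<lambda>\<xi>. normalized_Gegenbauer \<nu> m (\<omega> \<bullet> sgn \<xi>) * normalized_Gegenbauer \<nu> n (\<eta> \<bullet> sgn \<xi>))"
  unfolding homogeneous_zero_def
proof (intro conjI exI allI impI)
  show "\<bar>normalized_Gegenbauer \<nu> m (\<omega> \<bullet> sgn \<xi>) * normalized_Gegenbauer \<nu> n (\<eta> \<bullet> sgn \<xi>)\<bar> \<le>
      Gegenbauer_bound \<nu> m * Gegenbauer_bound \<nu> n" for \<xi>
    unfolding abs_mult
    by (intro mult_mono abs_Gegenbauer_le assms Gegenbauer_bound_nonneg)
      (use assms abs_inner_sgn_le[of _ \<xi>] in \<open>auto intro: order_trans[OF abs_inner_sgn_le]\<close>)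
  show "(\<lambda>\<xi>. normalized_Gegenbauer \<nu> m (\<omega> \<bullet> sgn \<xi>) * normalized_Gegenbauer \<nu> n (\<eta> \<bullet> sgn \<xi>)) \<in> borel_measurable borel"
    unfolding normalized_Gegenbauer_eq_poly poly_Gegenbauer_poly by measurable
qed (simp add: sgn_scaleR)

text \<open>The weight of the heat kernel as a function of \<open>z = |\<xi>|\<^sup>a\<close>.\<close>

definition heat_weight :: "real \<Rightarrow> real \<Rightarrow> real \<Rightarrow> real" where
  "heat_weight a t z = exp (- (t / a * z)) * z powr (1 - 2 / a)"

lemma heat_weight_eq:
  fixes \<xi> :: "'a::euclidean_space"
  assumes "a > 0"
  shows "exp (- (t / a) * norm \<xi> powr a) / norm \<xi> powr (2 - a) = heat_weight a t (norm \<xi> powr a)"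
proof (cases "\<xi> = 0")
  case False
  have "(norm \<xi> powr a) powr (1 - 2 / a) = norm \<xi> powr (- (2 - a))"
    using assms by (simp add: powr_powr algebra_simps)
  then show ?thesis
    unfolding heat_weight_def powr_minus by (simp add: divide_inverse)
qed (simp add: heat_weight_def)

text \<open>The exponent 1 - 2/a of the weight and N/a - 1 of the polar coordinates add up to (N -
  2)/a = 2 \<nu>/a, which exceeds -1 by assumption; hence integrability at 0.\<close>

lemma
  fixes f :: "real \<Rightarrow> real" and G :: "'a::euclidean_space \<Rightarrow> real"
  assumes a: "a > 0" and \<nu>: "\<nu> = (real DIM('a) - 2) / 2" and N: "2 / a * \<nu> > -1" and t: "t > 0"
    and f [measurable]: "f \<in> borel_measurable borel" "\<And>z. z > 0 \<Longrightarrow> \<bar>f z\<bar> \<le> C * exp (c * sqrt z)"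
    and G: "homogeneous_zero G"
  shows heat_weight_integrable: "integrable lborel (\<lambda>\<xi>. f (norm \<xi> powr a) * heat_weight a t (norm \<xi> powr a) * G \<xi>)" (is ?A)
    and heat_weight_integral: "(\<integral>\<xi>. f (norm \<xi> powr a) * heat_weight a t (norm \<xi> powr a) * G \<xi> \<partial>lborel) =
       angular_integral G * (real DIM('a) / a) *
       (\<integral>z. indicator {0<..} z * (f z * exp (- (t / a * z)) * z powr (2 / a * \<nu>)) \<partial>lborel)" (is ?B)
proof -
  define R where "R z = f z * heat_weight a t z" for z
  have eq: "indicator {0<..} z * (R z * z powr (real DIM('a) / a - 1)) =
      indicator {0<..} z * (f z * exp (- (t / a * z)) * z powr (2 / a * \<nu>))" for z
  proof (cases "z > 0")
    case True
    have "z powr (1 - 2 / a) * z powr (real DIM('a) / a - 1) = z powr (2 / a * \<nu>)"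
      unfolding powr_add[symmetric] \<nu> by (simp add: diff_divide_distrib)
    then show ?thesis
      using True by (simp add: R_def heat_weight_def)
  qed simp
  have R_meas: "R \<in> borel_measurable borel"
    unfolding R_def heat_weight_def by measurable
  have int: "integrable lborel (\<lambda>z. indicator {0<..} z * (R z * z powr (real DIM('a) / a - 1)))"
    unfolding eq using a N t f by (intro radial_weight_integrable) auto
  note polar_integral[OF G a R_meas int]
  then show ?A
    ?B
    unfolding eq by (simp_all only: R_def)
qed

lemma exists_unit_direction:
  fixes x :: "'a::euclidean_space"
  obtains \<omega> where "x = norm x *\<^sub>R \<omega>" "norm \<omega> = 1"
proof (cases "x = 0")
  case True
  obtain e :: 'a where "e \<in> Basis"
    using nonempty_Basis by blast
  then show ?thesis
    using True that[of e] by simp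
next
  case False
  then show ?thesis
    using that[of "sgn x"] by (simp add: sgn_div_norm)
qed

text \<open>Each factor contributes z^(m/a); with the weight z^(2\<nu>/a) this is exactly the power
  z^\<mu> of Weber's integral for \<mu> = 2 (m + \<nu>)/a. The powers of P, Q and \<tau> regroup to
  a Bessel term at sqrt(PQ)/\<tau>.\<close>

lemma radial_part_product_integral:
  assumes "a > 0" "2 / a * \<nu> > -1" "P \<ge> 0" "Q \<ge> 0" "\<tau> > 0"
  shows "(\<integral>z. indicator {0<..} z * (radial_part a \<nu> P m z * radial_part a \<nu> Q m z * exp (- (\<tau> * z)) * z powr (2 / a * \<nu>)) \<partial>lborel) =
    exp (- ((P + Q) / \<tau>)) / \<tau> powr (2 / a * \<nu> + 1) *
    Bessel_term (2 / a) \<nu> (sqrt (P * Q) / \<tau>) ((sqrt (P * Q) / \<tau>)\<^sup>2) m"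
proof -
  define \<mu> where "\<mu> = 2 / a * (real m + \<nu>)"
  have \<mu>: "\<mu> > -1"
    unfolding \<mu>_def using assms by (intro Bessel_order_gt) auto
  have eq: "indicator {0<..} z * (radial_part a \<nu> P m z * radial_part a \<nu> Q m z * exp (- (\<tau> * z)) * z powr (2 / a * \<nu>)) =
    ((P * Q) powr (1 / a)) ^ m * (indicator {0<..} z * (Bessel_Clifford \<mu> (- (P * z)) * Bessel_Clifford \<mu> (- (Q * z)) *
      (z powr \<mu> * exp (- (\<tau> * z)))))" for z
  proof (cases "z > 0")
    case True
    have p: "sqrt (P * z) powr (2 / a) = (P * z) powr (1 / a)" "sqrt (Q * z) powr (2 / a) = (Q * z) powr (1 / a)"
      using True assms by (intro sqrt_powr mult_nonneg_nonneg; simp)+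
    have "((P * z) powr (1 / a)) ^ m * ((Q * z) powr (1 / a)) ^ m = ((P * Q) powr (1 / a)) ^ m * ((z * z) powr (1 / a)) ^ m"
      using True assms by (simp add: powr_mult power_mult_distrib)
    also have "((z * z) powr (1 / a)) ^ m = z powr (2 / a * real m)"
      using True by (simp add: powr_powr powr_add[symmetric] powr_mult flip: powr_realpow)
    finally have "((P * z) powr (1 / a)) ^ m * ((Q * z) powr (1 / a)) ^ m * z powr (2 / a * \<nu>) =
        ((P * Q) powr (1 / a)) ^ m * z powr \<mu>"
      unfolding \<mu>_def distrib_left powr_add by simp
    then show ?thesis
      using True unfolding radial_part_def Bessel_term_def p \<mu>_def[symmetric] by (simp add: mult_ac)
  qed simp
  have "((sqrt (P * Q) / \<tau>) powr (2 / a)) ^ m = ((P * Q) powr (1 / a)) ^ m / (\<tau> powr (2 / a)) ^ m"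
    using assms by (simp add: powr_divide sqrt_powr power_divide)
  moreover have "\<tau> powr (\<mu> + 1) = (\<tau> powr (2 / a)) ^ m * \<tau> powr (2 / a * \<nu> + 1)"
  proof -
    have "\<mu> + 1 = 2 / a * real m + (2 / a * \<nu> + 1)"
      by (simp add: \<mu>_def distrib_left)
    moreover have "\<tau> powr (2 / a * real m) = (\<tau> powr (2 / a)) ^ m"
      using assms by (subst powr_realpow[symmetric]) (simp_all add: powr_powr)
    ultimately show ?thesis
      by (simp only: powr_add)
  qed
  moreover have "(sqrt (P * Q) / \<tau>)\<^sup>2 = P * Q / \<tau>\<^sup>2"
    using assms by (simp add: power_divide)
  ultimately show ?thesis
    unfolding eq Bessel_term_def integral_mult_right_zero Weber_integral[OF \<mu> assms(3,4,5)] \<mu>_def[symmetric]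
    by (simp add: mult_ac)
qed

text \<open>Both kernel series are cut at the same K, so that each integral is a finite double sum
  of which only the diagonal remains. The partial sums are bounded by exponentials of a multiple of
  the square root of |\<xi>|^a, integrable against the weight, and dominated convergence yields the
  limit.\<close>

theorem heat_integral_nonneg:
  fixes x y :: "real ^ 'n"
  assumes a: "a > 0" "2 / a * ((real CARD('n) - 2) / 2) > -1" and t: "t > 0"
  shows "(\<integral>\<xi>. cnj (B_kernel a x \<xi>) * B_kernel a y \<xi> *
    of_real (exp (- (t / a) * norm \<xi> powr a) / norm \<xi> powr (2 - a)) \<partial>lborel) \<in> \<real>\<^sub>\<ge>\<^sub>0"
    (is "integral\<^sup>L _ ?h \<in> _")
proof -
  define \<nu> where "\<nu> = (real CARD('n) - 2) / 2"
  define \<tau> where "\<tau> = t / a"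
  have \<nu>: "\<nu> \<ge> - 1 / 2" "\<nu> > -1" "2 / a * \<nu> > -1"
  proof -
    have "real CARD('n) \<ge> 1"
      by (simp add: Suc_leI)
    then show "\<nu> \<ge> - 1 / 2" "\<nu> > -1" "2 / a * \<nu> > -1"
      using a(2) by (auto simp: \<nu>_def)
  qed
  have \<nu>_DIM: "\<nu> = (real DIM(real ^ 'n) - 2) / 2"
    by (simp add: \<nu>_def)
  have \<tau>: "\<tau> > 0"
    using a t by (simp add: \<tau>_def)
  obtain \<omega> where \<omega>: "x = norm x *\<^sub>R \<omega>" "norm \<omega> = 1"
    by (rule exists_unit_direction)
  obtain \<eta> where \<eta>: "y = norm y *\<^sub>R \<eta>" "norm \<eta> = 1"
    by (rule exists_unit_direction)
  define P where "P = norm x powr a / a\<^sup>2"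
  define Q where "Q = norm y powr a / a\<^sup>2"
  have PQ: "P \<ge> 0" "Q \<ge> 0"
    by (auto simp: P_def Q_def)
  define C where "C = normalized_Gegenbauer \<nu>"
  define \<epsilon> where "\<epsilon> m = cis (- (pi / a * real m))" for m :: nat
  define z where "z \<xi> = norm \<xi> powr a" for \<xi> :: "real ^ 'n"
  define A where "A R e m \<xi> = radial_part a \<nu> R m (z \<xi>) * C m (e \<bullet> sgn \<xi>)" for R e m \<xi>
  define S where "S R e K \<xi> = (\<Sum>m<K. \<epsilon> m * of_real (A R e m \<xi>))" for R e K \<xi>
  define L where "L R e \<xi> = (\<Sum>m. \<epsilon> m * of_real (A R e m \<xi>))" for R e \<xi>
  define W where "W \<xi> = heat_weight a t (z \<xi>)" for \<xi>
  have W_nonneg: "W \<xi> \<ge> 0" for \<xi>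
    by (simp add: W_def heat_weight_def)
  define k where "k = 2 * 2 powr (a / 2) + 1"
  define D where "D = 2 * exp 2 * (\<Sum>m. Gegenbauer_bound \<nu> m * (1 / 2) ^ m)"
  define M where "M R z = D * exp (k * sqrt (R * z))" for R z
  have D: "D \<ge> 0"
    unfolding D_def using \<nu>(2)
    by (intro mult_nonneg_nonneg suminf_nonneg summable_Gegenbauer_bound Gegenbauer_bound_nonneg) auto
  have norm_term: "cmod (\<epsilon> m * of_real r) = \<bar>r\<bar>" for m r
    by (simp add: \<epsilon>_def norm_mult)
  have inner_le: "\<bar>e \<bullet> sgn \<xi>\<bar> \<le> 1" if "norm e = 1" for e \<xi> :: "real ^ 'n"
    using abs_inner_sgn_le[of e \<xi>] that by simp
  have A_summable: "summable (\<lambda>m. \<bar>A R e m \<xi>\<bar>)" and A_bound: "(\<Sum>m. \<bar>A R e m \<xi>\<bar>) \<le> M R (z \<xi>)"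
    if "R \<ge> 0" "norm e = 1" for R e \<xi>
    using summable_radial_part_Gegenbauer[OF a(1) \<nu>(2,3) that(1) _ inner_le[OF that(2), of \<xi>], of "z \<xi>"]
      suminf_radial_part_Gegenbauer[OF a(1) \<nu>(2,3) that(1) _ inner_le[OF that(2), of \<xi>], of "z \<xi>"]
    by (auto simp: A_def C_def M_def D_def k_def z_def exp_add mult_ac)
  have S_lim: "(\<lambda>K. S R e K \<xi>) \<longlonglongrightarrow> L R e \<xi>" and S_bound: "cmod (S R e K \<xi>) \<le> M R (z \<xi>)"
    if R: "R \<ge> 0" "norm e = 1" for R e \<xi> K
  proof -
    have "summable (\<lambda>m. cmod (\<epsilon> m * of_real (A R e m \<xi>)))"
      unfolding norm_term by (rule A_summable[OF R])
    then show "(\<lambda>K. S R e K \<xi>) \<longlonglongrightarrow> L R e \<xi>"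
      unfolding S_def L_def by (rule summable_LIMSEQ[OF summable_norm_cancel])
    have "cmod (S R e K \<xi>) \<le> (\<Sum>m<K. \<bar>A R e m \<xi>\<bar>)"
      unfolding S_def by (rule order_trans[OF norm_sum]) (simp add: norm_term)
    also have "\<dots> \<le> (\<Sum>m. \<bar>A R e m \<xi>\<bar>)"
      by (intro sum_le_suminf A_summable R) auto
    finally show "cmod (S R e K \<xi>) \<le> M R (z \<xi>)"
      using A_bound[OF R, of \<xi>] by simp
  qed
  have z_meas [measurable]: "z \<in> borel_measurable borel"
    unfolding z_def[abs_def] by measurable
  have [measurable]: "W \<in> borel_measurable borel"
    unfolding W_def[abs_def] heat_weight_def by measurable
  have rad_meas [measurable]: "radial_part a \<nu> R m \<in> borel_measurable borel" for R m
    by (rule borel_measurable_radial_part[OF a(1) \<nu>(3)])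
  have A_meas [measurable]: "A R e m \<in> borel_measurable borel" for R e m
    unfolding A_def[abs_def] C_def normalized_Gegenbauer_eq_poly poly_Gegenbauer_poly by measurable
  have S_meas [measurable]: "S R e K \<in> borel_measurable borel" for R e K
    unfolding S_def[abs_def] by measurable
  define h where "h K \<xi> = cnj (S P \<omega> K \<xi>) * S Q \<eta> K \<xi> * of_real (W \<xi>)" for K \<xi>
  define H where "H \<xi> = cnj (L P \<omega> \<xi>) * L Q \<eta> \<xi> * of_real (W \<xi>)" for \<xi>
  have [measurable]: "cnj \<in> borel_measurable borel"
    by (intro borel_measurable_continuous_onI continuous_intros)
  have h_meas [measurable]: "h K \<in> borel_measurable borel" for K
    unfolding h_def[abs_def] by measurable
  have h_lim: "(\<lambda>K. h K \<xi>) \<longlonglongrightarrow> H \<xi>" for \<xi>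
    unfolding h_def H_def using PQ \<omega> \<eta> by (intro tendsto_intros S_lim)
  have M_nonneg: "M R r \<ge> 0" for R r
    using D by (simp add: M_def)
  have h_bound: "cmod (h K \<xi>) \<le> M P (z \<xi>) * M Q (z \<xi>) * heat_weight a t (z \<xi>) * 1" for K \<xi>
  proof -
    have "cmod (h K \<xi>) = cmod (S P \<omega> K \<xi>) * cmod (S Q \<eta> K \<xi>) * W \<xi>"
      using W_nonneg[of \<xi>] by (simp add: h_def norm_mult)
    also have "\<dots> \<le> M P (z \<xi>) * M Q (z \<xi>) * W \<xi>"
      using PQ \<omega> \<eta> W_nonneg M_nonneg by (intro mult_right_mono mult_mono S_bound) auto
    finally show ?thesis
      by (simp add: W_def)
  qed
  have M_eq: "M P r * M Q r = D * D * exp (k * (sqrt P + sqrt Q) * sqrt r)" for r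
    by (simp add: M_def real_sqrt_mult exp_add[symmetric] algebra_simps)
  have M_int: "integrable lborel (\<lambda>\<xi>. M P (z \<xi>) * M Q (z \<xi>) * heat_weight a t (z \<xi>) * (1::real))"
    unfolding z_def
  proof (rule heat_weight_integrable[where f = "\<lambda>r. M P r * M Q r"])
    show "(\<lambda>r. M P r * M Q r) \<in> borel_measurable borel"
      unfolding M_def by measurable
    show "\<bar>M P r * M Q r\<bar> \<le> D * D * exp (k * (sqrt P + sqrt Q) * sqrt r)" for r
      unfolding M_eq using D by simp
  qed (rule a(1) \<nu>_DIM \<nu>(3) t homogeneous_zero_const)+
  have H_meas: "H \<in> borel_measurable lborel"
    unfolding measurable_lborel1
    by (rule borel_measurable_LIMSEQ_metric[of h]) (use h_lim in auto)
  have lim: "(\<lambda>K. \<integral>\<xi>. h K \<xi> \<partial>lborel) \<longlonglongrightarrow> (\<integral>\<xi>. H \<xi> \<partial>lborel)"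
    by (rule integral_dominated_convergence[OF H_meas _ M_int]) (use h_lim h_bound in auto)
  define V where "V = sqrt (P * Q) / \<tau>"
  \<comment> \<open>The part of the diagonal integrals that does not depend on m: angular volume,
    Jacobian and the prefactor from Weber's integral.\<close>
  define J where "J = angular_integral (\<lambda>_::real ^ 'n. 1) * (real DIM(real ^ 'n) / a) *
    (exp (- ((P + Q) / \<tau>)) / \<tau> powr (2 / a * \<nu> + 1))"
  define q where "q m = Bessel_term (2 / a) \<nu> V (V\<^sup>2) m * C m (\<omega> \<bullet> \<eta>)" for m
  have T: "integrable lborel (\<lambda>\<xi>. A P \<omega> m \<xi> * A Q \<eta> n \<xi> * W \<xi>)"
    "(\<integral>\<xi>. A P \<omega> m \<xi> * A Q \<eta> n \<xi> * W \<xi> \<partial>lborel) = (if m = n then J * q m else 0)" for m n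
  proof -
    define f where "f r = radial_part a \<nu> P m r * radial_part a \<nu> Q n r" for r
    define G where "G \<xi> = C m (\<omega> \<bullet> sgn \<xi>) * C n (\<eta> \<bullet> sgn \<xi>)" for \<xi> :: "real ^ 'n"
    have eq: "A P \<omega> m \<xi> * A Q \<eta> n \<xi> * W \<xi> = f (norm \<xi> powr a) * heat_weight a t (norm \<xi> powr a) * G \<xi>" for \<xi>
      by (simp add: A_def f_def G_def W_def z_def)
    have f: "f \<in> borel_measurable borel"
      unfolding f_def[abs_def] by measurable
    have f_bound: "\<bar>f r\<bar> \<le> (2 * exp 2) * (2 * exp 2) * exp (k * (sqrt P + sqrt Q) * sqrt r)" if "r > 0" for r
    proof -
      have *: "\<bar>radial_part a \<nu> R m r\<bar> \<le> 2 * exp 2 * exp (k * sqrt (R * r))" if "R \<ge> 0" for R m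
      proof -
        have "\<bar>radial_part a \<nu> R m r\<bar> \<le> 2 * exp (2 + k * sqrt (R * r)) * (1 / 2) ^ m"
          unfolding k_def using a(1) \<nu>(3) that \<open>r > 0\<close> by (intro abs_radial_part_le) auto
        also have "\<dots> \<le> 2 * exp (2 + k * sqrt (R * r)) * 1"
          by (intro mult_left_mono power_le_one) auto
        finally show ?thesis
          by (simp add: exp_add)
      qed
      have "\<bar>f r\<bar> \<le> (2 * exp 2 * exp (k * sqrt (P * r))) * (2 * exp 2 * exp (k * sqrt (Q * r)))"
        unfolding f_def abs_mult using PQ by (intro mult_mono *) auto
      also have "\<dots> = (2 * exp 2) * (2 * exp 2) * exp (k * (sqrt P + sqrt Q) * sqrt r)"
        by (simp add: real_sqrt_mult exp_add[symmetric] algebra_simps)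
      finally show ?thesis .
    qed
    have G: "homogeneous_zero G"
      unfolding G_def[abs_def] C_def using \<omega>(2) \<eta>(2) \<nu>(2) by (rule homogeneous_zero_Gegenbauer)
    show "integrable lborel (\<lambda>\<xi>. A P \<omega> m \<xi> * A Q \<eta> n \<xi> * W \<xi>)"
      unfolding eq by (rule heat_weight_integrable[OF a(1) \<nu>_DIM \<nu>(3) t f f_bound G])
    have "(\<integral>\<xi>. A P \<omega> m \<xi> * A Q \<eta> n \<xi> * W \<xi> \<partial>lborel) = angular_integral G * (real DIM(real ^ 'n) / a) *
       (\<integral>r. indicator {0<..} r * (f r * exp (- (\<tau> * r)) * r powr (2 / a * \<nu>)) \<partial>lborel)"
      unfolding eq \<tau>_def by (rule heat_weight_integral[OF a(1) \<nu>_DIM \<nu>(3) t f f_bound G])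
    moreover have "angular_integral G = (if m = n then angular_integral (\<lambda>_::real ^ 'n. 1) * C m (\<omega> \<bullet> \<eta>) else 0)"
      unfolding G_def[abs_def] C_def \<nu>_DIM using \<omega>(2) \<eta>(2) by (rule angular_integral_Gegenbauer)
    moreover have "(\<integral>r. indicator {0<..} r * (f r * exp (- (\<tau> * r)) * r powr (2 / a * \<nu>)) \<partial>lborel) =
      exp (- ((P + Q) / \<tau>)) / \<tau> powr (2 / a * \<nu> + 1) * Bessel_term (2 / a) \<nu> V (V\<^sup>2) m" if "m = n"
      unfolding f_def that V_def by (rule radial_part_product_integral[OF a(1) \<nu>(3) PQ \<tau>])
    ultimately show "(\<integral>\<xi>. A P \<omega> m \<xi> * A Q \<eta> n \<xi> * W \<xi> \<partial>lborel) = (if m = n then J * q m else 0)"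
      by (simp add: J_def q_def mult_ac)
  qed
  have h_int: "(\<integral>\<xi>. h K \<xi> \<partial>lborel) = of_real (J * (\<Sum>m<K. q m))" for K
  proof -
    have "h K \<xi> = (\<Sum>m<K. \<Sum>n<K. cnj (\<epsilon> m) * \<epsilon> n * of_real (A P \<omega> m \<xi> * A Q \<eta> n \<xi> * W \<xi>))" for \<xi>
      unfolding h_def S_def cnj_sum sum_product sum_distrib_right
      by (intro sum.cong refl) (simp add: sum_distrib_left sum_distrib_right mult_ac)
    then have "(\<integral>\<xi>. h K \<xi> \<partial>lborel) =
       (\<integral>\<xi>. (\<Sum>m<K. \<Sum>n<K. cnj (\<epsilon> m) * \<epsilon> n * of_real (A P \<omega> m \<xi> * A Q \<eta> n \<xi> * W \<xi>)) \<partial>lborel)"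
      by (simp only:)
    also have "\<dots> = (\<Sum>m<K. \<Sum>n<K. cnj (\<epsilon> m) * \<epsilon> n * of_real (\<integral>\<xi>. A P \<omega> m \<xi> * A Q \<eta> n \<xi> * W \<xi> \<partial>lborel))"
      using T(1) by (subst Bochner_Integration.integral_sum, force intro!: Bochner_Integration.integrable_sum integrable_mult_right integrable_of_real,
         intro sum.cong refl, subst Bochner_Integration.integral_sum) 
         (auto intro!: Bochner_Integration.integrable_sum integrable_mult_right integrable_of_real simp del: of_real_mult)
    also have "\<dots> = (\<Sum>m<K. \<Sum>n<K. if n = m then of_real (J * q m) else 0)"
      unfolding T(2)
      by (intro sum.cong refl) (auto simp: \<epsilon>_def cis_cnj cis_mult)
    also have "\<dots> = of_real (J * (\<Sum>m<K. q m))"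
      by (simp add: sum_distrib_left)
    finally show ?thesis .
  qed
  have V: "V \<ge> 0"
    using PQ \<tau> by (simp add: V_def)
  have "\<bar>\<omega> \<bullet> \<eta>\<bar> \<le> 1"
    using Cauchy_Schwarz_ineq2[of \<omega> \<eta>] \<omega>(2) \<eta>(2) by simp
  then have q_nonneg: "(\<Sum>m. q m) \<ge> 0"
    unfolding q_def C_def using a(1) \<nu> V by (intro Bessel_Gegenbauer_series_nonneg) auto
  have "summable q"
  proof (rule summable_comparison_test')
    show "summable (\<lambda>m. \<bar>Bessel_term (2 / a) \<nu> V (V\<^sup>2) m\<bar> * Gegenbauer_bound \<nu> m)"
      using a(1) \<nu> V by (intro summable_Bessel_Gegenbauer_bound) auto
    show "norm (q m) \<le> \<bar>Bessel_term (2 / a) \<nu> V (V\<^sup>2) m\<bar> * Gegenbauer_bound \<nu> m" for m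
      unfolding q_def C_def using abs_Gegenbauer_le[OF \<nu>(2) \<open>\<bar>\<omega> \<bullet> \<eta>\<bar> \<le> 1\<close>, of m] 
      by (simp add: abs_mult mult_left_mono)
  qed
  then have "(\<lambda>K. complex_of_real (J * (\<Sum>m<K. q m))) \<longlonglongrightarrow> of_real (J * (\<Sum>m. q m))"
    by (intro tendsto_intros summable_LIMSEQ)
  then have H_int: "(\<integral>\<xi>. H \<xi> \<partial>lborel) = of_real (J * (\<Sum>m. q m))"
    using lim unfolding h_int by (rule LIMSEQ_unique[rotated])
  have "J \<ge> 0"
    unfolding J_def angular_integral_def using a(1)
    by (intro mult_nonneg_nonneg divide_nonneg_nonneg Bochner_Integration.integral_nonneg) auto
  define \<gamma> where "\<gamma> = Gamma (2 / a * \<nu> + 1)"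
  have "?h \<xi> = of_real (\<gamma> * \<gamma>) * H \<xi>" for \<xi>
  proof -
    have "B_kernel a x \<xi> = of_real \<gamma> * L P \<omega> \<xi>" "B_kernel a y \<xi> = of_real \<gamma> * L Q \<eta> \<xi>"
      unfolding \<gamma>_def L_def A_def \<epsilon>_def P_def Q_def z_def C_def
      using B_kernel_eq[OF a(1) \<nu>(3) \<omega> \<nu>_def, of \<xi>] B_kernel_eq[OF a(1) \<nu>(3) \<eta> \<nu>_def, of \<xi>] by auto
    then show ?thesis
      unfolding heat_weight_eq[OF a(1)] H_def W_def z_def by simp
  qed
  then have "integral\<^sup>L lborel ?h = (\<integral>\<xi>. of_real (\<gamma> * \<gamma>) * H \<xi> \<partial>lborel)"
    by (intro Bochner_Integration.integral_cong) auto
  also have "\<dots> = of_real (\<gamma> * \<gamma> * (J * (\<Sum>m. q m)))"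
    by (simp add: H_int)
  finally show ?thesis
    using q_nonneg \<open>J \<ge> 0\<close> by (simp only: nonneg_Reals_of_real_iff) auto
qed

theorem corollary4p21:
  fixes x y :: "real ^ 'n" and a t :: real
  assumes "a > max 0 (2 - real CARD('n))" and "t > 0"
  shows "heat_kernel a x y t \<in> \<real>\<^sub>\<ge>\<^sub>0"
proof -
  have "a > 0" "a > 2 - real CARD('n)"
    using assms by auto
  \<comment> \<open>The left side is (N - 2)/a, so this is a > 2 - N divided by a.\<close>
  then have "2 / a * ((real CARD('n) - 2) / 2) > -1"
    by (simp add: field_simps)
  moreover have "c_const TYPE('n) a \<ge> 0"
    unfolding c_const_def by (simp add: Bochner_Integration.integral_nonneg)
  ultimately show ?thesis
    unfolding heat_kernel_def using \<open>a > 0\<close> assms(2)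
    by (intro nonneg_Reals_mult_I heat_integral_nonneg) auto
qed

end
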